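(* Let $G=\mathbb{Z}^2\rtimes\mathbb{F}_2$, where $\mathbb{F}_2$ is the (free) subgroup of $\mathrm{SL}(2,\mathbb{Z})$ generated by $v_1=\begin{bmatrix}1&2\\0&1\end{bmatrix}$ and $v_2=\begin{bmatrix}1&0\\2&1\end{bmatrix}$, acting on $\mathbb{Z}^2$ in the canonical way, and let $\sigma\in Z^2(G,\mathbb{T})$ be the 2-cocycle determined by $\mu_0,\mu_1,\mu_2\in\mathbb{T}$ (as specified in the context). Then the following conditions are equivalent: (i) $(G,\sigma)$ is $C^*$-simple. (ii) $(G,\sigma)$ has the unique trace property. (iii) At least one of $\mu_0,\mu_1,\mu_2$ is nontorsion.
   Context: The product in $G$ is $(a,x)(b,y)=(a+x\cdot b,xy)$ for $a,b\in\mathbb{Z}^2$, $x,y\in\mathbb{F}_2$. Given $\mu_0,\mu_1,\mu_2\in\mathbb{T}$, the associated 2-cocycle is $\sigma((a,x),(b,y))=\sigma_0(a,x\cdot b)\,g(b,x)$, where $\sigma_0((a_1,a_2),(b_1,b_2))=\mu_0^{\frac12(a_1b_2-a_2b_1)}$ (for a fixed square root $\mu_0^{1/2}$ of $\mu_0$), and $g:\mathbb{Z}^2\times\mathbb{F}_2\to\mathbb{T}$ is the unique function satisfying $g(a+b,x)=g(a,x)g(b,x)$, $g(a,xy)=g(y\cdot a,x)g(a,y)$, $g(0,x)=g(a,1)=1$ for all $a,b\in\mathbb{Z}^2$, $x,y\in\mathbb{F}_2$ (with $1$ the identity of $\mathbb{F}_2$), $g(e_1,v_2)=g(e_2,v_1)=1$,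 $g(e_1,v_1)=\mu_1$, $g(e_2,v_2)=\mu_2$, where $e_1=(1,0)$, $e_2=(0,1)$. (Every normalized 2-cocycle on $G$ is similar to one of this form, i.e. equal to it up to multiplication by a coboundary.) An element of $\mathbb{T}$ is nontorsion if it is not a root of unity. For a discrete group $G$ with identity $e$, $Z^2(G,\mathbb{T})$ is the set of maps $\sigma:G\times G\to\mathbb{T}$ with $\sigma(g,e)=\sigma(e,g)=1$ and $\sigma(g,h)\sigma(gh,k)=\sigma(h,k)\sigma(g,hk)$ for all $g,h,k$. With $(\lambda_\sigma(g)\xi)(h)=\sigma(g,g^{-1}h)\xi(g^{-1}h)$ on $\ell^2(G)$, $C_r^*(G,\sigma)$ is the C$^*$-algebra generated by $\lambda_\sigma(G)$. $(G,\sigma)$ is $C^*$-simple if $C_r^*(G,\sigma)$ is simple, and has the unique trace property if $C_r^*(G,\sigma)$ has a unique tracial state. *)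

theory Defs
  imports "HOL-Analysis.Analysis" "HOL-Library.Nonpos_Ints" "HOL-Algebra.Generated_Groups"
begin

section \<open>The complex Hilbert space of square-summable functions\<close>

typedef 'g ell2 = "{\<xi> :: 'g \<Rightarrow> complex. (\<lambda>h. (cmod (\<xi> h))\<^sup>2) summable_on UNIV}"
  morphisms ell2_at Abs_ell2
  by (rule exI[of _ "\<lambda>_. 0"]) simp

setup_lifting type_definition_ell2

lemma ell2_summable: "(\<lambda>h. (cmod (ell2_at \<xi> h))\<^sup>2) summable_on UNIV"
  using ell2_at[of \<xi>] by simp

lemma square_add_le: "(cmod (a + b))\<^sup>2 \<le> 2 * (cmod a)\<^sup>2 + 2 * (cmod b)\<^sup>2"
proof -
  have "(cmod (a + b))\<^sup>2 \<le> (cmod a + cmod b)\<^sup>2"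
    by (intro power_mono norm_triangle_ineq) auto
  also have "\<dots> \<le> 2 * (cmod a)\<^sup>2 + 2 * (cmod b)\<^sup>2"
    using sum_squares_bound[of "cmod a" "cmod b"] by (simp add: power2_sum)
  finally show ?thesis .
qed

lemma square_summable_add:
  assumes "(\<lambda>h. (cmod (\<xi> h))\<^sup>2) summable_on UNIV" "(\<lambda>h. (cmod (\<eta> h))\<^sup>2) summable_on UNIV"
  shows "(\<lambda>h. (cmod (\<xi> h + \<eta> h))\<^sup>2) summable_on UNIV"
proof (rule summable_on_comparison_test)
  show "(\<lambda>h. 2 * (cmod (\<xi> h))\<^sup>2 + 2 * (cmod (\<eta> h))\<^sup>2) summable_on UNIV"
    by (intro summable_on_add summable_on_cmult_right assms)
qed (auto simp: square_add_le)

lemma square_summable_scale: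
  assumes "(\<lambda>h. (cmod (\<xi> h))\<^sup>2) summable_on UNIV"
  shows "(\<lambda>h. (cmod (c * \<xi> h))\<^sup>2) summable_on UNIV"
  by (simp add: norm_mult power_mult_distrib summable_on_cmult_right assms)

definition cinner :: "'g ell2 \<Rightarrow> 'g ell2 \<Rightarrow> complex" where
  "cinner \<xi> \<eta> = (\<Sum>\<^sub>\<infinity>h. ell2_at \<xi> h * cnj (ell2_at \<eta> h))"

lemma cinner_summable: "(\<lambda>h. ell2_at \<xi> h * cnj (ell2_at \<eta> h)) summable_on UNIV"
proof (rule Infinite_Sum.abs_summable_summable, rule Infinite_Sum.abs_summable_on_comparison_test)
  show "(\<lambda>h. norm ((cmod (ell2_at \<xi> h))\<^sup>2 + (cmod (ell2_at \<eta> h))\<^sup>2)) summable_on UNIV"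
    using summable_on_add[OF ell2_summable[of \<xi>] ell2_summable[of \<eta>]] by simp
next
  fix h
  have "2 * (cmod (ell2_at \<xi> h) * cmod (ell2_at \<eta> h))
      \<le> (cmod (ell2_at \<xi> h))\<^sup>2 + (cmod (ell2_at \<eta> h))\<^sup>2"
    using sum_squares_bound[of "cmod (ell2_at \<xi> h)" "cmod (ell2_at \<eta> h)"] by simp
  moreover have "0 \<le> cmod (ell2_at \<xi> h) * cmod (ell2_at \<eta> h)" by simp
  ultimately show "cmod (ell2_at \<xi> h * cnj (ell2_at \<eta> h))
      \<le> norm ((cmod (ell2_at \<xi> h))\<^sup>2 + (cmod (ell2_at \<eta> h))\<^sup>2)"
    unfolding norm_mult complex_mod_cnj real_norm_def by linarith
qed

instantiation ell2 :: (type) real_inner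
begin

lift_definition zero_ell2 :: "'a ell2" is "\<lambda>_. 0" by simp
lift_definition plus_ell2 :: "'a ell2 \<Rightarrow> 'a ell2 \<Rightarrow> 'a ell2" is "\<lambda>\<xi> \<eta> h. \<xi> h + \<eta> h"
  by (rule square_summable_add)
lift_definition uminus_ell2 :: "'a ell2 \<Rightarrow> 'a ell2" is "\<lambda>\<xi> h. - \<xi> h" by simp
lift_definition minus_ell2 :: "'a ell2 \<Rightarrow> 'a ell2 \<Rightarrow> 'a ell2" is "\<lambda>\<xi> \<eta> h. \<xi> h - \<eta> h"
  using square_summable_add[where \<eta> = "\<lambda>h. - \<eta> h" for \<eta>] by simp
lift_definition scaleR_ell2 :: "real \<Rightarrow> 'a ell2 \<Rightarrow> 'a ell2" is "\<lambda>r \<xi> h. complex_of_real r * \<xi> h"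
  by (rule square_summable_scale)

definition "inner \<xi> (\<eta> :: 'a ell2) = Re (cinner \<xi> \<eta>)"
definition "norm (\<xi> :: 'a ell2) = sqrt (inner \<xi> \<xi>)"
definition "dist \<xi> (\<eta> :: 'a ell2) = norm (\<xi> - \<eta>)"
definition "sgn (\<xi> :: 'a ell2) = scaleR (inverse (norm \<xi>)) \<xi>"
definition "uniformity = (INF e\<in>{0 <..}. principal {(\<xi> :: 'a ell2, \<eta>). dist \<xi> \<eta> < e})"
definition "open (U :: 'a ell2 set) \<longleftrightarrow> (\<forall>\<xi>\<in>U. \<forall>\<^sub>F (\<xi>', \<eta>) in uniformity. \<xi>' = \<xi> \<longrightarrow> \<eta> \<in> U)"

lemma inner_self_ell2: "inner \<xi> \<xi> = (\<Sum>\<^sub>\<infinity>h. (cmod (ell2_at \<xi> h))\<^sup>2)" for \<xi> :: "'a ell2"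
proof -
  have "Re (cinner \<xi> \<xi>) = (\<Sum>\<^sub>\<infinity>h. Re (ell2_at \<xi> h * cnj (ell2_at \<xi> h)))"
    unfolding cinner_def by (rule infsum_Re[symmetric, OF cinner_summable])
  then show ?thesis by (simp add: inner_ell2_def cmod_power2) (simp add: power2_eq_square)
qed

instance
proof
  fix a b c :: "'a ell2" and r s :: real
  show "a + b + c = a + (b + c)" by transfer (simp add: add.assoc)
  show "a + b = b + a" by transfer (simp add: add.commute)
  show "0 + a = a" by transfer simp
  show "- a + a = 0" by transfer simp
  show "a - b = a + - b" by transfer simp
  show "r *\<^sub>R (a + b) = r *\<^sub>R a + r *\<^sub>R b" by transfer (simp add: distrib_left)
  show "(r + s) *\<^sub>R a = r *\<^sub>R a + s *\<^sub>R a" by transfer (simp add: distrib_right)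
  show "r *\<^sub>R s *\<^sub>R a = (r * s) *\<^sub>R a" by transfer (simp add: mult.assoc)
  show "1 *\<^sub>R a = a" by transfer simp
  show "sgn a = scaleR (inverse (norm a)) a" by (rule sgn_ell2_def)
  show "dist a b = norm (a - b)" by (rule dist_ell2_def)
  show "uniformity = (INF e\<in>{0 <..}. principal {(x :: 'a ell2, y). dist x y < e})"
    by (rule uniformity_ell2_def)
  show "open U = (\<forall>x\<in>U. \<forall>\<^sub>F (x', y) in uniformity. x' = x \<longrightarrow> y \<in> U)" for U :: "'a ell2 set"
    by (rule open_ell2_def)
  have "cinner b a = cnj (cinner a b)"
    unfolding cinner_def infsum_cnj[symmetric] by (simp add: mult.commute)
  then show "inner a b = inner b a" by (simp add: inner_ell2_def)
  have "cinner (a + b) c = cinner a c + cinner b c"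
    unfolding cinner_def infsum_add[OF cinner_summable cinner_summable, symmetric]
    by (simp add: plus_ell2.rep_eq distrib_right)
  then show "inner (a + b) c = inner a c + inner b c" by (simp add: inner_ell2_def)
  have "cinner (r *\<^sub>R a) b = complex_of_real r * cinner a b"
    unfolding cinner_def
    by (subst infsum_cmult_right'[symmetric]) (simp add: scaleR_ell2.rep_eq mult.assoc)
  then show "inner (r *\<^sub>R a) b = r * inner a b" by (simp add: inner_ell2_def)
  show "0 \<le> inner a a" unfolding inner_self_ell2 by (rule infsum_nonneg) simp
  show "(inner a a = 0) = (a = 0)"
  proof
    assume *: "inner a a = 0"
    have "(cmod (ell2_at a h))\<^sup>2 = 0" for h
      by (rule nonneg_infsum_le_0D[where A = UNIV])
        (use * ell2_summable[of a] in \<open>auto simp: inner_self_ell2\<close>)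
    then have "ell2_at a = ell2_at 0" by (auto simp: zero_ell2.rep_eq)
    then show "a = 0" by (simp add: ell2_at_inject)
  qed (simp add: inner_self_ell2 zero_ell2.rep_eq)
  show "norm a = sqrt (inner a a)" by (rule norm_ell2_def)
qed

end

lift_definition scaleC :: "complex \<Rightarrow> 'g ell2 \<Rightarrow> 'g ell2" is "\<lambda>c \<xi> h. c * \<xi> h"
  by (rule square_summable_scale)


section \<open>Concrete C*-algebras, ideals and tracial states\<close>

text \<open>
  A bounded function of the library type is only real-linear, so complex linearity is a
  separate condition. The library norm on it is the operator norm.
\<close>

type_synonym 'g op = "'g ell2 \<Rightarrow>\<^sub>L 'g ell2"

definition bounded_ops :: "'g op set" where
  "bounded_ops = {T :: 'g op. \<forall>c \<xi>. T (scaleC c \<xi>) = scaleC c (T \<xi>)}"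

lift_definition scalar_op :: "complex \<Rightarrow> 'g op" is scaleC
proof (rule bounded_linear_intro)
  fix c :: complex and \<xi> \<eta> :: "'g ell2" and r :: real
  show "scaleC c (\<xi> + \<eta>) = scaleC c \<xi> + scaleC c \<eta>" by transfer (simp add: distrib_left)
  show "scaleC c (r *\<^sub>R \<xi>) = r *\<^sub>R scaleC c \<xi>" by transfer (simp add: mult.left_commute)
  show "norm (scaleC c \<xi>) \<le> norm \<xi> * cmod c"
    by (simp add: norm_ell2_def inner_self_ell2 scaleC.rep_eq norm_mult power_mult_distrib
        infsum_cmult_right' real_sqrt_mult mult.commute)
qed

definition adj :: "'g op \<Rightarrow> 'g op" where
  "adj T = (THE S :: 'g op. \<forall>\<xi> \<eta>. cinner (T \<xi>) \<eta> = cinner \<xi> (S \<eta>))"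

definition complex_subspace :: "'g op set \<Rightarrow> bool" where
  "complex_subspace V \<longleftrightarrow>
     0 \<in> V \<and> (\<forall>S\<in>V. \<forall>T\<in>V. S + T \<in> V) \<and> (\<forall>c. \<forall>T\<in>V. scalar_op c o\<^sub>L T \<in> V)"

definition cstar_algebra :: "'g op set \<Rightarrow> bool" where
  "cstar_algebra A \<longleftrightarrow>
     A \<subseteq> bounded_ops \<and> complex_subspace A \<and> closed A \<and>
     (\<forall>S\<in>A. \<forall>T\<in>A. S o\<^sub>L T \<in> A) \<and> (\<forall>T\<in>A. adj T \<in> A)"

definition generated_cstar_algebra :: "'g op set \<Rightarrow> 'g op set" where
  "generated_cstar_algebra X = \<Inter>{A. cstar_algebra A \<and> X \<subseteq> A}"

definition closed_ideal :: "'g op set \<Rightarrow> 'g op set \<Rightarrow> bool" where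
  "closed_ideal J A \<longleftrightarrow>
     J \<subseteq> A \<and> complex_subspace J \<and> closed J \<and> (\<forall>S\<in>A. \<forall>T\<in>J. S o\<^sub>L T \<in> J \<and> T o\<^sub>L S \<in> J)"

definition simple_algebra :: "'g op set \<Rightarrow> bool" where
  "simple_algebra A \<longleftrightarrow> A \<noteq> {0} \<and> (\<forall>J. closed_ideal J A \<longrightarrow> J = {0} \<or> J = A)"

text \<open>
  For algebras containing the identity operator. A functional on \<open>A\<close> is represented by
  an extensional function, so that equality of functionals is equality on \<open>A\<close>.
\<close>

definition tracial_state :: "'g op set \<Rightarrow> ('g op \<Rightarrow> complex) \<Rightarrow> bool" where
  "tracial_state A \<tau> \<longleftrightarrow>
     \<tau> \<in> extensional A \<and>
     (\<forall>S\<in>A. \<forall>T\<in>A. \<tau> (S + T) = \<tau> S + \<tau> T) \<and>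
     (\<forall>c. \<forall>T\<in>A. \<tau> (scalar_op c o\<^sub>L T) = c * \<tau> T) \<and>
     (\<forall>T\<in>A. \<tau> (adj T o\<^sub>L T) \<in> \<real>\<^sub>\<ge>\<^sub>0) \<and>
     \<tau> id_blinfun = 1 \<and>
     (\<forall>S\<in>A. \<forall>T\<in>A. \<tau> (S o\<^sub>L T) = \<tau> (T o\<^sub>L S))"


section \<open>Reduced twisted group C*-algebras\<close>

text \<open>
  Discrete groups are types of class \<^class>\<open>group_add\<close>, the library's class of not necessarily
  commutative groups; the group operation is therefore written additively.
\<close>

definition two_cocycles :: "('g::group_add \<Rightarrow> 'g \<Rightarrow> complex) set" where
  "two_cocycles = {\<sigma>. (\<forall>g h. cmod (\<sigma> g h) = 1) \<and> (\<forall>g. \<sigma> g 0 = 1 \<and> \<sigma> 0 g = 1) \<and>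
            (\<forall>g h k. \<sigma> g h * \<sigma> (g + h) k = \<sigma> h k * \<sigma> g (h + k))}"

definition regular_rep :: "('g::group_add \<Rightarrow> 'g \<Rightarrow> complex) \<Rightarrow> 'g \<Rightarrow> 'g op" where
  "regular_rep \<sigma> g =
     Blinfun (\<lambda>\<xi>. Abs_ell2 (\<lambda>h. \<sigma> g (- g + h) * ell2_at \<xi> (- g + h)))"

text \<open>
  For unimodular \<open>\<sigma>\<close> the function to which \<open>Blinfun\<close> is applied is indeed well defined and
  bounded linear, so \<open>regular_rep\<close> acts by the expected formula:
\<close>

lemma regular_rep_apply:
  fixes \<sigma> :: "'g::group_add \<Rightarrow> 'g \<Rightarrow> complex"
  assumes "\<sigma> \<in> two_cocycles"
  shows "ell2_at (regular_rep \<sigma> g \<xi>) h = \<sigma> g (- g + h) * ell2_at \<xi> (- g + h)"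
proof -
  define F where "F = (\<lambda>\<xi> h. \<sigma> g (- g + h) * ell2_at \<xi> (- g + h))"
  have b: "bij_betw (\<lambda>h. - g + h) UNIV UNIV"
    by (rule bij_betwI[where g = "\<lambda>h. g + h"]) (auto simp: add.assoc[symmetric])
  have n: "cmod (F \<xi> h) = cmod (ell2_at \<xi> (- g + h))" for \<xi> h
    using assms by (simp add: F_def two_cocycles_def norm_mult)
  have s: "(\<lambda>h. (cmod (F \<xi> h))\<^sup>2) summable_on UNIV" for \<xi>
    unfolding n
    using summable_on_reindex_bij_betw[OF b, of "\<lambda>h. (cmod (ell2_at \<xi> h))\<^sup>2"]
      ell2_summable[of \<xi>] by simp
  have at: "ell2_at (Abs_ell2 (F \<xi>)) = F \<xi>" for \<xi>
    using s by (simp add: Abs_ell2_inverse)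
  have "bounded_linear (\<lambda>\<xi>. Abs_ell2 (F \<xi>))"
  proof (rule bounded_linear_intro[where K = 1])
    fix \<xi> \<eta> :: "'g ell2" and r :: real
    show "Abs_ell2 (F (\<xi> + \<eta>)) = Abs_ell2 (F \<xi>) + Abs_ell2 (F \<eta>)"
      unfolding ell2_at_inject[symmetric] plus_ell2.rep_eq at
      by (simp add: F_def plus_ell2.rep_eq distrib_left)
    show "Abs_ell2 (F (r *\<^sub>R \<xi>)) = r *\<^sub>R Abs_ell2 (F \<xi>)"
      unfolding ell2_at_inject[symmetric] scaleR_ell2.rep_eq at
      by (simp add: F_def scaleR_ell2.rep_eq mult.left_commute)
    show "norm (Abs_ell2 (F \<xi>)) \<le> norm \<xi> * 1"
      unfolding norm_ell2_def inner_self_ell2 at n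
      using infsum_reindex_bij_betw[OF b, of "\<lambda>h. (cmod (ell2_at \<xi> h))\<^sup>2"] by simp
  qed
  moreover have "regular_rep \<sigma> g = Blinfun (\<lambda>\<xi>. Abs_ell2 (F \<xi>))"
    unfolding regular_rep_def F_def ..
  ultimately show ?thesis
    by (simp add: bounded_linear_Blinfun_apply at) (simp add: F_def)
qed

definition reduced_cstar_algebra :: "('g::group_add \<Rightarrow> 'g \<Rightarrow> complex) \<Rightarrow> 'g op set" where
  "reduced_cstar_algebra \<sigma> = generated_cstar_algebra (range (regular_rep \<sigma>))"

definition cstar_simple :: "('g::group_add \<Rightarrow> 'g \<Rightarrow> complex) \<Rightarrow> bool" where
  "cstar_simple \<sigma> \<longleftrightarrow> simple_algebra (reduced_cstar_algebra \<sigma>)"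

definition unique_trace_property :: "('g::group_add \<Rightarrow> 'g \<Rightarrow> complex) \<Rightarrow> bool" where
  "unique_trace_property \<sigma> \<longleftrightarrow> (\<exists>!\<tau>. tracial_state (reduced_cstar_algebra \<sigma>) \<tau>)"


section \<open>The group and its cocycles\<close>

definition SL2Z :: "(int^2^2) monoid" where
  "SL2Z = \<lparr>carrier = {A. det A = 1}, mult = (**), one = mat 1\<rparr>"

definition v1 :: "int^2^2" where "v1 = vector [vector [1, 2], vector [0, 1]]"
definition v2 :: "int^2^2" where "v2 = vector [vector [1, 0], vector [2, 1]]"
definition e1 :: "int^2" where "e1 = vector [1, 0]"
definition e2 :: "int^2" where "e2 = vector [0, 1]"

definition F2 :: "(int^2^2) set" where "F2 = generate SL2Z {v1, v2}"

lemma group_SL2Z: "group SL2Z"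
proof (rule groupI)
  fix A assume A: "A \<in> carrier SL2Z"
  define B :: "int^2^2" where "B = vector [vector [A$2$2, - A$1$2], vector [- A$2$1, A$1$1]]"
  have "det B = 1" "B ** A = mat 1"
    using A by (auto simp: SL2Z_def det_2 B_def vec_eq_iff forall_2 matrix_matrix_mult_def sum_2
        mat_def algebra_simps)
  then show "\<exists>B\<in>carrier SL2Z. B \<otimes>\<^bsub>SL2Z\<^esub> A = \<one>\<^bsub>SL2Z\<^esub>" by (auto simp: SL2Z_def)
qed (auto simp: SL2Z_def det_mul matrix_mul_assoc)

lemma subgroup_F2: "subgroup F2 SL2Z"
  unfolding F2_def
  by (rule group.generate_is_subgroup[OF group_SL2Z]) (auto simp: SL2Z_def v1_def v2_def det_2)

typedef Z2F2 = "(UNIV :: (int^2) set) \<times> F2"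
  using subgroup.one_closed[OF subgroup_F2] by auto

setup_lifting type_definition_Z2F2

instantiation Z2F2 :: group_add
begin

lift_definition zero_Z2F2 :: Z2F2 is "(0, mat 1)"
  using subgroup.one_closed[OF subgroup_F2] by (simp add: SL2Z_def)

lift_definition plus_Z2F2 :: "Z2F2 \<Rightarrow> Z2F2 \<Rightarrow> Z2F2" is
  "\<lambda>(a, x) (b, y). (a + x *v b, x ** y)"
  using subgroup.m_closed[OF subgroup_F2] by (auto simp: SL2Z_def)

lift_definition uminus_Z2F2 :: "Z2F2 \<Rightarrow> Z2F2" is
  "\<lambda>(a, x). (- (inv\<^bsub>SL2Z\<^esub> x *v a), inv\<^bsub>SL2Z\<^esub> x)"
  using subgroup.m_inv_closed[OF subgroup_F2] by auto

definition "g - h = g + - h" for g h :: Z2F2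

instance
proof
  fix g h k :: Z2F2
  show "g + h + k = g + (h + k)"
    by transfer (auto simp: matrix_vector_right_distrib matrix_vector_mul_assoc matrix_mul_assoc
        add.assoc)
  show "0 + g = g" by transfer auto
  show "g + 0 = g" by transfer auto
  have l: "inv\<^bsub>SL2Z\<^esub> x ** x = mat 1" if "x \<in> F2" for x
    using group.l_inv[OF group_SL2Z, of x] subgroup.mem_carrier[OF subgroup_F2 that]
    by (simp add: SL2Z_def)
  show "- g + g = 0" by transfer (auto simp: l)
  show "g + - h = g - h" by (simp add: minus_Z2F2_def)
qed

end

text \<open>The argument \<open>r\<close> is the chosen square root of \<open>\<mu>\<^sub>0\<close>.\<close>

definition sigma0 :: "complex \<Rightarrow> int^2 \<Rightarrow> int^2 \<Rightarrow> complex" where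
  "sigma0 r a b = r powi (a$1 * b$2 - a$2 * b$1)"

text \<open>Only the values \<open>g a x\<close> with \<open>x \<in> F2\<close> are meaningful.\<close>

definition is_g :: "complex \<Rightarrow> complex \<Rightarrow> (int^2 \<Rightarrow> int^2^2 \<Rightarrow> complex) \<Rightarrow> bool" where
  "is_g \<mu>\<^sub>1 \<mu>\<^sub>2 g \<longleftrightarrow>
     (\<forall>a. \<forall>x\<in>F2. cmod (g a x) = 1) \<and>
     (\<forall>a b. \<forall>x\<in>F2. g (a + b) x = g a x * g b x) \<and>
     (\<forall>a. \<forall>x\<in>F2. \<forall>y\<in>F2. g a (x ** y) = g (y *v a) x * g a y) \<and>
     (\<forall>x\<in>F2. g 0 x = 1) \<and> (\<forall>a. g a (mat 1) = 1) \<and>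
     g e1 v2 = 1 \<and> g e2 v1 = 1 \<and> g e1 v1 = \<mu>\<^sub>1 \<and> g e2 v2 = \<mu>\<^sub>2"

definition cocycle :: "complex \<Rightarrow> (int^2 \<Rightarrow> int^2^2 \<Rightarrow> complex) \<Rightarrow> Z2F2 \<Rightarrow> Z2F2 \<Rightarrow> complex" where
  "cocycle r g p q =
     (case (Rep_Z2F2 p, Rep_Z2F2 q) of ((a, x), (b, y)) \<Rightarrow> sigma0 r a (x *v b) * g b x)"

lemma cocycle_in_two_cocycles:
  assumes r: "cmod r = 1" and g: "is_g \<mu>\<^sub>1 \<mu>\<^sub>2 g"
  shows "cocycle r g \<in> two_cocycles"
proof -
  have r0: "r \<noteq> 0" using r by auto
  have s_add: "sigma0 r (a + b) c = sigma0 r a c * sigma0 r b c"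
              "sigma0 r c (a + b) = sigma0 r c a * sigma0 r c b" for a b c
    using r0 by (simp_all add: sigma0_def power_int_add[symmetric] algebra_simps)
  have s_inv: "sigma0 r (x *v a) (x *v b) = sigma0 r a b" if "x \<in> F2" for x a b
  proof -
    have d: "x$1$1 * x$2$2 - x$1$2 * x$2$1 = 1"
      using subgroup.mem_carrier[OF subgroup_F2 that] by (simp add: SL2Z_def det_2)
    have "(x *v a)$1 * (x *v b)$2 - (x *v a)$2 * (x *v b)$1
        = (x$1$1 * x$2$2 - x$1$2 * x$2$1) * (a$1 * b$2 - a$2 * b$1)"
      by (simp add: matrix_vector_mult_def sum_2 algebra_simps)
    then show ?thesis by (simp add: sigma0_def d)
  qed
  have s_norm: "cmod (sigma0 r a b) = 1" for a b
    using r by (simp add: sigma0_def norm_power_int)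
  have [simp]: "sigma0 r 0 b = 1" "sigma0 r a 0 = 1" for a b
    by (simp_all add: sigma0_def)
  have one: "mat 1 \<in> F2" using subgroup.one_closed[OF subgroup_F2] by (simp add: SL2Z_def)
  have Rep: "\<exists>a x. Rep_Z2F2 p = (a, x) \<and> x \<in> F2" for p
    using Rep_Z2F2[of p] by (metis mem_Sigma_iff surj_pair)
  have "cmod (cocycle r g p q) = 1" for p q
    using Rep[of p] Rep[of q] g by (auto simp: cocycle_def norm_mult s_norm is_g_def)
  moreover have "cocycle r g p 0 = 1 \<and> cocycle r g 0 p = 1" for p
    using Rep[of p] g by (auto simp: cocycle_def zero_Z2F2.rep_eq is_g_def)
  moreover have "cocycle r g p q * cocycle r g (p + q) k = cocycle r g q k * cocycle r g p (q + k)"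
    for p q k
  proof -
    obtain a x b y c z where *: "Rep_Z2F2 p = (a, x)" "Rep_Z2F2 q = (b, y)" "Rep_Z2F2 k = (c, z)"
      and F: "x \<in> F2" "y \<in> F2" "z \<in> F2"
      using Rep[of p] Rep[of q] Rep[of k] by blast
    have g1: "g c (x ** y) = g (y *v c) x * g c y"
      and g2: "g (b + y *v c) x = g b x * g (y *v c) x"
      using g F by (auto simp: is_g_def)
    have "sigma0 r (x *v b) ((x ** y) *v c) = sigma0 r b (y *v c)"
      using s_inv[OF F(1)] by (simp add: matrix_vector_mul_assoc[symmetric])
    then show ?thesis
      by (simp add: cocycle_def plus_Z2F2.rep_eq * s_add g1 g2 matrix_vector_right_distrib
          matrix_vector_mul_assoc)
  qed
  ultimately show ?thesis unfolding two_cocycles_def by blast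
qed

definition nontorsion :: "complex \<Rightarrow> bool" where
  "nontorsion \<mu> \<longleftrightarrow> \<not> (\<exists>n::nat. n > 0 \<and> \<mu> ^ n = 1)"

end

theory Submission
  imports Defs
begin

text \<open>
  Let \<open>A\<close> be the algebra generated by the operators \<open>L g\<close>, with canonical trace
  \<open>T \<mapsto> \<langle>T \<delta>\<^sub>0, \<delta>\<^sub>0\<rangle>\<close>.

  If some \<open>\<mu>\<^sub>i\<close> is nontorsion, then averages of the conjugates of an element \<open>T\<close> by generators come
  arbitrarily close in norm to the scalar given by the canonical trace of \<open>T\<close> (\<open>average_to_trace\<close>).
  A tracial state is invariant under such averages and bounded (\<open>tracial_state_bounded\<close>), so it
  equals the canonical trace; and a nonzero closed ideal contains a positive element of nonzero
  canonical trace, hence averages of it close to a nonzero scalar, hence the unit. By linearity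
  and density only the averages of finitely many generators \<open>L g\<close> with \<open>g \<noteq> 0\<close> have to be made small.

  Generators outside the lattice \<open>\<int>\<^sup>2\<close> are handled by Powers' argument (\<open>powers_average\<close>): a
  nontrivial element of \<open>F2\<close> fixes at most two points of the projective line, and parabolic elements
  contract the rest of the line towards their fixed point. The estimate holds for all values of
  the parameters (\<open>vanish_off_lattice\<close>). Generators in the lattice are
  handled by the phases (\<open>vanish_on_lattice\<close>). Conjugation by lattice vectors multiplies them by
  powers of \<open>\<mu>\<^sub>0\<close>. Conjugation by powers of \<open>v1\<close> acts on them as Furstenberg's skew product over the
  rotation by \<open>\<mu>\<^sub>1\<close> acts on the characters of the torus, and the averages are Weyl sums with quadratic phases, small by
  van der Corput's inequality (\<open>average_quadratic_phase_small\<close>); likewise for \<open>v2\<close> and \<open>\<mu>\<^sub>2\<close>.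

  If all \<open>\<mu>\<^sub>i\<close> are torsion, then for a suitable \<open>l > 0\<close> the cocycle is inflated from the quotient by the
  normal subgroup \<open>l \<int>\<^sup>2\<close>. This subgroup is amenable, so the vector states of Folner squares converge
  to a second trace, the canonical trace of the quotient, and the null space of that trace is a
  proper nonzero ideal (\<open>torsion_obstruction\<close>).
\<close>

section \<open>Square-summable functions as a complex Hilbert space\<close>

lemma ell2_eqI: "(\<And>h. ell2_at \<xi> h = ell2_at \<eta> h) \<Longrightarrow> \<xi> = \<eta>"
  by (simp add: ell2_at_inject[symmetric] fun_eq_iff)

lemma norm_ell2_sq: "(norm \<xi>)\<^sup>2 = (\<Sum>\<^sub>\<infinity>h. (cmod (ell2_at \<xi> h))\<^sup>2)"
  by (metis inner_self_ell2 power2_norm_eq_inner)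

lemma cinner_add_left: "cinner (\<xi> + \<eta>) \<zeta> = cinner \<xi> \<zeta> + cinner \<eta> \<zeta>"
  unfolding cinner_def infsum_add[OF cinner_summable cinner_summable, symmetric]
  by (simp add: plus_ell2.rep_eq distrib_right)

lemma cinner_commute: "cinner \<eta> \<xi> = cnj (cinner \<xi> \<eta>)"
  unfolding cinner_def infsum_cnj[symmetric] by (simp add: mult.commute)

lemma cinner_add_right: "cinner \<zeta> (\<xi> + \<eta>) = cinner \<zeta> \<xi> + cinner \<zeta> \<eta>"
  by (metis cinner_add_left cinner_commute complex_cnj_add)

lemma cinner_scaleC_left: "cinner (scaleC c \<xi>) \<eta> = c * cinner \<xi> \<eta>"
  unfolding cinner_def
  by (subst infsum_cmult_right'[symmetric]) (simp add: scaleC.rep_eq mult.assoc)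

lemma cinner_scaleC_right: "cinner \<xi> (scaleC c \<eta>) = cnj c * cinner \<xi> \<eta>"
  by (metis cinner_scaleC_left cinner_commute complex_cnj_mult)

lemma scaleR_scaleC: "r *\<^sub>R \<xi> = scaleC (complex_of_real r) \<xi>"
  by (rule ell2_eqI) (simp add: scaleR_ell2.rep_eq scaleC.rep_eq)

lemma uminus_scaleC: "- \<xi> = scaleC (- 1) \<xi>"
  by (rule ell2_eqI) (simp add: uminus_ell2.rep_eq scaleC.rep_eq)

lemma scaleC_scaleC [simp]: "scaleC a (scaleC b \<xi>) = scaleC (a * b) \<xi>"
  by (rule ell2_eqI) (simp add: scaleC.rep_eq mult.assoc)

lemma scaleC_simps [simp]: "scaleC 1 \<xi> = \<xi>" "scaleC 0 \<xi> = 0" "scaleC c 0 = 0"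
  by (rule ell2_eqI, simp add: scaleC.rep_eq zero_ell2.rep_eq)+

lemma scaleC_add: "scaleC c (\<xi> + \<eta>) = scaleC c \<xi> + scaleC c \<eta>"
  by (rule ell2_eqI) (simp add: scaleC.rep_eq plus_ell2.rep_eq distrib_left)

lemma scaleC_add_left: "scaleC (a + b) \<xi> = scaleC a \<xi> + scaleC b \<xi>"
  by (rule ell2_eqI) (simp add: scaleC.rep_eq plus_ell2.rep_eq distrib_right)

lemma scaleC_sum: "scaleC c (\<Sum>i\<in>I. f i) = (\<Sum>i\<in>I. scaleC c (f i))"
  by (induction I rule: infinite_finite_induct) (simp_all add: scaleC_add)

lemma cinner_minus_left: "cinner (\<xi> - \<eta>) \<zeta> = cinner \<xi> \<zeta> - cinner \<eta> \<zeta>"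
  using cinner_add_left[of "\<xi> - \<eta>" \<eta> \<zeta>] by simp

lemma cinner_minus_right: "cinner \<zeta> (\<xi> - \<eta>) = cinner \<zeta> \<xi> - cinner \<zeta> \<eta>"
  using cinner_add_right[of \<zeta> "\<xi> - \<eta>" \<eta>] by simp

lemma cinner_zero [simp]: "cinner 0 \<xi> = 0" "cinner \<xi> 0 = 0"
  by (simp_all add: cinner_def zero_ell2.rep_eq)

lemma cinner_sum_left: "cinner (\<Sum>i\<in>I. f i) \<eta> = (\<Sum>i\<in>I. cinner (f i) \<eta>)"
  by (induction I rule: infinite_finite_induct) (simp_all add: cinner_add_left)

lemma cinner_sum_right: "cinner \<eta> (\<Sum>i\<in>I. f i) = (\<Sum>i\<in>I. cinner \<eta> (f i))"
  by (induction I rule: infinite_finite_induct) (simp_all add: cinner_add_right)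

lemma cinner_self: "cinner \<xi> \<xi> = complex_of_real ((norm \<xi>)\<^sup>2)"
proof (rule complex_eqI)
  show "Re (cinner \<xi> \<xi>) = Re (complex_of_real ((norm \<xi>)\<^sup>2))"
    by (simp add: power2_norm_eq_inner inner_ell2_def)
  show "Im (cinner \<xi> \<xi>) = Im (complex_of_real ((norm \<xi>)\<^sup>2))"
    using cinner_commute[of \<xi> \<xi>] by (metis Im_complex_of_real cnj.simps(2) neg_equal_zero)
qed

lemma norm_scaleC [simp]: "norm (scaleC c \<xi>) = cmod c * norm \<xi>"
proof -
  have "(norm (scaleC c \<xi>))\<^sup>2 = (cmod c * norm \<xi>)\<^sup>2"
    by (simp add: norm_ell2_sq scaleC.rep_eq norm_mult power_mult_distrib infsum_cmult_right')
  then show ?thesis by simp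
qed

lemma cinner_cauchy_schwarz: "cmod (cinner \<xi> \<eta>) \<le> norm \<xi> * norm \<eta>"
proof (cases "cinner \<xi> \<eta> = 0")
  case False
  \<comment> \<open>Rotating \<open>\<xi>\<close> makes the complex inner product real, where the real inequality applies.\<close>
  define c where "c = cnj (sgn (cinner \<xi> \<eta>))"
  have "c * cinner \<xi> \<eta> = complex_of_real (cmod (cinner \<xi> \<eta>))"
    unfolding c_def sgn_eq using False
    by (simp add: complex_norm_square[symmetric] field_simps power2_eq_square)
  then have "inner (scaleC c \<xi>) \<eta> = cmod (cinner \<xi> \<eta>)"
    by (simp add: inner_ell2_def cinner_scaleC_left)
  moreover have "cmod c = 1" using False by (simp add: c_def norm_sgn)
  ultimately show ?thesis using norm_cauchy_schwarz[of "scaleC c \<xi>" \<eta>] by simp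
qed simp

lemma cmod_ell2_at_le: "cmod (ell2_at \<xi> h) \<le> norm \<xi>"
proof -
  have "(cmod (ell2_at \<xi> h))\<^sup>2 \<le> (norm \<xi>)\<^sup>2"
    unfolding norm_ell2_sq
    using finite_sum_le_infsum[OF ell2_summable[of \<xi>], of "{h}"] by simp
  then show ?thesis by (simp add: power2_le_iff_abs_le)
qed

lift_definition delta :: "'g \<Rightarrow> 'g ell2" is "\<lambda>k h. if h = k then 1 else 0"
  by (rule finite_nonzero_values_imp_summable_on) auto

lemma cinner_delta: "cinner \<xi> (delta k) = ell2_at \<xi> k"
proof -
  have "cinner \<xi> (delta k) = (\<Sum>\<^sub>\<infinity>h\<in>{k}. ell2_at \<xi> h * cnj (ell2_at (delta k) h))"
    unfolding cinner_def by (rule infsum_cong_neutral) (auto simp: delta.rep_eq)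
  then show ?thesis by (simp add: delta.rep_eq)
qed

lemma norm_delta [simp]: "norm (delta k) = 1"
  using cinner_self[of "delta k"] unfolding cinner_delta delta.rep_eq
  by (metis (full_types) norm_ge_zero of_real_eq_1_iff power2_eq_1_iff
      of_nat_0_le_iff not_one_le_zero neg_0_le_iff_le zero_neq_one le_minus_one_simps(3))

lift_definition supp_proj :: "'g set \<Rightarrow> 'g ell2 \<Rightarrow> 'g ell2" is "\<lambda>E \<xi> h. if h \<in> E then \<xi> h else 0"
proof -
  fix E :: "'g set" and \<xi> :: "'g \<Rightarrow> complex"
  assume "(\<lambda>h. (cmod (\<xi> h))\<^sup>2) summable_on UNIV"
  then show "(\<lambda>h. (cmod (if h \<in> E then \<xi> h else 0))\<^sup>2) summable_on UNIV"
    by (rule summable_on_comparison_test) auto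
qed

lemma norm_supp_proj: "norm (supp_proj E \<xi>) \<le> norm \<xi>"
proof -
  have "(norm (supp_proj E \<xi>))\<^sup>2 \<le> (norm \<xi>)\<^sup>2"
    unfolding norm_ell2_sq
    by (rule infsum_mono[OF ell2_summable ell2_summable]) (simp add: supp_proj.rep_eq)
  then show ?thesis by simp
qed

lemma has_sum_finite_sum:
  fixes f :: "'i \<Rightarrow> 'a \<Rightarrow> 'b::{topological_comm_monoid_add}"
  shows "(\<And>i. i \<in> I \<Longrightarrow> (f i has_sum s i) A) \<Longrightarrow> ((\<lambda>h. \<Sum>i\<in>I. f i h) has_sum (\<Sum>i\<in>I. s i)) A"
  by (induction I rule: infinite_finite_induct) (simp_all add: has_sum_add)

text \<open>Bessel's inequality for the projections onto pairwise disjoint supports.\<close>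

lemma sum_norm_supp_proj:
  assumes "finite I" "disjoint_family_on B I"
  shows "(\<Sum>i\<in>I. (norm (supp_proj (B i) \<xi>))\<^sup>2) \<le> (norm \<xi>)\<^sup>2"
proof -
  have p: "(\<Sum>i\<in>I. (cmod (ell2_at (supp_proj (B i) \<xi>) h))\<^sup>2) \<le> (cmod (ell2_at \<xi> h))\<^sup>2" for h
  proof (cases "\<exists>i\<in>I. h \<in> B i")
    case True
    then obtain i where i: "i \<in> I" "h \<in> B i" by blast
    have "(\<Sum>j\<in>I. (cmod (ell2_at (supp_proj (B j) \<xi>) h))\<^sup>2)
        = (\<Sum>j\<in>I. if j = i then (cmod (ell2_at \<xi> h))\<^sup>2 else 0)"
      using assms(2) i by (intro sum.cong) (auto simp: supp_proj.rep_eq disjoint_family_on_def)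
    then show ?thesis using assms(1) i by simp
  next
    case False
    then have "(\<Sum>j\<in>I. (cmod (ell2_at (supp_proj (B j) \<xi>) h))\<^sup>2) = 0"
      by (intro sum.neutral) (auto simp: supp_proj.rep_eq)
    then show ?thesis by simp
  qed
  have "((\<lambda>h. \<Sum>i\<in>I. (cmod (ell2_at (supp_proj (B i) \<xi>) h))\<^sup>2)
      has_sum (\<Sum>i\<in>I. (norm (supp_proj (B i) \<xi>))\<^sup>2)) UNIV"
    unfolding norm_ell2_sq by (intro has_sum_finite_sum has_sum_infsum ell2_summable)
  moreover have "((\<lambda>h. (cmod (ell2_at \<xi> h))\<^sup>2) has_sum (norm \<xi>)\<^sup>2) UNIV"
    unfolding norm_ell2_sq by (intro has_sum_infsum ell2_summable)
  ultimately show ?thesis using p by (rule has_sum_mono)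
qed

text \<open>
  Completeness is used for the limits of adjoints and for the square roots that bound positive
  functionals.
\<close>

instance ell2 :: (type) banach
proof
  fix X :: "nat \<Rightarrow> 'a ell2" assume X: "Cauchy X"
  have "Cauchy (\<lambda>n. ell2_at (X n) h)" for h
  proof (rule CauchyI)
    fix e :: real assume "e > 0"
    then obtain M where M: "\<forall>m\<ge>M. \<forall>n\<ge>M. norm (X m - X n) < e" using CauchyD[OF X] by blast
    have "norm (ell2_at (X m) h - ell2_at (X n) h) \<le> norm (X m - X n)" for m n
      using cmod_ell2_at_le[of "X m - X n" h] by (simp add: minus_ell2.rep_eq)
    then show "\<exists>M. \<forall>m\<ge>M. \<forall>n\<ge>M. norm (ell2_at (X m) h - ell2_at (X n) h) < e"
      using M by (meson order_le_less_trans)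
  qed
  then have "\<forall>h. \<exists>l. (\<lambda>n. ell2_at (X n) h) \<longlonglongrightarrow> l"
    by (simp add: Cauchy_convergent_iff convergent_def)
  then obtain f where f: "\<And>h. (\<lambda>n. ell2_at (X n) h) \<longlonglongrightarrow> f h" by metis
  \<comment> \<open>Finite partial sums of the tail are bounded uniformly, by passing to the limit in \<open>m\<close>.\<close>
  have tail: "\<exists>M. \<forall>n\<ge>M. \<forall>F. finite F \<longrightarrow> (\<Sum>h\<in>F. (cmod (ell2_at (X n) h - f h))\<^sup>2) \<le> e\<^sup>2"
    if e: "e > 0" for e
  proof -
    obtain M where M: "\<forall>m\<ge>M. \<forall>n\<ge>M. norm (X m - X n) < e" using CauchyD[OF X e] by blast
    have "(\<Sum>h\<in>F. (cmod (ell2_at (X n) h - f h))\<^sup>2) \<le> e\<^sup>2" if n: "n \<ge> M" and F: "finite F" for n F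
    proof (rule tendsto_upperbound)
      show "(\<lambda>m. \<Sum>h\<in>F. (cmod (ell2_at (X n) h - ell2_at (X m) h))\<^sup>2)
          \<longlonglongrightarrow> (\<Sum>h\<in>F. (cmod (ell2_at (X n) h - f h))\<^sup>2)"
        by (intro tendsto_intros f)
      show "\<forall>\<^sub>F m in sequentially. (\<Sum>h\<in>F. (cmod (ell2_at (X n) h - ell2_at (X m) h))\<^sup>2) \<le> e\<^sup>2"
        unfolding eventually_sequentially
      proof (intro exI allI impI)
        fix m assume m: "m \<ge> M"
        have "(\<Sum>h\<in>F. (cmod (ell2_at (X n - X m) h))\<^sup>2) \<le> (norm (X n - X m))\<^sup>2"
          unfolding norm_ell2_sq by (rule finite_sum_le_infsum[OF ell2_summable]) (use F in auto)
        also have "\<dots> \<le> e\<^sup>2" using M m n by (intro power_mono) (auto intro: less_imp_le)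
        finally show "(\<Sum>h\<in>F. (cmod (ell2_at (X n) h - ell2_at (X m) h))\<^sup>2) \<le> e\<^sup>2"
          by (simp add: minus_ell2.rep_eq)
      qed
    qed simp
    then show ?thesis by blast
  qed
  have diff: "(\<lambda>h. (cmod (ell2_at (X n) h - f h))\<^sup>2) summable_on UNIV"
    if "\<forall>F. finite F \<longrightarrow> (\<Sum>h\<in>F. (cmod (ell2_at (X n) h - f h))\<^sup>2) \<le> e\<^sup>2" for n e
    by (rule nonneg_bdd_above_summable_on) (use that in \<open>auto intro!: bdd_aboveI\<close>)
  obtain M where M: "\<forall>n\<ge>M. \<forall>F. finite F \<longrightarrow> (\<Sum>h\<in>F. (cmod (ell2_at (X n) h - f h))\<^sup>2) \<le> 1\<^sup>2"
    using tail[of 1] by auto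
  have "(\<lambda>h. (cmod (f h))\<^sup>2) summable_on UNIV"
  proof -
    have "(\<lambda>h. (cmod (f h - ell2_at (X M) h))\<^sup>2) summable_on UNIV"
      using diff[of M 1] M by (simp add: norm_minus_commute)
    from square_summable_add[OF this ell2_summable[of "X M"]] show ?thesis by simp
  qed
  then have at: "ell2_at (Abs_ell2 f) = f" by (simp add: Abs_ell2_inverse)
  have "X \<longlonglongrightarrow> Abs_ell2 f"
  proof (rule LIMSEQ_I)
    fix e :: real assume e: "e > 0"
    obtain N where N: "\<forall>n\<ge>N. \<forall>F. finite F \<longrightarrow> (\<Sum>h\<in>F. (cmod (ell2_at (X n) h - f h))\<^sup>2) \<le> (e/2)\<^sup>2"
      using tail[of "e/2"] e by auto
    have "norm (X n - Abs_ell2 f) < e" if n: "n \<ge> N" for n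
    proof -
      have "(norm (X n - Abs_ell2 f))\<^sup>2 \<le> (e/2)\<^sup>2"
        unfolding norm_ell2_sq minus_ell2.rep_eq at
        by (rule infsum_le_finite_sums[OF diff]) (use N n in auto)
      then have "norm (X n - Abs_ell2 f) \<le> e/2" using e by (simp add: power2_le_iff_abs_le)
      then show ?thesis using e by simp
    qed
    then show "\<exists>no. \<forall>n\<ge>no. norm (X n - Abs_ell2 f) < e" by blast
  qed
  then show "convergent X" by (auto simp: convergent_def)
qed

section \<open>Operators, complex scalars and adjoints\<close>

abbreviation cscale :: "complex \<Rightarrow> 'g op \<Rightarrow> 'g op" (infixr "\<cdot>" 75)
  where "c \<cdot> T \<equiv> scalar_op c o\<^sub>L T"

declare scalar_op.rep_eq [simp]

lemma blinfun_minus_apply [simp]: "blinfun_apply (S - T) \<xi> = S \<xi> - T \<xi>"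
  by (rule blinfun.diff_left)

lemma blinfun_add_apply [simp]: "blinfun_apply (S + T) \<xi> = S \<xi> + T \<xi>"
  by (rule blinfun.add_left)

lemma norm_cscale: "norm (c \<cdot> T) \<le> cmod c * norm T"
  by (rule norm_blinfun_bound)
    (use norm_blinfun[of T] in \<open>auto intro: mult_left_mono simp: mult.assoc\<close>)

lemma cscale_cscale [simp]: "a \<cdot> (b \<cdot> T) = (a * b) \<cdot> T"
  by (rule blinfun_eqI) simp

lemma cscale_one [simp]: "1 \<cdot> T = T" and cscale_zero [simp]: "0 \<cdot> T = 0" "c \<cdot> (0::'g op) = 0"
  by (rule blinfun_eqI, simp)+

lemma cscale_add: "c \<cdot> (S + T) = c \<cdot> S + c \<cdot> T"
  by (rule blinfun_eqI) (simp add: scaleC_add)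

lemma scaleR_cscale: "r *\<^sub>R T = complex_of_real r \<cdot> T"
  by (rule blinfun_eqI) (simp add: scaleR_scaleC blinfun.scaleR_left)

lemma uminus_cscale: "- T = (- 1) \<cdot> T" for T :: "'g op"
  by (rule blinfun_eqI) (simp add: uminus_scaleC[symmetric] blinfun.minus_left)

lemma compose_cscale_left: "(c \<cdot> S) o\<^sub>L T = c \<cdot> (S o\<^sub>L T)"
  by (rule blinfun_eqI) simp

lemma bounded_ops_scaleC: "T \<in> bounded_ops \<Longrightarrow> T (scaleC c \<xi>) = scaleC c (T \<xi>)"
  by (simp add: bounded_ops_def)

lemma compose_cscale_right: "S \<in> bounded_ops \<Longrightarrow> S o\<^sub>L (c \<cdot> T) = c \<cdot> (S o\<^sub>L T)"
  by (rule blinfun_eqI) (simp add: bounded_ops_scaleC)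

lemma compose_distrib: "S o\<^sub>L (T + U) = (S o\<^sub>L T) + (S o\<^sub>L U)" "(T + U) o\<^sub>L S = (T o\<^sub>L S) + (U o\<^sub>L S)"
  for S T U :: "'g op"
  by (rule blinfun_eqI, simp add: blinfun.add_right)+

lemma compose_assoc: "(S o\<^sub>L T) o\<^sub>L U = S o\<^sub>L (T o\<^sub>L U)" for S T U :: "'g op"
  by (rule blinfun_eqI) simp

lemma scalar_op_simps [simp]: "scalar_op 0 = (0 :: 'g op)" "scalar_op 1 = (id_blinfun :: 'g op)"
  "c \<cdot> scalar_op d = (scalar_op (c * d) :: 'g op)"
  by (rule blinfun_eqI, simp)+

lemma compose_id [simp]: "T o\<^sub>L id_blinfun = T" "id_blinfun o\<^sub>L T = T" for T :: "'g op"
  by (rule blinfun_eqI, simp)+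

lemma norm_compose_le: "norm (S o\<^sub>L T) \<le> norm S * norm T" for S T :: "'g op"
  by (rule norm_blinfun_compose)

text \<open>
  As \<open>adj\<close> is a definite description, its properties depend on the existence of an adjoint. The
  relation carries that existence along.
\<close>

definition adjoint_pair :: "'g op \<Rightarrow> 'g op \<Rightarrow> bool" where
  "adjoint_pair T S \<longleftrightarrow> (\<forall>\<xi> \<eta>. cinner (T \<xi>) \<eta> = cinner \<xi> (S \<eta>))"

lemma cinner_right_inject: "(\<And>\<xi>. cinner \<xi> \<eta> = cinner \<xi> \<zeta>) \<Longrightarrow> \<eta> = \<zeta>"
  using cinner_self[of "\<eta> - \<zeta>"] by (simp add: cinner_minus_right)

lemma adj_eq: "adjoint_pair T S \<Longrightarrow> adj T = S"
  unfolding adj_def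
  by (rule the_equality)
    (auto simp: adjoint_pair_def intro!: blinfun_eqI cinner_right_inject) 

lemma adjoint_pair_sym: "adjoint_pair T S \<Longrightarrow> adjoint_pair S T"
  unfolding adjoint_pair_def by (metis cinner_commute)

lemma adjoint_pair_norm: assumes "adjoint_pair T S" shows "norm S \<le> norm T"
proof (rule norm_blinfun_bound)
  fix \<xi>
  have "(norm (S \<xi>))\<^sup>2 = cmod (cinner (T (S \<xi>)) \<xi>)"
    using assms by (simp add: adjoint_pair_def cinner_self norm_power)
  also have "\<dots> \<le> norm T * norm (S \<xi>) * norm \<xi>"
    by (meson cinner_cauchy_schwarz mult_right_mono norm_blinfun norm_ge_zero order_trans)
  finally show "norm (S \<xi>) \<le> norm T * norm \<xi>"
    by (cases "S \<xi> = 0") (simp_all add: power2_eq_square mult.assoc mult.left_commute)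
qed simp

lemma adjoint_pair_add:
  "adjoint_pair T S \<Longrightarrow> adjoint_pair T' S' \<Longrightarrow> adjoint_pair (T + T') (S + S')"
  by (simp add: adjoint_pair_def cinner_add_left cinner_add_right)

lemma adjoint_pair_cscale: "adjoint_pair T S \<Longrightarrow> S \<in> bounded_ops \<Longrightarrow> adjoint_pair (c \<cdot> T) (cnj c \<cdot> S)"
  by (simp add: adjoint_pair_def cinner_scaleC_left cinner_scaleC_right)

lemma adjoint_pair_compose:
  "adjoint_pair T S \<Longrightarrow> adjoint_pair T' S' \<Longrightarrow> adjoint_pair (T o\<^sub>L T') (S' o\<^sub>L S)"
  by (simp add: adjoint_pair_def)

lemma tendsto_cinner:
  fixes \<xi> \<eta> :: "'g ell2"
  assumes "(f \<longlongrightarrow> \<xi>) F" "(k \<longlongrightarrow> \<eta>) F" shows "((\<lambda>x. cinner (f x) (k x)) \<longlongrightarrow> cinner \<xi> \<eta>) F"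
proof -
  have "bounded_bilinear (cinner :: 'g ell2 \<Rightarrow> _)"
  proof
    show "\<exists>K. \<forall>a b. norm (cinner a b :: complex) \<le> norm (a::'g ell2) * norm b * K"
      by (rule exI[of _ 1]) (simp add: cinner_cauchy_schwarz)
  qed (simp_all add: cinner_add_left cinner_add_right scaleR_scaleC cinner_scaleC_left
      cinner_scaleC_right scaleR_conv_of_real)
  from bounded_bilinear.tendsto[OF this assms] show ?thesis .
qed

lemma closed_bounded_ops: "closed (bounded_ops :: 'g op set)"
proof -
  have b: "bounded_linear (\<lambda>T::'g op. blinfun_apply T (scaleC c \<xi>) - scaleC c (blinfun_apply T \<xi>))" for c \<xi>
  proof -
    have "bounded_linear (\<lambda>T::'g op. blinfun_apply T (scaleC c \<xi>) - blinfun_apply (scalar_op c) (blinfun_apply T \<xi>))"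
      by (intro bounded_linear_sub bounded_linear_intros)
    then show ?thesis by simp
  qed
  have "bounded_ops = (\<Inter>c. \<Inter>\<xi>. {T::'g op. T (scaleC c \<xi>) - scaleC c (T \<xi>) = 0})"
    by (auto simp: bounded_ops_def)
  also have "closed \<dots>"
    by (intro closed_INT ballI closed_Collect_eq continuous_on_const linear_continuous_on b)
  finally show ?thesis .
qed

lemma bounded_ops_closed_under:
  "id_blinfun \<in> bounded_ops" "0 \<in> bounded_ops"
  "S \<in> bounded_ops \<Longrightarrow> T \<in> bounded_ops \<Longrightarrow> S + T \<in> bounded_ops"
  "S \<in> bounded_ops \<Longrightarrow> T \<in> bounded_ops \<Longrightarrow> S o\<^sub>L T \<in> bounded_ops"
  "T \<in> bounded_ops \<Longrightarrow> c \<cdot> T \<in> bounded_ops"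
  by (simp_all add: bounded_ops_def scaleC_add mult.commute)

section \<open>The twisted group algebra and its closure\<close>

locale twisted_group =
  fixes \<sigma> :: "'g::group_add \<Rightarrow> 'g \<Rightarrow> complex"
  assumes two_cocycle: "\<sigma> \<in> two_cocycles"
begin

abbreviation L :: "'g \<Rightarrow> 'g op" where "L \<equiv> regular_rep \<sigma>"

abbreviation A :: "'g op set" where "A \<equiv> reduced_cstar_algebra \<sigma>"

lemma cmod_\<sigma> [simp]: "cmod (\<sigma> g h) = 1"
  and \<sigma>_zero [simp]: "\<sigma> g 0 = 1" "\<sigma> 0 g = 1"
  and \<sigma>_assoc: "\<sigma> g h * \<sigma> (g + h) k = \<sigma> h k * \<sigma> g (h + k)"
  using two_cocycle by (auto simp: two_cocycles_def)

lemma \<sigma>_cnj [simp]: "\<sigma> g h * cnj (\<sigma> g h) = 1" "cnj (\<sigma> g h) * \<sigma> g h = 1"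
  by (simp_all add: complex_norm_square[symmetric] mult.commute)

lemma \<sigma>_minus: "\<sigma> (- g) g = \<sigma> g (- g)"
  using \<sigma>_assoc[of g "- g" g] by simp

lemmas L_at = regular_rep_apply[OF two_cocycle]

lemma L_bounded_ops: "L g \<in> bounded_ops"
  by (auto simp: bounded_ops_def L_at scaleC.rep_eq mult.left_commute intro!: ell2_eqI)

lemma L_zero [simp]: "L 0 = id_blinfun"
  by (rule blinfun_eqI, rule ell2_eqI) (simp add: L_at)

lemma L_compose: "L g o\<^sub>L L h = \<sigma> g h \<cdot> L (g + h)"
proof (rule blinfun_eqI, rule ell2_eqI)
  fix \<xi> k
  have "h + (- h + (- g + k)) = - g + k" by simp
  then have "\<sigma> g h * \<sigma> (g + h) (- h + (- g + k)) = \<sigma> h (- h + (- g + k)) * \<sigma> g (- g + k)"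
    using \<sigma>_assoc[of g h "- h + (- g + k)"] by simp
  moreover have "- (g + h) + k = - h + (- g + k)" by (simp only: minus_add add.assoc)
  ultimately show "ell2_at ((L g o\<^sub>L L h) \<xi>) k = ell2_at ((\<sigma> g h \<cdot> L (g + h)) \<xi>) k"
    by (simp add: L_at scaleC.rep_eq mult.assoc[symmetric])
qed

lemma L_delta_zero: "L g (delta 0) = delta g"
proof (rule ell2_eqI)
  show "ell2_at (L g (delta 0)) h = ell2_at (delta g) h" for h
    by (cases "h = g") (auto simp: L_at delta.rep_eq neg_eq_iff_add_eq_0[symmetric])
qed

lemma cinner_L: "cinner (L g \<xi>) (L g \<eta>) = cinner \<xi> \<eta>"
proof -
  have b: "bij_betw (\<lambda>h. - g + h) UNIV UNIV"
    by (rule bij_betwI[where g = "\<lambda>h. g + h"]) (auto simp: add.assoc[symmetric])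
  have "ell2_at (L g \<xi>) h * cnj (ell2_at (L g \<eta>) h)
      = ell2_at \<xi> (- g + h) * cnj (ell2_at \<eta> (- g + h))" for h
    unfolding L_at using \<sigma>_cnj(1)[of g "- g + h"] by (simp add: algebra_simps)
  then show ?thesis
    unfolding cinner_def
    using infsum_reindex_bij_betw[OF b, of "\<lambda>h. ell2_at \<xi> h * cnj (ell2_at \<eta> h)"] by simp
qed

lemma norm_L_apply [simp]: "norm (L g \<xi>) = norm \<xi>"
  using cinner_L[of g \<xi> \<xi>] by (simp add: cinner_self del: of_real_power)

definition L' :: "'g \<Rightarrow> 'g op" where "L' g = cnj (\<sigma> g (- g)) \<cdot> L (- g)"

lemma L_L' [simp]: "L g o\<^sub>L L' g = id_blinfun" and L'_L [simp]: "L' g o\<^sub>L L g = id_blinfun"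
  by (simp_all add: L'_def compose_cscale_right compose_cscale_left L_bounded_ops L_compose \<sigma>_minus)

lemma L_L'_apply [simp]: "L g (L' g \<xi>) = \<xi>"
  by (metis L_L' blinfun_apply_blinfun_compose blinfun_apply_id_blinfun id_apply)

lemma adjoint_pair_L: "adjoint_pair (L g) (L' g)"
  unfolding adjoint_pair_def by (metis L_L'_apply cinner_L)

lemma norm_L: "norm (L g) \<le> 1" and norm_L': "norm (L' g) \<le> 1"
proof -
  show *: "norm (L g) \<le> 1" for g by (rule norm_blinfun_bound) auto
  show "norm (L' g) \<le> 1" using adjoint_pair_norm[OF adjoint_pair_L] * by (rule order_trans)
qed

text \<open>
  The linear span of the \<open>L g\<close>; adding one summand at a time gives the induction rule by which
  identities pass from the generators to the span.
\<close>

inductive_set group_algebra :: "'g op set" where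
  zero: "0 \<in> group_algebra"
| add: "T \<in> group_algebra \<Longrightarrow> T + c \<cdot> L g \<in> group_algebra"

lemma group_algebra_bounded_ops: "T \<in> group_algebra \<Longrightarrow> T \<in> bounded_ops"
  by (induction rule: group_algebra.induct) (simp_all add: bounded_ops_closed_under L_bounded_ops)

lemma group_algebra_plus: "T \<in> group_algebra \<Longrightarrow> S \<in> group_algebra \<Longrightarrow> S + T \<in> group_algebra"
  by (induction rule: group_algebra.induct)
    (simp_all add: add.assoc[symmetric] group_algebra.intros)

lemma group_algebra_cscale_L: "c \<cdot> L g \<in> group_algebra"
  using group_algebra.add[OF group_algebra.zero] by simp

lemma group_algebra_cscale: "T \<in> group_algebra \<Longrightarrow> c \<cdot> T \<in> group_algebra"
  by (induction rule: group_algebra.induct)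
    (simp_all add: cscale_add group_algebra.intros)

lemma group_algebra_compose_L: "T \<in> group_algebra \<Longrightarrow> T o\<^sub>L L g \<in> group_algebra"
  by (induction rule: group_algebra.induct)
    (simp_all add: compose_distrib compose_cscale_left L_compose group_algebra.intros)

lemma group_algebra_compose: "T \<in> group_algebra \<Longrightarrow> S \<in> group_algebra \<Longrightarrow> S o\<^sub>L T \<in> group_algebra"
  by (induction rule: group_algebra.induct)
    (simp_all add: compose_distrib compose_cscale_right group_algebra_bounded_ops
      group_algebra.zero group_algebra_plus group_algebra_cscale group_algebra_compose_L)

lemma group_algebra_adjoint: "T \<in> group_algebra \<Longrightarrow> \<exists>S\<in>group_algebra. adjoint_pair T S"
proof (induction rule: group_algebra.induct)
  case zero
  show ?case by (rule bexI[OF _ group_algebra.zero]) (simp add: adjoint_pair_def)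
next
  case (add T c g)
  then obtain S where "S \<in> group_algebra" "adjoint_pair T S" by blast
  moreover have "adjoint_pair (c \<cdot> L g) (cnj c \<cdot> L' g)"
    by (intro adjoint_pair_cscale adjoint_pair_L)
      (simp add: L'_def bounded_ops_closed_under(5)[OF L_bounded_ops])
  ultimately show ?case
    by (intro bexI[of _ "S + cnj c \<cdot> L' g"] adjoint_pair_add)
      (simp_all add: L'_def group_algebra.intros)
qed

text \<open>
  Passing to adjoints is isometric, so the adjoints of a convergent sequence converge as well.
\<close>

lemma closure_group_algebra_adjoint:
  assumes "T \<in> closure group_algebra"
  shows "\<exists>S\<in>closure group_algebra. adjoint_pair T S"
proof -
  obtain f where f: "\<And>n. f n \<in> group_algebra" "f \<longlonglongrightarrow> T"
    using assms by (auto simp: closure_sequential)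
  obtain k where k: "\<And>n. k n \<in> group_algebra" "\<And>n. adjoint_pair (f n) (k n)"
    using group_algebra_adjoint[OF f(1)] by metis
  have adj_diff: "norm (k m - k n) \<le> norm (f m - f n)" for m n
  proof (rule adjoint_pair_norm)
    show "adjoint_pair (f m - f n) (k m - k n)"
      using k(2) by (simp add: adjoint_pair_def cinner_minus_left cinner_minus_right)
  qed
  have "Cauchy k"
    using LIMSEQ_imp_Cauchy[OF f(2)] unfolding Cauchy_iff by (meson adj_diff order_le_less_trans)
  then obtain S where S: "k \<longlonglongrightarrow> S" using Cauchy_convergent_iff convergent_def by blast
  have "adjoint_pair T S"
    unfolding adjoint_pair_def
  proof (intro allI)
    fix \<xi> \<eta>
    have "(\<lambda>n. cinner (f n \<xi>) \<eta>) \<longlonglongrightarrow> cinner (T \<xi>) \<eta>"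
      by (intro tendsto_cinner blinfun.tendsto f tendsto_const)
    moreover have "(\<lambda>n. cinner \<xi> (k n \<eta>)) \<longlonglongrightarrow> cinner \<xi> (S \<eta>)"
      by (intro tendsto_cinner blinfun.tendsto S tendsto_const)
    ultimately show "cinner (T \<xi>) \<eta> = cinner \<xi> (S \<eta>)"
      using k(2) by (simp add: adjoint_pair_def LIMSEQ_unique)
  qed
  moreover have "S \<in> closure group_algebra" using k(1) S by (auto simp: closure_sequential)
  ultimately show ?thesis by blast
qed

lemma tendsto_compose:
  fixes S T :: "'h op"
  shows "(f \<longlongrightarrow> S) F \<Longrightarrow> (k \<longlongrightarrow> T) F \<Longrightarrow> ((\<lambda>x. f x o\<^sub>L k x) \<longlongrightarrow> S o\<^sub>L T) F"
  by (rule bounded_bilinear.tendsto[OF bounded_bilinear_blinfun_compose])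

lemma cstar_algebra_closure: "cstar_algebra (closure group_algebra)"
  unfolding cstar_algebra_def complex_subspace_def
proof (intro conjI ballI allI)
  show "closure group_algebra \<subseteq> bounded_ops"
    using group_algebra_bounded_ops by (intro closure_minimal closed_bounded_ops) auto
  show "0 \<in> closure group_algebra" using group_algebra.zero closure_subset by blast
  fix T assume "T \<in> closure group_algebra"
  then obtain k where k: "\<And>n. k n \<in> group_algebra" "k \<longlonglongrightarrow> T" by (auto simp: closure_sequential)
  show "c \<cdot> T \<in> closure group_algebra" for c
    unfolding closure_sequential
    by (rule exI[of _ "\<lambda>n. c \<cdot> k n"])
      (use k in \<open>auto intro: group_algebra_cscale tendsto_compose\<close>)
  show "adj T \<in> closure group_algebra"
    using closure_group_algebra_adjoint \<open>T \<in> _\<close> adj_eq by blast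
  fix S assume "S \<in> closure group_algebra"
  then obtain f where f: "\<And>n. f n \<in> group_algebra" "f \<longlonglongrightarrow> S" by (auto simp: closure_sequential)
  show "S o\<^sub>L T \<in> closure group_algebra"
    unfolding closure_sequential
    by (rule exI[of _ "\<lambda>n. f n o\<^sub>L k n"])
      (use f k in \<open>auto intro: group_algebra_compose tendsto_compose\<close>)
  show "S + T \<in> closure group_algebra"
    unfolding closure_sequential
    by (rule exI[of _ "\<lambda>n. f n + k n"])
      (use f k in \<open>auto intro: group_algebra_plus tendsto_add\<close>)
qed simp

lemma A_eq_closure: "A = closure group_algebra"
proof
  have "L g \<in> group_algebra" for g using group_algebra_cscale_L[of 1] by simp
  then have "range L \<subseteq> closure group_algebra" using closure_subset by blast
  then show "A \<subseteq> closure group_algebra"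
    using cstar_algebra_closure by (auto simp: reduced_cstar_algebra_def generated_cstar_algebra_def)
  have "closure group_algebra \<subseteq> B" if B: "cstar_algebra B" "range L \<subseteq> B" for B
  proof (rule closure_minimal)
    show "group_algebra \<subseteq> B"
    proof
      fix T assume "T \<in> group_algebra"
      then show "T \<in> B"
        by (induction rule: group_algebra.induct)
          (use B in \<open>auto simp: cstar_algebra_def complex_subspace_def image_subset_iff\<close>)
    qed
  qed (use B in \<open>simp add: cstar_algebra_def\<close>)
  then show "closure group_algebra \<subseteq> A"
    by (auto simp: reduced_cstar_algebra_def generated_cstar_algebra_def)
qed

lemma A_closed_under:
  shows A_bounded_ops: "A \<subseteq> bounded_ops" and A_zero: "0 \<in> A" and A_closed: "closed A"
    and A_add: "\<And>S T. S \<in> A \<Longrightarrow> T \<in> A \<Longrightarrow> S + T \<in> A"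
    and A_cscale: "\<And>c T. T \<in> A \<Longrightarrow> c \<cdot> T \<in> A"
    and A_compose: "\<And>S T. S \<in> A \<Longrightarrow> T \<in> A \<Longrightarrow> S o\<^sub>L T \<in> A"
    and A_adj: "\<And>T. T \<in> A \<Longrightarrow> adj T \<in> A"
  using cstar_algebra_closure unfolding A_eq_closure cstar_algebra_def complex_subspace_def by auto

lemma L_in_A: "L g \<in> A"
  using group_algebra_cscale_L[of 1 g] closure_subset by (force simp: A_eq_closure)

lemma L'_in_A: "L' g \<in> A"
  by (simp add: L'_def A_cscale L_in_A)

lemma id_in_A: "id_blinfun \<in> A"
  using L_in_A[of 0] by simp

lemma A_scaleR: "T \<in> A \<Longrightarrow> r *\<^sub>R T \<in> A"
  by (simp add: scaleR_cscale A_cscale)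

lemma A_diff: "S \<in> A \<Longrightarrow> T \<in> A \<Longrightarrow> S - T \<in> A"
  using A_add[of S "(- 1) \<cdot> T"] A_cscale[of T "- 1"] by (simp add: uminus_cscale[symmetric])

lemma A_sum: "(\<And>i. i \<in> I \<Longrightarrow> f i \<in> A) \<Longrightarrow> (\<Sum>i\<in>I. f i) \<in> A"
  by (induction I rule: infinite_finite_induct) (simp_all add: A_zero A_add)

lemma adjoint_pair_adj: "T \<in> A \<Longrightarrow> adjoint_pair T (adj T)"
  using closure_group_algebra_adjoint adj_eq unfolding A_eq_closure by blast

lemma A_approx:
  assumes "T \<in> A" "e > 0" obtains S where "S \<in> group_algebra" "norm (S - T) < e"
  using assms unfolding A_eq_closure closure_approachable dist_norm by blast

lemma group_algebra_subset_A: "group_algebra \<subseteq> A"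
  by (simp add: A_eq_closure closure_subset)

end

section \<open>Tracial states\<close>

context twisted_group begin

lemma vector_states_convergent:
  assumes unit: "\<And>n. norm (\<xi> n) = 1"
    and lim: "\<And>g. (\<lambda>n. cinner (L g (\<xi> n)) (\<xi> n)) \<longlonglongrightarrow> \<phi> g"
    and T: "T \<in> A"
  shows "convergent (\<lambda>n. cinner (T (\<xi> n)) (\<xi> n))"
proof -
  have GA: "convergent (\<lambda>n. cinner (S (\<xi> n)) (\<xi> n))" if "S \<in> group_algebra" for S
    using that
  proof (induction rule: group_algebra.induct)
    case (add S c g)
    have "convergent (\<lambda>n. cinner (S (\<xi> n)) (\<xi> n) + c * cinner (L g (\<xi> n)) (\<xi> n))"
      using lim[of g]
      by (intro convergent_add add.IH convergent_mult convergent_const) (auto simp: convergent_def)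
    then show ?case by (simp add: cinner_add_left cinner_scaleC_left)
  qed (simp add: convergent_const)
  have "Cauchy (\<lambda>n. cinner (T (\<xi> n)) (\<xi> n))"
  proof (rule CauchyI)
    fix e :: real assume e: "e > 0"
    then obtain S where S: "S \<in> group_algebra" "norm (S - T) < e / 3" using A_approx[OF T, of "e/3"] by auto
    have d: "cmod (cinner (S (\<xi> n)) (\<xi> n) - cinner (T (\<xi> n)) (\<xi> n)) \<le> e / 3" for n
    proof -
      have "cmod (cinner ((S - T) (\<xi> n)) (\<xi> n)) \<le> norm ((S - T) (\<xi> n))"
        using cinner_cauchy_schwarz[of "(S - T) (\<xi> n)" "\<xi> n"] by (simp only: unit mult_1_right)
      also have "\<dots> \<le> norm (S - T)" using norm_blinfun[of "S - T" "\<xi> n"] by (simp only: unit mult_1_right)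
      finally show ?thesis using S(2) by (simp add: cinner_minus_left)
    qed
    obtain M where M: "\<forall>m\<ge>M. \<forall>n\<ge>M. cmod (cinner (S (\<xi> m)) (\<xi> m) - cinner (S (\<xi> n)) (\<xi> n)) < e / 3"
      using CauchyD[of "\<lambda>n. cinner (S (\<xi> n)) (\<xi> n)" "e/3"] GA[OF S(1)] e
      by (auto simp: Cauchy_convergent_iff)
    have "cmod (cinner (T (\<xi> m)) (\<xi> m) - cinner (T (\<xi> n)) (\<xi> n)) < e" if "m \<ge> M" "n \<ge> M" for m n
      using d[of m] d[of n] M[rule_format, OF that] by norm
    then show "\<exists>M. \<forall>m\<ge>M. \<forall>n\<ge>M. cmod (cinner (T (\<xi> m)) (\<xi> m) - cinner (T (\<xi> n)) (\<xi> n)) < e" by blast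
  qed
  then show ?thesis by (simp add: Cauchy_convergent_iff)
qed

definition limit_state :: "(nat \<Rightarrow> 'g ell2) \<Rightarrow> 'g op \<Rightarrow> complex" where
  "limit_state \<xi> = (\<lambda>T\<in>A. lim (\<lambda>n. cinner (blinfun_apply T (\<xi> n)) (\<xi> n)))"

lemma limit_state_tendsto:
  assumes "\<And>n. norm (\<xi> n) = 1" "\<And>g. (\<lambda>n. cinner (L g (\<xi> n)) (\<xi> n)) \<longlonglongrightarrow> \<phi> g" "T \<in> A"
  shows "(\<lambda>n. cinner (T (\<xi> n)) (\<xi> n)) \<longlonglongrightarrow> limit_state \<xi> T"
  using vector_states_convergent[OF assms] assms(3)
  by (simp add: limit_state_def convergent_LIMSEQ_iff)

text \<open>
  A sequence of unit vectors along which the vector states converge on the generators, to a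
  function with the trace symmetry, yields a tracial state on the whole algebra. Both the
  canonical trace and a trace induced from a quotient by an amenable normal subgroup arise so.
\<close>

lemma tracial_limit_state:
  assumes unit: "\<And>n. norm (\<xi> n) = 1"
    and lim: "\<And>g. (\<lambda>n. cinner (L g (\<xi> n)) (\<xi> n)) \<longlonglongrightarrow> \<phi> g"
    and sym: "\<And>g h. \<sigma> g h * \<phi> (g + h) = \<sigma> h g * \<phi> (h + g)"
  shows "tracial_state A (limit_state \<xi>)"
    and "limit_state \<xi> (L g) = \<phi> g"
proof -
  let ?\<tau> = "limit_state \<xi>"
  note tends = limit_state_tendsto[OF unit lim]
  show L: "?\<tau> (L g) = \<phi> g" for g
    using LIMSEQ_unique[OF tends[OF L_in_A] lim] .
  have plus: "?\<tau> (S + T) = ?\<tau> S + ?\<tau> T" if "S \<in> A" "T \<in> A" for S T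
    using LIMSEQ_unique[OF tends[OF A_add[OF that]]] tendsto_add[OF tends[OF that(1)] tends[OF that(2)]]
    by (simp add: cinner_add_left)
  have scale: "?\<tau> (c \<cdot> T) = c * ?\<tau> T" if "T \<in> A" for c T
    using LIMSEQ_unique[OF tends[OF A_cscale[OF that]]] tendsto_mult[OF tendsto_const tends[OF that]]
    by (simp add: cinner_scaleC_left)
  have zero: "?\<tau> 0 = 0" using scale[OF A_zero, of 0] by simp
  have norm_le: "cmod (?\<tau> T) \<le> norm T" if "T \<in> A" for T
  proof (rule tendsto_upperbound[OF tendsto_norm[OF tends[OF that]]])
    have "cmod (cinner (T (\<xi> n)) (\<xi> n)) \<le> norm T" for n
      using cinner_cauchy_schwarz[of "T (\<xi> n)" "\<xi> n"] norm_blinfun[of T "\<xi> n"] by (simp add: unit)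
    then show "\<forall>\<^sub>F n in sequentially. cmod (cinner (T (\<xi> n)) (\<xi> n)) \<le> norm T" by simp
  qed simp
  have cont: "(\<lambda>n. ?\<tau> (f n)) \<longlonglongrightarrow> ?\<tau> T" if "\<And>n. f n \<in> A" "f \<longlonglongrightarrow> T" "T \<in> A" for f T
  proof -
    have diff: "?\<tau> (f n) - ?\<tau> T = ?\<tau> (f n - T)" for n
      using plus[OF A_diff[OF that(1)[of n] that(3)] that(3)] by simp
    have "(\<lambda>n. norm (f n - T)) \<longlonglongrightarrow> 0" using that(2) by (simp add: LIM_zero tendsto_norm_zero)
    then have "(\<lambda>n. ?\<tau> (f n) - ?\<tau> T) \<longlonglongrightarrow> 0"
      by (rule Lim_null_comparison[rotated]) (simp add: diff norm_le A_diff that)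
    then show ?thesis by (rule LIM_zero_cancel)
  qed
  have LL: "?\<tau> (L g o\<^sub>L L h) = ?\<tau> (L h o\<^sub>L L g)" for g h
    by (simp add: L_compose scale L_in_A L sym)
  have GL: "?\<tau> (L g o\<^sub>L T) = ?\<tau> (T o\<^sub>L L g)" if "T \<in> group_algebra" for T g
    using that
  proof (induction rule: group_algebra.induct)
    case (add T c h)
    then have "T \<in> A" using group_algebra_subset_A by blast
    with add show ?case
      by (simp add: compose_distrib compose_cscale_left compose_cscale_right L_bounded_ops plus scale
          A_compose A_cscale L_in_A LL)
  qed simp
  have GG: "?\<tau> (S o\<^sub>L T) = ?\<tau> (T o\<^sub>L S)" if "S \<in> group_algebra" "T \<in> group_algebra" for S T
    using that(1)
  proof (induction rule: group_algebra.induct)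
    case (add S c h)
    have "S \<in> A" "T \<in> A" "T \<in> bounded_ops"
      using add that group_algebra_subset_A group_algebra_bounded_ops by blast+
    with add show ?case
      by (simp add: compose_distrib compose_cscale_left compose_cscale_right L_bounded_ops plus scale
          A_compose A_cscale L_in_A GL[OF that(2)])
  qed simp
  have trace: "?\<tau> (S o\<^sub>L T) = ?\<tau> (T o\<^sub>L S)" if S: "S \<in> A" and T: "T \<in> A" for S T
  proof -
    obtain f where f: "\<And>n. f n \<in> group_algebra" "f \<longlonglongrightarrow> S"
      using S by (auto simp: A_eq_closure closure_sequential)
    obtain k where k: "\<And>n. k n \<in> group_algebra" "k \<longlonglongrightarrow> T"
      using T by (auto simp: A_eq_closure closure_sequential)
    have inA: "f n \<in> A" "k n \<in> A" for n using f k group_algebra_subset_A by blast+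
    have "(\<lambda>n. ?\<tau> (f n o\<^sub>L k n)) \<longlonglongrightarrow> ?\<tau> (S o\<^sub>L T)"
      by (intro cont A_compose inA S T tendsto_compose f k)
    moreover have "(\<lambda>n. ?\<tau> (k n o\<^sub>L f n)) \<longlonglongrightarrow> ?\<tau> (T o\<^sub>L S)"
      by (intro cont A_compose inA S T tendsto_compose f k)
    ultimately show ?thesis using GG[OF f(1) k(1)] by (simp add: LIMSEQ_unique)
  qed
  have pos: "?\<tau> (adj T o\<^sub>L T) \<in> \<real>\<^sub>\<ge>\<^sub>0" if T: "T \<in> A" for T
  proof (rule closed_sequentially[OF closed_nonneg_Reals_complex])
    show "(\<lambda>n. cinner ((adj T o\<^sub>L T) (\<xi> n)) (\<xi> n)) \<longlonglongrightarrow> ?\<tau> (adj T o\<^sub>L T)"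
      by (intro tends A_compose A_adj T)
    have "adjoint_pair (adj T) T" by (rule adjoint_pair_sym[OF adjoint_pair_adj[OF T]])
    then show "cinner ((adj T o\<^sub>L T) (\<xi> n)) (\<xi> n) \<in> \<real>\<^sub>\<ge>\<^sub>0" for n
      by (simp add: adjoint_pair_def cinner_self del: of_real_power)
  qed
  have one: "?\<tau> id_blinfun = 1"
  proof (rule LIMSEQ_unique[OF tends[OF id_in_A]])
    show "(\<lambda>n. cinner (id_blinfun (\<xi> n)) (\<xi> n)) \<longlonglongrightarrow> 1" by (simp add: cinner_self unit)
  qed
  show "tracial_state A ?\<tau>"
    unfolding tracial_state_def
    by (auto intro: plus scale pos one trace) (simp add: limit_state_def)
qed

definition canonical_trace :: "'g op \<Rightarrow> complex" where
  "canonical_trace = limit_state (\<lambda>_. delta 0)"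

lemma canonical_trace_eq: "T \<in> A \<Longrightarrow> canonical_trace T = cinner (T (delta 0)) (delta 0)"
  by (simp add: canonical_trace_def limit_state_def)

lemma \<sigma>_commute_inverse: "g + h = 0 \<Longrightarrow> \<sigma> g h = \<sigma> h g"
  using \<sigma>_minus by (metis minus_unique)

lemma tracial_canonical_trace: "tracial_state A canonical_trace"
  and canonical_trace_L: "canonical_trace (L g) = (if g = 0 then 1 else 0)"
proof -
  have lim: "(\<lambda>n::nat. cinner (L g (delta 0)) (delta 0)) \<longlonglongrightarrow> (if g = 0 then 1 else 0)" for g
    by (auto simp: L_delta_zero cinner_delta delta.rep_eq)
  have sym: "\<sigma> g h * (if g + h = 0 then 1 else 0) = \<sigma> h g * (if h + g = 0 then 1 else 0)" for g h
    using \<sigma>_commute_inverse[of g h] by (auto simp: add_eq_0_iff neg_eq_iff_add_eq_0)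
  show "tracial_state A canonical_trace" "canonical_trace (L g) = (if g = 0 then 1 else 0)"
    unfolding canonical_trace_def using tracial_limit_state[OF _ lim sym] by auto
qed

text \<open>
  The trace property gives \<open>\<parallel>T L h \<delta>\<^sub>0\<parallel> = \<parallel>T \<delta>\<^sub>0\<parallel>\<close> for all \<open>h\<close>, and the vectors \<open>L h \<delta>\<^sub>0 = \<delta>\<^sub>h\<close> are total.
\<close>

lemma A_delta_zero_separating:
  assumes T: "T \<in> A" and 0: "T (delta 0) = 0" shows "T = 0"
proof -
  have Tdelta: "T (delta h) = 0" for h
  proof -
    let ?\<tau> = canonical_trace
    have tr: "?\<tau> (S o\<^sub>L U) = ?\<tau> (U o\<^sub>L S)" if "S \<in> A" "U \<in> A" for S U
      using tracial_canonical_trace that by (simp add: tracial_state_def)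
    have adjT: "adjoint_pair (adj T) T" by (rule adjoint_pair_sym[OF adjoint_pair_adj[OF T]])
    let ?S = "T o\<^sub>L L h"
    have "complex_of_real ((norm (?S (delta 0)))\<^sup>2) = cinner (((L' h o\<^sub>L adj T) o\<^sub>L ?S) (delta 0)) (delta 0)"
      using adjT adjoint_pair_sym[OF adjoint_pair_L, of h]
      by (simp add: adjoint_pair_def cinner_self[symmetric] del: of_real_power)
    also have "\<dots> = ?\<tau> ((L' h o\<^sub>L adj T) o\<^sub>L ?S)"
      by (simp add: canonical_trace_eq A_compose L'_in_A L_in_A A_adj T)
    also have "\<dots> = ?\<tau> (L' h o\<^sub>L ((adj T o\<^sub>L T) o\<^sub>L L h))"
      by (simp add: compose_assoc)
    also have "\<dots> = ?\<tau> (((adj T o\<^sub>L T) o\<^sub>L L h) o\<^sub>L L' h)"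
      by (intro tr A_compose L'_in_A L_in_A A_adj T)
    also have "\<dots> = ?\<tau> (adj T o\<^sub>L T)" by (simp add: compose_assoc)
    also have "\<dots> = 0" by (simp add: canonical_trace_eq A_compose A_adj T 0 blinfun.zero_right)
    finally show ?thesis by (simp add: L_delta_zero)
  qed
  show ?thesis
  proof (rule blinfun_eqI, rule cinner_right_inject)
    fix \<xi> \<eta>
    have "adj T \<eta> = 0"
    proof (rule ell2_eqI)
      fix h
      have "cnj (ell2_at (adj T \<eta>) h) = cinner (T (delta h)) \<eta>"
        using adjoint_pair_adj[OF T] by (simp add: adjoint_pair_def cinner_delta[symmetric] cinner_commute[of _ "delta h"])
      then show "ell2_at (adj T \<eta>) h = ell2_at 0 h" by (simp add: Tdelta zero_ell2.rep_eq)
    qed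
    then show "cinner \<eta> (T \<xi>) = cinner \<eta> (blinfun_apply 0 \<xi>)"
      using adjoint_pair_adj[OF T] by (metis adjoint_pair_def cinner_commute cinner_zero complex_cnj_zero zero_blinfun.rep_eq)
  qed
qed

section \<open>Boundedness of tracial states\<close>

text \<open>
  The square root is \<open>1 - Y\<close> for the fixed point of the contraction \<open>Y \<mapsto> (X + Y\<^sup>2) / 2\<close> on a
  ball of radius \<open>\<parallel>X\<parallel>\<close>.
\<close>

lemma sqrt_one_minus:
  assumes X: "X \<in> A" "adjoint_pair X X" and norm: "norm X < 1"
  obtains S where "S \<in> A" "adjoint_pair S S" "S o\<^sub>L S = id_blinfun - X"
proof -
  define K where "K = {Y \<in> A. adjoint_pair Y Y \<and> norm Y \<le> norm X}"
  define f where "f Y = (1/2) *\<^sub>R (X + (Y o\<^sub>L Y))" for Y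
  have "closed {Y::'g op. adjoint_pair Y Y}"
  proof -
    have "{Y::'g op. adjoint_pair Y Y} = (\<Inter>\<xi>. \<Inter>\<eta>. {Y::'g op. cinner (Y \<xi>) \<eta> = cinner \<xi> (Y \<eta>)})"
      by (auto simp: adjoint_pair_def)
    moreover have "continuous_on UNIV (\<lambda>Y::'g op. cinner (Y \<xi>) \<eta>)"
      "continuous_on UNIV (\<lambda>Y::'g op. cinner \<eta> (Y \<xi>))" for \<xi> \<eta>
      unfolding continuous_on_def
      by (auto intro!: tendsto_cinner blinfun.tendsto tendsto_ident_at tendsto_const)
    ultimately show ?thesis by (simp add: closed_INT closed_Collect_eq)
  qed
  moreover have "K = A \<inter> {Y. adjoint_pair Y Y} \<inter> {Y. norm Y \<le> norm X}" by (auto simp: K_def)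
  ultimately have "closed K"
    by (auto intro!: closed_Int A_closed closed_Collect_le continuous_intros)
  then have "complete K" by (simp add: complete_eq_closed)
  moreover have "K \<noteq> {}" using X by (auto simp: K_def)
  moreover have "f ` K \<subseteq> K"
  proof
    fix Z assume "Z \<in> f ` K"
    then obtain Y where Y: "Y \<in> A" "adjoint_pair Y Y" "norm Y \<le> norm X" and Z: "Z = f Y" by (auto simp: K_def)
    have "adjoint_pair (X + (Y o\<^sub>L Y)) (X + (Y o\<^sub>L Y))"
      by (intro adjoint_pair_add adjoint_pair_compose X Y)
    then have "adjoint_pair Z Z"
      using Y X A_bounded_ops
      by (auto simp: Z f_def scaleR_cscale intro!: adjoint_pair_cscale[where c = "1/2", simplified] A_add A_compose)
    moreover have "Z \<in> A" using X Y by (auto simp: Z f_def intro!: A_scaleR A_add A_compose)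
    moreover have "norm (Y o\<^sub>L Y) \<le> norm X"
    proof -
      have "norm (Y o\<^sub>L Y) \<le> norm X * norm X"
        by (rule order_trans[OF norm_compose_le]) (use Y in \<open>auto intro: mult_mono\<close>)
      also have "\<dots> \<le> norm X" using norm by (simp add: mult_left_le)
      finally show ?thesis .
    qed
    then have "norm Z \<le> norm X"
      unfolding Z f_def norm_scaleR using norm_triangle_ineq[of X "Y o\<^sub>L Y"] by simp
    ultimately show "Z \<in> K" by (simp add: K_def)
  qed
  moreover have "dist (f Y) (f Z) \<le> norm X * dist Y Z" if "Y \<in> K" "Z \<in> K" for Y Z
  proof -
    have "f Y - f Z = (1/2) *\<^sub>R ((Y o\<^sub>L (Y - Z)) + ((Y - Z) o\<^sub>L Z))"
      by (rule blinfun_eqI) (simp add: f_def blinfun.scaleR_left blinfun.diff_right scaleR_right_diff_distrib[symmetric])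
    moreover have "norm (Y o\<^sub>L (Y - Z)) \<le> norm X * norm (Y - Z)"
      by (rule order_trans[OF norm_compose_le]) (use that in \<open>auto intro: mult_right_mono simp: K_def\<close>)
    moreover have "norm ((Y - Z) o\<^sub>L Z) \<le> norm X * norm (Y - Z)"
      by (rule order_trans[OF norm_compose_le])
        (use that in \<open>auto intro: mult_right_mono simp: K_def mult.commute[of "norm (Y - Z)"]\<close>)
    ultimately show ?thesis
      unfolding dist_norm using norm_triangle_ineq[of "Y o\<^sub>L (Y - Z)" "(Y - Z) o\<^sub>L Z"] by simp
  qed
  ultimately have "\<exists>!Y\<in>K. f Y = Y"
    using norm by (intro Banach_fix[where c = "norm X"]) auto
  then obtain Y where Y: "Y \<in> A" "adjoint_pair Y Y" and fixed: "f Y = Y" by (auto simp: K_def)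
  have two: "X + (Y o\<^sub>L Y) = Y + Y"
  proof -
    have "Y + Y = 2 *\<^sub>R f Y" by (simp add: fixed scaleR_2)
    then show ?thesis by (simp add: f_def)
  qed
  have sq: "(id_blinfun - Y) o\<^sub>L (id_blinfun - Y) = id_blinfun - X"
  proof (rule blinfun_eqI)
    fix \<xi>
    have "X \<xi> + Y (Y \<xi>) = Y \<xi> + Y \<xi>"
      using arg_cong[OF two, of "\<lambda>T. blinfun_apply T \<xi>"] by simp
    then show "((id_blinfun - Y) o\<^sub>L (id_blinfun - Y)) \<xi> = (id_blinfun - X) \<xi>"
      by (simp add: blinfun.diff_right algebra_simps)
  qed
  have "adjoint_pair (id_blinfun - Y) (id_blinfun - Y)"
    using Y(2) by (simp add: adjoint_pair_def cinner_minus_left cinner_minus_right)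
  with Y(1) sq that show thesis by (metis A_diff id_in_A)
qed

text \<open>
  On self-adjoint elements of norm below \<open>1\<close> the bound is the positivity of the squares \<open>1 - X\<close> and
  \<open>1 + X\<close>. The factor \<open>2\<close> accounts for real and imaginary parts.
\<close>

lemma tracial_state_bounded:
  assumes \<tau>: "tracial_state A \<tau>" and T: "T \<in> A"
  shows "cmod (\<tau> T) \<le> 2 * norm T"
proof -
  have plus: "\<tau> (S + U) = \<tau> S + \<tau> U" if "S \<in> A" "U \<in> A" for S U
    using \<tau> that by (simp add: tracial_state_def)
  have scale: "\<tau> (c \<cdot> S) = c * \<tau> S" if "S \<in> A" for c S
    using \<tau> that by (simp add: tracial_state_def)
  have minus: "\<tau> (S - U) = \<tau> S - \<tau> U" if "S \<in> A" "U \<in> A" for S U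
    using plus[OF A_diff[OF that] that(2)] by simp
  have one: "\<tau> id_blinfun = 1" using \<tau> by (simp add: tracial_state_def)
  have upper: "\<tau> X \<in> \<real> \<and> Re (\<tau> X) \<le> 1" if X: "X \<in> A" "adjoint_pair X X" "norm X < 1" for X
  proof -
    obtain S where S: "S \<in> A" "adjoint_pair S S" "S o\<^sub>L S = id_blinfun - X" using sqrt_one_minus[OF X] .
    have "\<tau> (adj S o\<^sub>L S) \<in> \<real>\<^sub>\<ge>\<^sub>0" using \<tau> S(1) by (simp add: tracial_state_def)
    then have "1 - \<tau> X \<in> \<real>\<^sub>\<ge>\<^sub>0" using S X by (simp add: adj_eq minus id_in_A one)
    then show ?thesis by (simp add: complex_nonneg_Reals_iff complex_is_Real_iff)
  qed
  have selfadj: "cmod (\<tau> X) \<le> norm X" if X: "X \<in> A" "adjoint_pair X X" for X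
  proof (rule field_le_epsilon)
    fix e :: real assume e: "e > 0"
    define c where "c = 1 / (norm X + e)"
    have c: "c > 0" using e by (simp add: c_def add_nonneg_pos)
    have small: "norm (c *\<^sub>R X) < 1" using e c by (simp add: c_def field_simps add_nonneg_pos)
    have ap: "adjoint_pair (c *\<^sub>R X) (c *\<^sub>R X)" "adjoint_pair (- (c *\<^sub>R X)) (- (c *\<^sub>R X))"
      using X(2) by (simp_all add: adjoint_pair_def blinfun.scaleR_left blinfun.minus_left scaleR_scaleC
          uminus_scaleC cinner_scaleC_left cinner_scaleC_right)
    have mem: "- (c *\<^sub>R X) \<in> A" using X by (simp add: uminus_cscale A_cscale A_scaleR)
    have \<tau>c: "\<tau> (c *\<^sub>R X) = c * \<tau> X" using X(1) by (simp add: scaleR_cscale scale)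
    have "\<tau> (- (c *\<^sub>R X)) = - (c * \<tau> X)"
      unfolding uminus_cscale using X by (simp add: scale A_scaleR \<tau>c)
    then have "c * \<tau> X \<in> \<real> \<and> Re (c * \<tau> X) \<le> 1 \<and> - Re (c * \<tau> X) \<le> 1"
      using upper[OF A_scaleR[OF X(1)] ap(1) small] upper[OF mem ap(2)] small \<tau>c by simp
    then have "cmod (c * \<tau> X) \<le> 1" by (auto simp: cmod_eq_Re complex_is_Real_iff abs_le_iff)
    then have "c * cmod (\<tau> X) \<le> 1" using c by (simp add: norm_mult)
    then show "cmod (\<tau> X) \<le> norm X + e"
      using e by (simp add: c_def pos_divide_le_eq add_nonneg_pos)
  qed
  define U where "U = adj T"
  have U: "U \<in> A" "adjoint_pair T U" "adjoint_pair U T"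
    using T by (simp_all add: U_def A_adj adjoint_pair_adj adjoint_pair_sym)
  have nU: "norm U \<le> norm T" using adjoint_pair_norm[OF U(2)] .
  let ?X = "(1/2) \<cdot> (T + U)" and ?Y = "(- \<i>/2) \<cdot> (T + (- 1) \<cdot> U)"
  have bd: "T \<in> bounded_ops" "U \<in> bounded_ops" using T U A_bounded_ops by auto
  have mem: "?X \<in> A" "?Y \<in> A" using T U by (auto intro!: A_cscale A_add)
  have ap: "adjoint_pair ?X ?X" "adjoint_pair ?Y ?Y"
    using U(2,3) by (simp_all add: adjoint_pair_def cinner_scaleC_left cinner_scaleC_right
        cinner_add_left cinner_add_right algebra_simps)
  have nX: "norm ?X \<le> norm T"
    using norm_cscale[of "1/2" "T + U"] norm_triangle_ineq[of T U] nU by simp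
  have nY: "norm ?Y \<le> norm T"
    using norm_cscale[of "- \<i>/2" "T + (- 1) \<cdot> U"] norm_triangle_ineq[of T "(- 1) \<cdot> U"]
      norm_cscale[of "- 1" U] nU by (simp add: norm_divide)
  have "T = ?X + \<i> \<cdot> ?Y"
    by (rule blinfun_eqI, rule ell2_eqI) (simp add: scaleC.rep_eq plus_ell2.rep_eq field_simps)
  then have "\<tau> T = \<tau> ?X + \<i> * \<tau> ?Y" using mem by (metis plus scale A_cscale)
  then have "cmod (\<tau> T) \<le> cmod (\<tau> ?X) + cmod (\<tau> ?Y)"
    by (metis norm_triangle_ineq norm_mult norm_ii mult_1)
  also have "\<dots> \<le> 2 * norm T" using selfadj[OF mem(1) ap(1)] selfadj[OF mem(2) ap(2)] nX nY by linarith
  finally show ?thesis .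
qed

end

section \<open>Averages of conjugates and the Dixmier property\<close>

context twisted_group begin

definition conj_by :: "'g \<Rightarrow> 'g op \<Rightarrow> 'g op" where
  "conj_by g T = L g o\<^sub>L (T o\<^sub>L L' g)"

definition average :: "nat \<Rightarrow> (nat \<Rightarrow> 'g) \<Rightarrow> 'g op \<Rightarrow> 'g op" where
  "average n u T = (1 / n) *\<^sub>R (\<Sum>i<n. conj_by (u i) T)"

lemma conj_by_add_right: "conj_by g (S + T) = conj_by g S + conj_by g T"
  by (simp add: conj_by_def compose_distrib)

lemma conj_by_cscale: "conj_by g (c \<cdot> T) = c \<cdot> conj_by g T"
  by (simp add: conj_by_def compose_cscale_left compose_cscale_right L_bounded_ops)

lemma conj_by_id [simp]: "conj_by g id_blinfun = id_blinfun"
  by (simp add: conj_by_def)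

lemma conj_by_zero_left [simp]: "conj_by 0 T = T"
  using L'_L[of 0] by (simp add: conj_by_def)

lemma norm_conj_by: "norm (conj_by g T) \<le> norm T"
proof -
  have "norm (conj_by g T) \<le> norm (L g) * (norm T * norm (L' g))"
    unfolding conj_by_def by (meson norm_compose_le mult_left_mono norm_ge_zero order_trans)
  also have "\<dots> \<le> 1 * (norm T * 1)"
    by (intro mult_mono norm_L norm_L' order_refl) auto
  finally show ?thesis by simp
qed

lemma conj_by_compose: "conj_by g (S o\<^sub>L T) = conj_by g S o\<^sub>L conj_by g T"
proof -
  have "L' g o\<^sub>L (L g o\<^sub>L U) = U" for U :: "'g op" by (metis L'_L compose_assoc compose_id(2))
  then show ?thesis by (simp add: conj_by_def compose_assoc)
qed

lemma L'_compose: "L' h o\<^sub>L L' g = cnj (\<sigma> g h) \<cdot> L' (g + h)"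
proof -
  have "L' (g + h) \<in> bounded_ops" by (simp add: L'_def bounded_ops_closed_under(5)[OF L_bounded_ops])
  then have "adjoint_pair (\<sigma> g h \<cdot> L (g + h)) (cnj (\<sigma> g h) \<cdot> L' (g + h))"
    by (intro adjoint_pair_cscale adjoint_pair_L)
  moreover have "adjoint_pair (\<sigma> g h \<cdot> L (g + h)) (L' h o\<^sub>L L' g)"
    unfolding L_compose[symmetric] by (intro adjoint_pair_compose adjoint_pair_L)
  ultimately show ?thesis using adj_eq by metis
qed

lemma conj_by_conj_by:
  assumes "T \<in> bounded_ops" shows "conj_by g (conj_by h T) = conj_by (g + h) T"
proof -
  have "conj_by g (conj_by h T) = (L g o\<^sub>L L h) o\<^sub>L (T o\<^sub>L (L' h o\<^sub>L L' g))"
    by (simp add: conj_by_def compose_assoc)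
  also have "\<dots> = conj_by (g + h) T"
    unfolding L_compose L'_compose
    using assms by (simp add: compose_cscale_left compose_cscale_right L_bounded_ops conj_by_def)
  finally show ?thesis .
qed

lemma conj_by_L: "conj_by h (L g) = (\<sigma> h g * cnj (\<sigma> (h + g - h) h)) \<cdot> L (h + g - h)"
proof -
  have "L (h + g - h) o\<^sub>L L h = \<sigma> (h + g - h) h \<cdot> L (h + g)"
    unfolding L_compose by simp
  then have "L (h + g) = cnj (\<sigma> (h + g - h) h) \<cdot> (L (h + g - h) o\<^sub>L L h)" by simp
  then have "conj_by h (L g) = (\<sigma> h g * cnj (\<sigma> (h + g - h) h)) \<cdot> (L (h + g - h) o\<^sub>L (L h o\<^sub>L L' h))"
    unfolding conj_by_def compose_assoc[symmetric] L_compose[of h g]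
    by (simp add: compose_cscale_left)
  then show ?thesis by simp
qed

lemma average_add: "average n u (S + T) = average n u S + average n u T"
  by (simp add: average_def conj_by_add_right sum.distrib scaleR_add_right)

lemma average_cscale: "average n u (c \<cdot> T) = c \<cdot> average n u T"
proof -
  have "(\<Sum>i\<in>I. c \<cdot> f i) = c \<cdot> (\<Sum>i\<in>I. f i)" for I and f :: "nat \<Rightarrow> 'g op"
    by (induction I rule: infinite_finite_induct) (simp_all add: cscale_add)
  then show ?thesis by (simp add: average_def conj_by_cscale scaleR_cscale mult.commute)
qed

lemma average_id: "n > 0 \<Longrightarrow> average n u id_blinfun = id_blinfun"
  by (simp add: average_def sum_constant_scaleR)

lemma norm_average: "norm (average n u T) \<le> norm T"
proof (cases "n = 0")
  case False
  have "norm (\<Sum>i<n. conj_by (u i) T) \<le> n * norm T"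
    using sum_norm_le[of "{..<n}" "\<lambda>i. conj_by (u i) T" "\<lambda>_. norm T"] norm_conj_by by simp
  then show ?thesis using False by (simp add: average_def field_simps)
qed (simp add: average_def)

lemma average_in_ideal:
  assumes "closed_ideal J A" "T \<in> J" shows "average n u T \<in> J"
proof -
  have J: "0 \<in> J" "\<And>S T. S \<in> J \<Longrightarrow> T \<in> J \<Longrightarrow> S + T \<in> J" "\<And>c T. T \<in> J \<Longrightarrow> c \<cdot> T \<in> J"
    "\<And>S T. S \<in> A \<Longrightarrow> T \<in> J \<Longrightarrow> S o\<^sub>L T \<in> J" "\<And>S T. S \<in> A \<Longrightarrow> T \<in> J \<Longrightarrow> T o\<^sub>L S \<in> J"
    using assms(1) by (auto simp: closed_ideal_def complex_subspace_def)
  have "conj_by g T \<in> J" for g using J assms(2) L_in_A L'_in_A by (simp add: conj_by_def)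
  then have "(\<Sum>i\<in>I. conj_by (u i) T) \<in> J" for I
    by (induction I rule: infinite_finite_induct) (simp_all add: J)
  then show ?thesis by (simp add: average_def scaleR_cscale J)
qed

lemma A_ideal: "closed_ideal A A"
  using A_closed_under by (simp add: closed_ideal_def complex_subspace_def)

lemma trace_average:
  assumes \<tau>: "tracial_state A \<tau>" and T: "T \<in> A" and n: "n > 0"
  shows "\<tau> (average n u T) = \<tau> T"
proof -
  have plus: "\<And>S U. S \<in> A \<Longrightarrow> U \<in> A \<Longrightarrow> \<tau> (S + U) = \<tau> S + \<tau> U"
    and scale: "\<And>c S. S \<in> A \<Longrightarrow> \<tau> (c \<cdot> S) = c * \<tau> S"
    and tr: "\<And>S U. S \<in> A \<Longrightarrow> U \<in> A \<Longrightarrow> \<tau> (S o\<^sub>L U) = \<tau> (U o\<^sub>L S)"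
    using \<tau> by (auto simp: tracial_state_def)
  have inA: "conj_by g T \<in> A" for g using T by (simp add: conj_by_def A_compose L_in_A L'_in_A)
  have conj: "\<tau> (conj_by g T) = \<tau> T" for g
    unfolding conj_by_def using T
    by (subst tr) (simp_all add: A_compose L_in_A L'_in_A compose_assoc)
  have "\<tau> (\<Sum>i\<in>I. conj_by (u i) T) = of_nat (card I) * \<tau> T" if "finite I" for I
    using that
  proof (induction I rule: finite_induct)
    case empty show ?case using scale[OF A_zero, of 0] by simp
  next
    case (insert i I)
    then show ?case using plus[OF inA A_sum, of I "\<lambda>i. conj_by (u i) T"] inA
      by (simp add: conj algebra_simps)
  qed
  then show ?thesis using n by (simp add: average_def scaleR_cscale scale A_sum inA)
qed

text \<open>
  The averaging maps in question consist of two successive averages: one to make the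
  generators in a normal subgroup small, one for the rest.
\<close>

definition averaging :: "('g op \<Rightarrow> 'g op) \<Rightarrow> bool" where
  "averaging P \<longleftrightarrow> (\<exists>n u m v. n > 0 \<and> m > 0 \<and> P = (\<lambda>T. average m v (average n u T)))"

definition averages_vanish :: bool where
  "averages_vanish \<longleftrightarrow>
     (\<forall>F e. finite F \<longrightarrow> 0 \<notin> F \<longrightarrow> e > 0 \<longrightarrow> (\<exists>P. averaging P \<and> (\<forall>g\<in>F. norm (P (L g)) \<le> e)))"

lemma averagingD:
  assumes "averaging P"
  shows "P (S + T) = P S + P T" "P (c \<cdot> T) = c \<cdot> P T" "P id_blinfun = id_blinfun" "norm (P T) \<le> norm T"
    and "closed_ideal J A \<Longrightarrow> T \<in> J \<Longrightarrow> P T \<in> J"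
    and "tracial_state A \<tau> \<Longrightarrow> T \<in> A \<Longrightarrow> \<tau> (P T) = \<tau> T"
proof -
  obtain n u m v where P: "n > 0" "m > 0" "P = (\<lambda>T. average m v (average n u T))"
    using assms by (auto simp: averaging_def)
  show "P (S + T) = P S + P T" "P (c \<cdot> T) = c \<cdot> P T" "P id_blinfun = id_blinfun"
    using P by (simp_all add: average_add average_cscale average_id)
  show "norm (P T) \<le> norm T"
    unfolding P(3) by (rule order_trans[OF norm_average norm_average])
  show "closed_ideal J A \<Longrightarrow> T \<in> J \<Longrightarrow> P T \<in> J"
    unfolding P(3) by (intro average_in_ideal)
  show "\<tau> (P T) = \<tau> T" if "tracial_state A \<tau>" "T \<in> A"
    using trace_average[OF that(1) average_in_ideal[OF A_ideal that(2)] P(2)]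
      trace_average[OF that P(1)] by (simp add: P(3))
qed

lemma averaging_zero: "averaging P \<Longrightarrow> P 0 = 0"
  using averagingD(2)[of P 0 0] by simp

text \<open>
  An averaging map acts linearly and fixes scalars, so on a finite combination its distance from
  the trace is controlled by the finitely many generators occurring in it.
\<close>

definition controlled_by :: "'g op \<Rightarrow> 'g set \<Rightarrow> real \<Rightarrow> bool" where
  "controlled_by T F K \<longleftrightarrow> (\<forall>P e. averaging P \<longrightarrow> (\<forall>g\<in>F. norm (P (L g)) \<le> e) \<longrightarrow>
     norm (P T - canonical_trace T \<cdot> id_blinfun) \<le> K * e)"

lemma controlled_byD:
  "controlled_by T F K \<Longrightarrow> averaging P \<Longrightarrow> (\<And>g. g \<in> F \<Longrightarrow> norm (P (L g)) \<le> e) \<Longrightarrow>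
     norm (P T - canonical_trace T \<cdot> id_blinfun) \<le> K * e"
  by (simp add: controlled_by_def)

lemma group_algebra_controlled:
  assumes "T \<in> group_algebra"
  shows "\<exists>F K. finite F \<and> 0 \<notin> F \<and> controlled_by T F K"
  using assms
proof (induction rule: group_algebra.induct)
  case zero
  show ?case
    by (rule exI[of _ "{}"], rule exI[of _ 0])
      (auto dest!: averaging_zero simp: controlled_by_def canonical_trace_eq A_zero)
next
  case (add T c g)
  then obtain F K where F: "finite F" "0 \<notin> F"
    and ctrl: "controlled_by T F K" by blast
  have T: "T \<in> A" using add group_algebra_subset_A by blast
  have tr: "canonical_trace (T + c \<cdot> L g) = canonical_trace T + c * (if g = 0 then 1 else 0)"
    using tracial_canonical_trace T by (simp add: tracial_state_def A_cscale L_in_A canonical_trace_L)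
  show ?case
  proof (cases "g = 0")
    case True
    have "P (T + c \<cdot> L g) - canonical_trace (T + c \<cdot> L g) \<cdot> id_blinfun = P T - canonical_trace T \<cdot> id_blinfun"
      if "averaging P" for P
      unfolding averagingD(1)[OF that] tr using averagingD(2)[OF that, of c id_blinfun] averagingD(3)[OF that] True
      by (intro blinfun_eqI) (simp add: scaleC_add_left)
    then have "controlled_by (T + c \<cdot> L g) F K" using ctrl by (simp add: controlled_by_def)
    then show ?thesis using F by blast
  next
    case False
    have "norm (P (T + c \<cdot> L g) - canonical_trace (T + c \<cdot> L g) \<cdot> id_blinfun) \<le> (K + cmod c) * e"
      if P: "averaging P" "\<forall>h\<in>insert g F. norm (P (L h)) \<le> e" for P e
    proof -
      have "P (T + c \<cdot> L g) - canonical_trace (T + c \<cdot> L g) \<cdot> id_blinfun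
          = (P T - canonical_trace T \<cdot> id_blinfun) + c \<cdot> P (L g)"
        using averagingD(1,2)[OF P(1)] False by (simp add: tr)
      moreover have "norm (c \<cdot> P (L g)) \<le> cmod c * e"
        by (rule order_trans[OF norm_cscale]) (use P(2) in \<open>auto intro: mult_left_mono\<close>)
      moreover have "norm (P T - canonical_trace T \<cdot> id_blinfun) \<le> K * e"
        using controlled_byD[OF ctrl P(1)] P(2) by simp
      ultimately show ?thesis
        using norm_triangle_ineq[of "P T - canonical_trace T \<cdot> id_blinfun" "c \<cdot> P (L g)"]
        by (simp add: distrib_right)
    qed
    then have "controlled_by (T + c \<cdot> L g) (insert g F) (K + cmod c)" unfolding controlled_by_def by meson
    then show ?thesis using F False by (intro exI[of _ "insert g F"] exI[of _ "K + cmod c"]) auto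
  qed
qed

text \<open>
  This is the Dixmier property, with conjugations by generators only. Averaging maps are
  contractive, so approximating \<open>T\<close> by finite combinations reduces it to generators.
\<close>

lemma average_to_trace:
  assumes van: averages_vanish and T: "T \<in> A" and e: "e > 0"
  obtains P where "averaging P" "norm (P T - canonical_trace T \<cdot> id_blinfun) < e"
proof -
  obtain S where S: "S \<in> group_algebra" "norm (S - T) < e / 4"
    using A_approx[OF T, of "e/4"] e by auto
  then have SA: "S \<in> A" using group_algebra_subset_A by blast
  obtain F K where F: "finite F" "0 \<notin> F"
    and ctrl: "controlled_by S F K"
    using group_algebra_controlled[OF S(1)] by blast
  define d where "d = e / (4 * (\<bar>K\<bar> + 1))"
  have d: "d > 0" using e by (simp add: d_def)
  obtain P where "averaging P \<and> (\<forall>g\<in>F. norm (P (L g)) \<le> d)"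
    using van[unfolded averages_vanish_def, rule_format, OF F d] by (rule exE)
  then have P: "averaging P" "\<And>g. g \<in> F \<Longrightarrow> norm (P (L g)) \<le> d" by auto
  have "K * d \<le> (\<bar>K\<bar> + 1) * d" using d by (intro mult_right_mono) auto
  also have "\<dots> = e / 4" by (simp add: d_def field_simps)
  finally have 1: "norm (P S - canonical_trace S \<cdot> id_blinfun) \<le> e / 4"
    using controlled_byD[OF ctrl P] by linarith
  have TS: "norm (T - S) < e / 4" "T - S \<in> A" using S(2) T SA by (simp_all add: norm_minus_commute A_diff)
  have 2: "norm (P (T - S)) \<le> e / 4" using averagingD(4)[OF P(1), of "T - S"] TS by linarith
  have "cmod (canonical_trace (S - T)) \<le> 2 * norm (S - T)"
    using tracial_state_bounded[OF tracial_canonical_trace] A_diff SA T by blast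
  moreover have "norm (canonical_trace (S - T) \<cdot> (id_blinfun :: 'g op)) \<le> cmod (canonical_trace (S - T)) * norm (id_blinfun :: 'g op)"
    by (rule norm_cscale)
  moreover have "cmod (canonical_trace (S - T)) * norm (id_blinfun :: 'g op) \<le> cmod (canonical_trace (S - T))"
    using norm_L[of 0] by (intro mult_left_le) simp_all
  ultimately have 3: "norm (canonical_trace (S - T) \<cdot> (id_blinfun :: 'g op)) < e / 2"
    using S(2) by linarith
  have "canonical_trace ((S - T) + T) = canonical_trace (S - T) + canonical_trace T"
    using tracial_canonical_trace A_diff SA T unfolding tracial_state_def by blast
  then have "canonical_trace S = canonical_trace (S - T) + canonical_trace T" by simp
  then have 4: "canonical_trace S \<cdot> (id_blinfun :: 'g op) - canonical_trace T \<cdot> id_blinfun = canonical_trace (S - T) \<cdot> id_blinfun"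
    by (intro blinfun_eqI) (simp add: scaleC_add_left)
  have "P T = P (T - S) + P S" using averagingD(1)[OF P(1), of "T - S" S] by simp
  then have "P T - canonical_trace T \<cdot> id_blinfun
     = P (T - S) + (P S - canonical_trace S \<cdot> id_blinfun) + canonical_trace (S - T) \<cdot> id_blinfun"
    by (simp add: 4[simplified, symmetric])
  then have "norm (P T - canonical_trace T \<cdot> id_blinfun)
     \<le> norm (P (T - S)) + norm (P S - canonical_trace S \<cdot> id_blinfun) + norm (canonical_trace (S - T) \<cdot> (id_blinfun :: 'g op))"
    by (metis norm_triangle_mono norm_triangle_ineq order_refl)
  then show thesis using that[OF P(1)] 1 2 3 by linarith
qed

lemma id_nonzero: "(id_blinfun :: 'g op) \<noteq> 0"
proof
  assume "(id_blinfun :: 'g op) = 0"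
  then have "norm (blinfun_apply (id_blinfun :: 'g op) (delta 0)) = 0" by simp
  then show False by simp
qed

text \<open>
  An ideal containing \<open>T \<noteq> 0\<close> contains averages of \<open>T\<^sup>*T\<close> close to the nonzero scalar
  \<open>\<parallel>T (delta 0)\<parallel>\<^sup>2\<close>, hence the unit.
\<close>

lemma simple_if_averages_vanish:
  assumes van: averages_vanish shows "cstar_simple \<sigma>"
  unfolding cstar_simple_def simple_algebra_def
proof (intro conjI allI impI)
  show "A \<noteq> {0}" using id_in_A id_nonzero by auto
  fix J assume J: "closed_ideal J A"
  show "J = {0} \<or> J = A"
  proof (cases "J \<subseteq> {0}")
    case True
    then show ?thesis using J by (auto simp: closed_ideal_def complex_subspace_def)
  next
    case False
    then obtain T where T: "T \<in> J" "T \<noteq> 0" by blast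
    then have TA: "T \<in> A" using J by (auto simp: closed_ideal_def)
    define X where "X = adj T o\<^sub>L T"
    define t where "t = (norm (T (delta 0)))\<^sup>2"
    have X: "X \<in> J" "X \<in> A" using J T TA by (auto simp: closed_ideal_def X_def A_adj A_compose)
    have t: "t > 0" using A_delta_zero_separating[OF TA] T by (auto simp: t_def)
    have tr: "canonical_trace X = complex_of_real t"
      using adjoint_pair_sym[OF adjoint_pair_adj[OF TA]] X
      by (simp add: canonical_trace_eq X_def adjoint_pair_def cinner_self t_def)
    have "\<exists>Y\<in>J. dist Y id_blinfun < e" if e: "e > 0" for e
    proof -
      obtain P where P: "averaging P" "norm (P X - canonical_trace X \<cdot> id_blinfun) < e * t"
        using average_to_trace[OF van X(2), of "e * t"] e t by auto
      have mem: "(1/t) *\<^sub>R P X \<in> J"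
        using averagingD(5)[OF P(1) J X(1)] J by (auto simp: scaleR_cscale closed_ideal_def complex_subspace_def)
      have "(1/t) *\<^sub>R P X - id_blinfun = (1/t) *\<^sub>R (P X - canonical_trace X \<cdot> id_blinfun)"
        unfolding tr scaleR_cscale[symmetric] using t by (simp add: scaleR_diff_right)
      then have "norm ((1/t) *\<^sub>R P X - id_blinfun) = norm (P X - canonical_trace X \<cdot> id_blinfun) / t"
        using t by simp
      then have "norm ((1/t) *\<^sub>R P X - id_blinfun) < e" using P(2) t by (simp only: pos_divide_less_eq)
      then show ?thesis using mem by (metis dist_norm)
    qed
    then have "id_blinfun \<in> closure J" by (simp add: closure_approachable)
    then have "id_blinfun \<in> J" using J by (simp add: closed_ideal_def)
    then have "S \<in> J" if "S \<in> A" for S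
      using J that compose_id(1)[of S] unfolding closed_ideal_def by metis
    then show ?thesis using J by (auto simp: closed_ideal_def)
  qed
qed

lemma unique_trace_if_averages_vanish:
  assumes van: averages_vanish shows "unique_trace_property \<sigma>"
  unfolding unique_trace_property_def
proof (rule ex1I)
  show "tracial_state A canonical_trace" by (rule tracial_canonical_trace)
  fix \<tau> assume \<tau>: "tracial_state A \<tau>"
  have "\<tau> T = canonical_trace T" if T: "T \<in> A" for T
  proof (rule ccontr)
    assume "\<tau> T \<noteq> canonical_trace T"
    define e where "e = cmod (\<tau> T - canonical_trace T) / 2"
    have e: "e > 0" using \<open>\<tau> T \<noteq> _\<close> by (simp add: e_def)
    obtain P where P: "averaging P" "norm (P T - canonical_trace T \<cdot> id_blinfun) < e"
      using average_to_trace[OF van T e] .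
    have inA: "P T \<in> A" "canonical_trace T \<cdot> id_blinfun \<in> A"
      using averagingD(5)[OF P(1) A_ideal T] A_cscale[OF id_in_A] by blast+
    have "\<tau> ((P T - canonical_trace T \<cdot> id_blinfun) + canonical_trace T \<cdot> id_blinfun)
        = \<tau> (P T - canonical_trace T \<cdot> id_blinfun) + \<tau> (canonical_trace T \<cdot> id_blinfun)"
      using \<tau> inA A_diff[OF inA] unfolding tracial_state_def by blast
    moreover have "\<tau> (canonical_trace T \<cdot> id_blinfun) = canonical_trace T"
      using \<tau> id_in_A unfolding tracial_state_def by (metis mult_1_right)
    moreover have "\<tau> (P T) = \<tau> T" using averagingD(6)[OF P(1) \<tau> T] .
    ultimately have "\<tau> (P T - canonical_trace T \<cdot> id_blinfun) = \<tau> T - canonical_trace T" by simp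
    then have "cmod (\<tau> T - canonical_trace T) \<le> 2 * norm (P T - canonical_trace T \<cdot> id_blinfun)"
      using tracial_state_bounded[OF \<tau> A_diff[OF inA]] by simp
    then show False using P(2) by (simp add: e_def)
  qed
  then show "\<tau> = canonical_trace"
    using \<tau> tracial_canonical_trace
    by (intro extensionalityI[of _ A]) (auto simp: tracial_state_def)
qed

definition vanish_on :: "'g set \<Rightarrow> bool" where
  "vanish_on M \<longleftrightarrow> (\<forall>F e. finite F \<longrightarrow> F \<subseteq> M \<longrightarrow> e > 0 \<longrightarrow>
     (\<exists>n u. n > 0 \<and> (\<forall>g\<in>F. norm (average n u (L g)) \<le> e)))"

lemma norm_average_average:
  assumes "\<And>i. i < n \<Longrightarrow> norm (average m v (L (u i + g - u i))) \<le> e" and n: "n > 0"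
  shows "norm (average m v (average n u (L g))) \<le> e"
proof -
  have sum: "average m v (\<Sum>i\<in>I. f i) = (\<Sum>i\<in>I. average m v (f i))" for I and f :: "nat \<Rightarrow> 'g op"
    by (induction I rule: infinite_finite_induct)
      (simp_all add: average_add average_cscale[of m v 0 0, simplified])
  have "norm (\<Sum>i<n. average m v (conj_by (u i) (L g))) \<le> (\<Sum>i<n. e)"
  proof (rule sum_norm_le)
    fix i assume "i \<in> {..<n}"
    then have i: "norm (average m v (L (u i + g - u i))) \<le> e" using assms(1) by simp
    have "norm (average m v (conj_by (u i) (L g))) \<le> 1 * norm (average m v (L (u i + g - u i)))"
      unfolding conj_by_L average_cscale
      by (rule order_trans[OF norm_cscale]) (simp add: norm_mult)
    then show "norm (average m v (conj_by (u i) (L g))) \<le> e" using i by simp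
  qed
  then have "norm (\<Sum>i<n. average m v (conj_by (u i) (L g))) \<le> n * e" by simp
  moreover have "average m v (average n u (L g)) = (1 / n) *\<^sub>R (\<Sum>i<n. average m v (conj_by (u i) (L g)))"
    by (simp add: average_def[of n] scaleR_cscale average_cscale sum)
  ultimately show ?thesis using n by (simp add: field_simps)
qed

text \<open>
  The average that makes the generators in \<open>M\<close> small turns the others into combinations of finitely
  many conjugates, which still avoid \<open>M\<close>. A second average makes those small and, being
  contractive, keeps the first ones small.
\<close>

lemma averages_vanish_normal:
  assumes M: "vanish_on (M - {0})" and off: "vanish_on (- M)"
    and normal: "\<And>g h. g \<notin> M \<Longrightarrow> h + g - h \<notin> M"
  shows averages_vanish
  unfolding averages_vanish_def
proof (intro allI impI)
  fix F :: "'g set" and e :: real assume F: "finite F" "0 \<notin> F" and e: "e > 0"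
  have "finite (F \<inter> M)" "F \<inter> M \<subseteq> M - {0}" using F by auto
  from M[unfolded vanish_on_def, rule_format, OF this e]
  obtain n u where nu: "n > 0" "\<forall>g\<in>F \<inter> M. norm (average n u (L g)) \<le> e" by (elim exE conjE)
  define F' where "F' = (\<lambda>(i, g). u i + g - u i) ` ({..<n} \<times> (F - M))"
  have "finite F'" "F' \<subseteq> - M" using F normal by (auto simp: F'_def)
  from off[unfolded vanish_on_def, rule_format, OF this e]
  obtain m v where mv: "m > 0" "\<forall>g\<in>F'. norm (average m v (L g)) \<le> e" by (elim exE conjE)
  define P where "P = (\<lambda>T. average m v (average n u T))"
  have "averaging P" using nu(1) mv(1) by (auto simp: averaging_def P_def)
  moreover have "norm (P (L g)) \<le> e" if g: "g \<in> F" for g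
  proof (cases "g \<in> M")
    case True
    then show ?thesis unfolding P_def using nu(2) g order_trans[OF norm_average] by blast
  next
    case False
    then show ?thesis unfolding P_def using g mv(2) nu(1)
      by (intro norm_average_average) (auto simp: F'_def)
  qed
  ultimately show "\<exists>P. averaging P \<and> (\<forall>g\<in>F. norm (P (L g)) \<le> e)" by blast
qed

section \<open>Powers' estimate\<close>

lemma sum_norm_supp_proj_le:
  assumes "disjoint_family_on B {..<n::nat}"
  shows "(\<Sum>j<n. norm (supp_proj (B j) \<xi>)) \<le> sqrt n * norm \<xi>"
proof -
  have "(\<Sum>j<n. norm (supp_proj (B j) \<xi>))\<^sup>2 \<le> (\<Sum>j<n. (norm (supp_proj (B j) \<xi>))\<^sup>2) * card {..<n}"
    by (rule sum_squared_le_sum_of_squares)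
  also have "\<dots> \<le> (norm \<xi>)\<^sup>2 * n"
    using sum_norm_supp_proj[OF _ assms] by (simp add: mult_right_mono)
  also have "\<dots> = (sqrt n * norm \<xi>)\<^sup>2" by (simp add: power_mult_distrib)
  finally show ?thesis by (rule power2_le_imp_le) simp
qed

text \<open>
  If \<open>g\<close> maps the complement of \<open>E\<close> into \<open>E\<close>, then the conjugate of \<open>L g\<close> by \<open>u j\<close> maps vectors
  supported off \<open>B j = u j + E\<close> to vectors supported in \<open>B j\<close>. So each matrix coefficient of that
  conjugate sees one of the two vectors only through its part in \<open>B j\<close>, and the \<open>B j\<close> are disjoint.
\<close>

lemma powers_average:
  assumes disj: "disjoint_family_on (\<lambda>j. (+) (u j) ` E) {..<n}"
    and E: "\<And>y. y \<notin> E \<Longrightarrow> g + y \<in> E"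
    and n: "n > 0"
  shows "norm (average n u (L g)) \<le> 2 / sqrt n"
proof -
  define B where "B j = (+) (u j) ` E" for j
  define X where "X j = conj_by (u j) (L g)" for j
  have nX: "norm (X j \<xi>) \<le> norm \<xi>" for j \<xi>
  proof -
    have "norm (X j) \<le> 1" using norm_conj_by norm_L unfolding X_def by (rule order_trans)
    then show ?thesis
      using norm_blinfun[of "X j" \<xi>] mult_right_mono[of "norm (X j)" 1 "norm \<xi>"] by simp
  qed
  have moves: "y \<in> B j" if y: "- (u j + g - u j) + y \<notin> B j" for j y
  proof -
    let ?y = "- (u j + g - u j) + y"
    have "- u j + ?y \<notin> E" using y unfolding B_def by (metis add_minus_cancel image_eqI)
    then have "u j + (g + (- u j + ?y)) \<in> B j" using E unfolding B_def by blast
    moreover have "u j + (g + (- u j + ?y)) = y"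
      by (simp add: minus_add diff_conv_add_uminus add.assoc del: add_uminus_conv_diff)
    ultimately show ?thesis by simp
  qed
  have supp: "supp_proj (B j) (X j \<zeta>) = X j \<zeta>" if "supp_proj (B j) \<zeta> = 0" for j \<zeta>
  proof (rule ell2_eqI)
    fix y
    have "ell2_at \<zeta> y = 0" if "y \<in> B j" for y
      using \<open>supp_proj (B j) \<zeta> = 0\<close> that by (metis supp_proj.rep_eq zero_ell2.rep_eq)
    then have "ell2_at (X j \<zeta>) y = 0" if "y \<notin> B j"
      using moves[of j y] that by (auto simp: X_def conj_by_L scaleC.rep_eq L_at)
    then show "ell2_at (supp_proj (B j) (X j \<zeta>)) y = ell2_at (X j \<zeta>) y"
      by (auto simp: supp_proj.rep_eq)
  qed
  have inner_proj: "inner (supp_proj E \<xi>) \<eta> = inner (supp_proj E \<xi>) (supp_proj E \<eta>)" for E and \<xi> \<eta> :: "'g ell2"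
    unfolding inner_ell2_def cinner_def by (rule arg_cong[where f = Re], rule infsum_cong) (simp add: supp_proj.rep_eq)
  have coeff: "inner (X j \<xi>) \<eta> \<le> norm (supp_proj (B j) \<xi>) * norm \<eta> + norm \<xi> * norm (supp_proj (B j) \<eta>)" for j \<xi> \<eta>
  proof -
    define \<zeta> where "\<zeta> = \<xi> - supp_proj (B j) \<xi>"
    have "\<zeta> = supp_proj (- B j) \<xi>"
      by (rule ell2_eqI) (simp add: \<zeta>_def minus_ell2.rep_eq supp_proj.rep_eq)
    then have n\<zeta>: "norm \<zeta> \<le> norm \<xi>" by (simp add: norm_supp_proj)
    have "supp_proj (B j) \<zeta> = 0"
      by (rule ell2_eqI) (simp add: \<zeta>_def minus_ell2.rep_eq supp_proj.rep_eq zero_ell2.rep_eq)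
    from supp[OF this] have "inner (X j \<zeta>) \<eta> = inner (X j \<zeta>) (supp_proj (B j) \<eta>)"
      by (metis inner_proj)
    also have "\<dots> \<le> norm \<xi> * norm (supp_proj (B j) \<eta>)"
      by (rule order_trans[OF norm_cauchy_schwarz]) (meson mult_right_mono n\<zeta> nX norm_ge_zero order_trans)
    finally have 1: "inner (X j \<zeta>) \<eta> \<le> norm \<xi> * norm (supp_proj (B j) \<eta>)" .
    have 2: "inner (X j (supp_proj (B j) \<xi>)) \<eta> \<le> norm (supp_proj (B j) \<xi>) * norm \<eta>"
      by (rule order_trans[OF norm_cauchy_schwarz]) (simp add: mult_right_mono nX)
    have "X j \<xi> = X j \<zeta> + X j (supp_proj (B j) \<xi>)" by (simp add: \<zeta>_def blinfun.diff_right)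
    then show ?thesis using 1 2 by (simp add: inner_add_left)
  qed
  have sum_bound: "norm ((\<Sum>j<n. X j) \<xi>) \<le> 2 * sqrt n * norm \<xi>" for \<xi>
  proof (cases "(\<Sum>j<n. X j) \<xi> = 0")
    case False
    define \<eta> where "\<eta> = (\<Sum>j<n. X j) \<xi>"
    have disjB: "disjoint_family_on B {..<n}" using disj unfolding B_def .
    have "norm \<eta> * norm \<eta> = (\<Sum>j<n. inner (X j \<xi>) \<eta>)"
      by (simp add: \<eta>_def blinfun.sum_left inner_sum_left[symmetric] power2_norm_eq_inner[symmetric] power2_eq_square)
    also have "\<dots> \<le> (\<Sum>j<n. norm (supp_proj (B j) \<xi>) * norm \<eta> + norm \<xi> * norm (supp_proj (B j) \<eta>))"
      by (rule sum_mono) (rule coeff)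
    also have "\<dots> = (\<Sum>j<n. norm (supp_proj (B j) \<xi>)) * norm \<eta> + norm \<xi> * (\<Sum>j<n. norm (supp_proj (B j) \<eta>))"
      by (simp add: sum.distrib sum_distrib_left sum_distrib_right)
    also have "\<dots> \<le> (sqrt n * norm \<xi>) * norm \<eta> + norm \<xi> * (sqrt n * norm \<eta>)"
      by (intro add_mono mult_right_mono mult_left_mono sum_norm_supp_proj_le disjB) auto
    also have "\<dots> = (2 * sqrt n * norm \<xi>) * norm \<eta>" by simp
    finally show ?thesis using False by (simp add: \<eta>_def)
  qed simp
  have "norm (\<Sum>j<n. X j) \<le> 2 * sqrt n"
    by (rule norm_blinfun_bound) (use sum_bound in auto)
  then have "norm (average n u (L g)) \<le> 2 * sqrt n / n"
    using n by (simp add: average_def X_def divide_right_mono)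
  also have "\<dots> = 2 / sqrt n" using n by (simp add: field_simps)
  finally show ?thesis .
qed

end

section \<open>Weyl sums with operator coefficients\<close>

lemma norm_geometric_sum:
  fixes q :: complex
  assumes "cmod q = 1" "q \<noteq> 1"
  shows "cmod (\<Sum>j<N. q ^ j) \<le> 2 / cmod (1 - q)"
proof -
  have "cmod (1 - q ^ N) \<le> 2"
    using norm_triangle_ineq4[of 1 "q ^ N"] assms(1) by (simp add: norm_power)
  then show ?thesis
    using assms(2) by (simp add: sum_gp_strict norm_divide divide_right_mono)
qed

lemma unit_cnj_power: "cmod z = 1 \<Longrightarrow> z ^ n * cnj (z ^ n) = 1"
  by (simp add: complex_norm_square[symmetric] norm_power del: complex_cnj_power)

lemma unit_power_cnj_neq_1:
  assumes z: "cmod z = 1" "\<And>d::nat. d > 0 \<Longrightarrow> z ^ d \<noteq> 1" and "h \<noteq> h'"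
  shows "z ^ h * cnj (z ^ h') \<noteq> 1"
proof
  assume 1: "z ^ h * cnj (z ^ h') = 1"
  have "z ^ h = z ^ h * cnj (z ^ h') * z ^ h'"
    using unit_cnj_power[OF z(1), of h'] by (metis mult.assoc mult.commute mult_1_right)
  then have eq: "z ^ h = z ^ h'" by (simp only: 1 mult_1_left)
  have "z ^ (b - a) = 1" if "a < b" "z ^ a = z ^ b" for a b
  proof -
    have "z ^ a * z ^ (b - a) = z ^ b" using that(1) by (simp add: power_add[symmetric])
    moreover have "z ^ a \<noteq> 0" using z(1) by auto
    ultimately show ?thesis using that(2) by (metis mult_cancel_left mult_1_right)
  qed
  then show False using z(2) eq \<open>h \<noteq> h'\<close> by (metis linorder_neqE_nat zero_less_diff)
qed

text \<open>
  Expanding the squares gives a double sum over \<open>h\<close> and \<open>h'\<close>. The diagonal contributes at most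
  \<open>c\<^sup>2 H N\<close>; off the diagonal the sums over \<open>j\<close> are geometric, bounded independently of \<open>N\<close>.
\<close>

lemma mean_square_twisted_sums:
  fixes y :: "nat \<Rightarrow> 'g ell2"
  assumes z: "cmod z = 1" "\<And>d::nat. d > 0 \<Longrightarrow> z ^ d \<noteq> 1"
    and y: "\<And>h. norm (y h) \<le> c"
  shows "(\<Sum>j<N. (norm (\<Sum>h<H. scaleC (z ^ (j * h)) (y h)))\<^sup>2)
     \<le> c\<^sup>2 * (real H * real N + (\<Sum>h<H. \<Sum>h'<H. 2 / cmod (1 - z ^ h * cnj (z ^ h'))))"
    (is "?S \<le> _")
proof -
  have c: "c \<ge> 0" using y[of 0] norm_ge_zero order_trans by blast
  have "complex_of_real ?S = (\<Sum>j<N. \<Sum>h<H. \<Sum>h'<H. (z ^ h * cnj (z ^ h')) ^ j * cinner (y h) (y h'))"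
    unfolding of_real_sum cinner_self[symmetric]
    by (rule sum.cong[OF refl], subst cinner_sum_left, rule sum.cong[OF refl],
        subst cinner_sum_right, rule sum.cong[OF refl])
      (simp add: cinner_scaleC_left cinner_scaleC_right power_mult_distrib power_mult[symmetric] mult_ac)
  also have "\<dots> = (\<Sum>h<H. \<Sum>j<N. \<Sum>h'<H. (z ^ h * cnj (z ^ h')) ^ j * cinner (y h) (y h'))"
    by (rule sum.swap)
  also have "\<dots> = (\<Sum>h<H. \<Sum>h'<H. (\<Sum>j<N. (z ^ h * cnj (z ^ h')) ^ j) * cinner (y h) (y h'))"
    by (rule sum.cong[OF refl]) (subst sum.swap, simp add: sum_distrib_right)
  finally have "?S = cmod (\<Sum>h<H. \<Sum>h'<H. (\<Sum>j<N. (z ^ h * cnj (z ^ h')) ^ j) * cinner (y h) (y h'))"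
    by (metis (no_types, lifting) norm_of_real abs_of_nonneg sum_nonneg zero_le_power2)
  also have "\<dots> \<le> (\<Sum>h<H. \<Sum>h'<H. ((if h = h' then real N else 0) + 2 / cmod (1 - z ^ h * cnj (z ^ h'))) * c\<^sup>2)"
  proof (intro sum_norm_le)
    fix h h'
    have "cmod (cinner (y h) (y h')) \<le> c\<^sup>2"
      unfolding power2_eq_square
      by (rule order_trans[OF cinner_cauchy_schwarz]) (intro mult_mono y c norm_ge_zero)
    moreover have "cmod (\<Sum>j<N. (z ^ h * cnj (z ^ h')) ^ j)
        \<le> (if h = h' then real N else 0) + 2 / cmod (1 - z ^ h * cnj (z ^ h'))"
    proof (cases "h = h'")
      case True
      then show ?thesis unfolding True unit_cnj_power[OF z(1)] by simp
    next
      case False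
      then show ?thesis
        using norm_geometric_sum[OF _ unit_power_cnj_neq_1[OF z False], of N] z(1)
        by (simp add: norm_mult norm_power)
    qed
    ultimately show "cmod ((\<Sum>j<N. (z ^ h * cnj (z ^ h')) ^ j) * cinner (y h) (y h'))
       \<le> ((if h = h' then real N else 0) + 2 / cmod (1 - z ^ h * cnj (z ^ h'))) * c\<^sup>2"
      unfolding norm_mult by (intro mult_mono) auto
  qed
  also have "\<dots> = c\<^sup>2 * (real H * real N + (\<Sum>h<H. \<Sum>h'<H. 2 / cmod (1 - z ^ h * cnj (z ^ h'))))"
    unfolding sum_distrib_right[symmetric] by (simp add: sum.distrib mult.commute)
  finally show ?thesis .
qed

context twisted_group begin

definition multiple :: "nat \<Rightarrow> 'g \<Rightarrow> 'g" where "multiple k w = ((+) w ^^ k) 0"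

lemma multiple_simps [simp]: "multiple 0 w = 0" "multiple (Suc k) w = w + multiple k w"
  by (simp_all add: multiple_def)

lemma multiple_Suc_right: "multiple (Suc k) w = multiple k w + w"
  by (induction k) (simp, metis add.assoc multiple_simps(2))

lemma conj_by_multiple_eigen:
  assumes T: "T \<in> bounded_ops" and eig: "conj_by w T = \<rho> \<cdot> T"
  shows "conj_by (multiple k w) T = \<rho> ^ k \<cdot> T"
proof (induction k)
  case (Suc k)
  have "conj_by (multiple (Suc k) w) T = conj_by w (conj_by (multiple k w) T)"
    using conj_by_conj_by[OF T] by simp
  then show ?case by (simp add: Suc conj_by_cscale eig mult.commute)
qed simp

lemma average_eigenvector_small:
  assumes T: "T \<in> bounded_ops" "norm T \<le> 1" and eig: "conj_by w T = \<rho> \<cdot> T"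
    and \<rho>: "cmod \<rho> = 1" "\<rho> \<noteq> 1" and e: "e > 0"
  shows "\<forall>\<^sub>F N in sequentially. norm (average N (\<lambda>k. multiple k w) T) \<le> e"
proof -
  define C where "C = 2 / cmod (1 - \<rho>)"
  have bound: "norm (average N (\<lambda>k. multiple k w) T) \<le> C / N" for N
  proof -
    have "(\<Sum>k<N. \<rho> ^ k \<cdot> T) = (\<Sum>k<N. \<rho> ^ k) \<cdot> T"
      by (rule blinfun_eqI, rule ell2_eqI)
        (induction N, simp_all add: blinfun.add_left plus_ell2.rep_eq scaleC.rep_eq algebra_simps)
    then have "norm (\<Sum>k<N. conj_by (multiple k w) T) \<le> cmod (\<Sum>k<N. \<rho> ^ k) * norm T"
      using norm_cscale by (simp add: conj_by_multiple_eigen[OF T(1) eig])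
    also have "\<dots> \<le> C * 1"
      unfolding C_def by (intro mult_mono norm_geometric_sum \<rho> T) auto
    finally show ?thesis by (simp add: average_def divide_right_mono)
  qed
  have "(\<lambda>N. C / real N) \<longlonglongrightarrow> 0" by (rule lim_const_over_n)
  then have "\<forall>\<^sub>F N in sequentially. C / real N < e" using e by (rule order_tendstoD)
  then show ?thesis by eventually_elim (use bound order_trans less_imp_le in blast)
qed

text \<open>
  Here conjugation by \<open>k w\<close> multiplies \<open>V\<close> by \<open>W\<^sup>k\<close> and by a phase quadratic in \<open>k\<close>. As in van
  der Corput's inequality, the average over a block of length \<open>H\<close> turns the quadratic phase into
  one linear in the number of the block, and then averages over the blocks.
\<close>

lemma average_quadratic_phase_small:
  assumes V: "V \<in> bounded_ops" "\<And>\<xi>. norm (V \<xi>) \<le> norm \<xi>"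
    and W: "W \<in> bounded_ops" "\<And>\<xi>. norm (W \<xi>) = norm \<xi>"
    and conjV: "conj_by w V = \<rho> \<cdot> (W o\<^sub>L V)" and conjW: "conj_by w W = \<nu> \<cdot> W"
    and \<rho>: "cmod \<rho> = 1" and \<nu>: "cmod \<nu> = 1" "\<And>d::nat. d > 0 \<Longrightarrow> \<nu> ^ d \<noteq> 1"
    and H: "H > (0::nat)"
  shows "\<forall>\<^sub>F N in sequentially. norm (average (N * H) (\<lambda>k. multiple k w) V) \<le> sqrt (2 / real H)"
proof -
  define \<gamma> where "\<gamma> k = (\<Prod>j<k. \<rho> * \<nu> ^ j)" for k :: nat
  have \<gamma>_norm: "cmod (\<gamma> k) = 1" for k
    by (simp add: \<gamma>_def prod_norm[symmetric] norm_mult norm_power \<rho> \<nu>)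
  \<comment> \<open>The defect \<open>\<nu> ^ (k * h)\<close> is linear in \<open>k\<close>: this makes the sums over blocks geometric.\<close>
  have \<gamma>_add: "\<gamma> (k + h) = \<gamma> k * \<gamma> h * \<nu> ^ (k * h)" for k h
    by (induction h) (simp_all add: \<gamma>_def power_add algebra_simps)
  have Wpow_scale: "(blinfun_apply W ^^ k) (scaleC c \<xi>) = scaleC c ((blinfun_apply W ^^ k) \<xi>)" for k c \<xi>
    using W(1) by (induction k) (simp_all add: bounded_ops_scaleC)
  have Wpow_norm: "norm ((blinfun_apply W ^^ k) \<xi>) = norm \<xi>" for k \<xi>
    by (induction k) (simp_all add: W)
  have Wpow_sum: "(blinfun_apply W ^^ k) (\<Sum>i\<in>I. f i) = (\<Sum>i\<in>I. (blinfun_apply W ^^ k) (f i))" for k I and f :: "nat \<Rightarrow> 'g ell2"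
    by (induction k) (simp_all add: blinfun.sum_right)
  have conj_apply: "conj_by (multiple k w) V \<xi> = scaleC (\<gamma> k) ((blinfun_apply W ^^ k) (V \<xi>))" for k \<xi>
  proof (induction k)
    case (Suc k)
    have "conj_by (multiple (Suc k) w) V = conj_by (multiple k w) (conj_by w V)"
      unfolding multiple_Suc_right using conj_by_conj_by[OF V(1)] by simp
    also have "\<dots> = (\<rho> * \<nu> ^ k) \<cdot> (W o\<^sub>L conj_by (multiple k w) V)"
      by (simp only: conjV conj_by_cscale conj_by_compose[of _ W V]
          conj_by_multiple_eigen[OF W(1) conjW] compose_cscale_left cscale_cscale)
    finally show ?case
      using W(1) by (simp add: Suc \<gamma>_def bounded_ops_scaleC mult.commute)
  qed (simp add: \<gamma>_def)
  define z where "z = \<nu> ^ H"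
  have z: "cmod z = 1" "\<And>d::nat. d > 0 \<Longrightarrow> z ^ d \<noteq> 1"
    using \<nu> H by (simp_all add: z_def norm_power power_mult[symmetric])
  define C where "C = (\<Sum>h<H. \<Sum>h'<H. 2 / cmod (1 - z ^ h * cnj (z ^ h')))"
  have main: "norm (average (N * H) (\<lambda>k. multiple k w) V) \<le> sqrt (2 / real H)"
    if N: "N > 0" "N \<ge> C" for N
  proof (rule norm_blinfun_bound)
    fix \<xi>
    define y where "y h = scaleC (\<gamma> h) ((blinfun_apply W ^^ h) (V \<xi>))" for h
    have y_norm: "norm (y h) \<le> norm \<xi>" for h by (simp add: y_def \<gamma>_norm Wpow_norm V)
    have y_block: "y (j * H + h) = scaleC (\<gamma> (j * H)) ((blinfun_apply W ^^ (j * H)) (scaleC (z ^ (j * h)) (y h)))" for j h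
      by (simp add: y_def \<gamma>_add Wpow_scale funpow_add z_def power_mult[symmetric] mult_ac)
    have blocks: "(\<Sum>k<N * H. y k) = (\<Sum>j<N. \<Sum>h<H. y (j * H + h))" for N
    proof -
      have "(\<Sum>h<H. y (j * H + h)) = sum y {j * H..<j * H + H}" for j
        using sum.shift_bounds_nat_ivl[of y 0 "j * H" H] by (simp add: lessThan_atLeast0 add.commute)
      then show ?thesis by (simp add: sum.nat_group)
    qed
    have "norm (\<Sum>k<N * H. y k) \<le> (\<Sum>j<N. norm (\<Sum>h<H. scaleC (z ^ (j * h)) (y h)))"
      unfolding blocks
    proof (rule sum_norm_le)
      fix j
      have "(\<Sum>h<H. y (j * H + h))
          = scaleC (\<gamma> (j * H)) ((blinfun_apply W ^^ (j * H)) (\<Sum>h<H. scaleC (z ^ (j * h)) (y h)))"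
        by (simp add: y_block Wpow_sum scaleC_sum)
      then show "norm (\<Sum>h<H. y (j * H + h)) \<le> norm (\<Sum>h<H. scaleC (z ^ (j * h)) (y h))"
        by (simp add: \<gamma>_norm Wpow_norm)
    qed
    then have "(norm (\<Sum>k<N * H. y k))\<^sup>2 \<le> (\<Sum>j<N. norm (\<Sum>h<H. scaleC (z ^ (j * h)) (y h)))\<^sup>2"
      by (intro power_mono) auto
    also have "\<dots> \<le> (\<Sum>j<N. (norm (\<Sum>h<H. scaleC (z ^ (j * h)) (y h)))\<^sup>2) * N"
      using sum_squared_le_sum_of_squares[of _ "{..<N}"] by simp
    also have "\<dots> \<le> ((norm \<xi>)\<^sup>2 * (real H * real N + C)) * N"
      unfolding C_def by (intro mult_right_mono mean_square_twisted_sums z y_norm) auto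
    also have "\<dots> \<le> ((norm \<xi>)\<^sup>2 * (real H * real N + real H * real N)) * N"
    proof -
      have "C \<le> real H * real N" using N H by (metis mult_le_cancel_right1 of_nat_0_le_iff of_nat_1 of_nat_le_iff
            order_trans less_eq_Suc_le One_nat_def not_le)
      then show ?thesis by (intro mult_right_mono mult_left_mono) auto
    qed
    also have "\<dots> = (N * H)\<^sup>2 * (2 / real H) * (norm \<xi>)\<^sup>2"
      using H by (simp add: power2_eq_square field_simps)
    also have "\<dots> = (N * H * (sqrt (2 / real H) * norm \<xi>))\<^sup>2"
      by (simp add: power_mult_distrib)
    finally have "norm (\<Sum>k<N * H. y k) \<le> N * H * (sqrt (2 / real H) * norm \<xi>)"
      by (rule power2_le_imp_le) simp
    moreover have "average (N * H) (\<lambda>k. multiple k w) V \<xi> = (1 / real (N * H)) *\<^sub>R (\<Sum>k<N * H. y k)"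
      by (simp add: average_def blinfun.scaleR_left blinfun.sum_left conj_apply y_def)
    ultimately show "norm (average (N * H) (\<lambda>k. multiple k w) V \<xi>) \<le> sqrt (2 / real H) * norm \<xi>"
      using N H by (simp add: field_simps)
  qed simp
  obtain M :: nat where M: "C \<le> M" using real_arch_simple by blast
  show ?thesis
    unfolding eventually_sequentially
  proof (intro exI allI impI)
    fix N assume "N \<ge> Suc M"
    then show "norm (average (N * H) (\<lambda>k. multiple k w) V) \<le> sqrt (2 / real H)"
      using M by (intro main) linarith+
  qed
qed

end

section \<open>The group and its cocycle\<close>

lemma F2_one: "mat 1 \<in> F2"
  using subgroup.one_closed[OF subgroup_F2] by (simp add: SL2Z_def)

lemma F2_mult: "x \<in> F2 \<Longrightarrow> y \<in> F2 \<Longrightarrow> x ** y \<in> F2"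
  using subgroup.m_closed[OF subgroup_F2] by (simp add: SL2Z_def)

lemma F2_det: "x \<in> F2 \<Longrightarrow> x$1$1 * x$2$2 - x$1$2 * x$2$1 = 1"
  using subgroup.mem_carrier[OF subgroup_F2, of x] by (simp add: SL2Z_def det_2)

lemma v1_in_F2: "v1 \<in> F2" and v2_in_F2: "v2 \<in> F2"
  unfolding F2_def by (auto intro: generate.incl)

lemmas mat2_simps = vec_eq_iff forall_2 matrix_matrix_mult_def matrix_vector_mult_def sum_2 mat_def

lemma inv_v: "inv\<^bsub>SL2Z\<^esub> v1 = vector [vector [1, -2], vector [0, 1]]"
  "inv\<^bsub>SL2Z\<^esub> v2 = vector [vector [1, 0], vector [-2, 1]]"
  by (rule group.inv_equality[OF group_SL2Z];
      simp add: SL2Z_def v1_def v2_def det_2 mat2_simps)+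

text \<open>This congruence excludes \<open>- mat 1\<close>, the only other matrix of determinant \<open>1\<close> that fixes every line.\<close>

lemma F2_mod4:
  assumes "x \<in> F2"
  shows "x$1$1 mod 4 = 1 \<and> x$2$2 mod 4 = 1 \<and> even (x$1$2) \<and> even (x$2$1)"
  using assms unfolding F2_def
proof (induction rule: generate.induct)
  case one
  then show ?case by (simp add: SL2Z_def mat_def)
next
  case (incl h)
  then show ?case by (auto simp: v1_def v2_def)
next
  case (inv h)
  then show ?case by (auto simp: inv_v)
next
  case (eng x y)
  have "(x$1$1 * y$1$1 + x$1$2 * y$2$1) mod 4 = 1"
    "(x$2$1 * y$1$2 + x$2$2 * y$2$2) mod 4 = 1"
  proof -
    have p: "(a * b + c * d) mod 4 = 1" if "a mod 4 = 1" "b mod 4 = 1" "even c" "even d" for a b c d :: int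
    proof -
      have "4 dvd c * d" using that(3,4) mult_dvd_mono[of 2 c 2 d] by simp
      then have "(a * b + c * d) mod 4 = (a * b) mod 4" by (metis add.right_neutral dvd_imp_mod_0 mod_add_right_eq)
      also have "\<dots> = 1" using that by (metis mod_mult_eq mult_1 one_mod_numeral(1) num.distinct(1) mod_mod_trivial)
      finally show ?thesis .
    qed
    show "(x$1$1 * y$1$1 + x$1$2 * y$2$1) mod 4 = 1" using eng by (intro p) auto
    have "(x$2$2 * y$2$2 + x$2$1 * y$1$2) mod 4 = 1" using eng by (intro p) auto
    then show "(x$2$1 * y$1$2 + x$2$2 * y$2$2) mod 4 = 1" by (simp add: add.commute)
  qed
  then show ?case using eng by (simp add: SL2Z_def matrix_matrix_mult_def sum_2)
qed

definition upper :: "int \<Rightarrow> int^2^2" where "upper k = vector [vector [1, 2 * k], vector [0, 1]]"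
definition lower :: "int \<Rightarrow> int^2^2" where "lower k = vector [vector [1, 0], vector [2 * k, 1]]"

lemma upper_in_F2: "upper (int k) \<in> F2"
proof (induction k)
  case 0
  have "upper 0 = mat 1" by (simp add: upper_def mat2_simps)
  then show ?case using F2_one by simp
next
  case (Suc k)
  have "upper (int (Suc k)) = v1 ** upper (int k)" by (simp add: upper_def v1_def mat2_simps)
  then show ?case using F2_mult[OF v1_in_F2 Suc] by simp
qed

lemma lower_in_F2: "lower (int k) \<in> F2"
proof (induction k)
  case 0
  have "lower 0 = mat 1" by (simp add: lower_def mat2_simps)
  then show ?case using F2_one by simp
next
  case (Suc k)
  have "lower (int (Suc k)) = v2 ** lower (int k)" by (simp add: lower_def v2_def mat2_simps)
  then show ?case using F2_mult[OF v2_in_F2 Suc] by simp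
qed

definition shift_part :: "Z2F2 \<Rightarrow> int^2" where "shift_part p = fst (Rep_Z2F2 p)"
definition lin_part :: "Z2F2 \<Rightarrow> int^2^2" where "lin_part p = snd (Rep_Z2F2 p)"
definition transl :: "int^2 \<Rightarrow> Z2F2" where "transl a = Abs_Z2F2 (a, mat 1)"
definition lin :: "int^2^2 \<Rightarrow> Z2F2" where "lin x = Abs_Z2F2 (0, x)"

lemma Rep_parts: "Rep_Z2F2 p = (shift_part p, lin_part p)"
  by (simp add: shift_part_def lin_part_def)

lemma lin_part_in_F2: "lin_part p \<in> F2"
  using Rep_Z2F2[of p] by (simp add: Rep_parts)

lemma parts_eqI: "shift_part p = shift_part q \<Longrightarrow> lin_part p = lin_part q \<Longrightarrow> p = q"
  by (simp add: Rep_Z2F2_inject[symmetric] Rep_parts)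

lemma parts_simps [simp]:
  "shift_part (transl a) = a" "lin_part (transl a) = mat 1"
  "shift_part 0 = 0" "lin_part 0 = mat 1"
  "shift_part (p + q) = shift_part p + lin_part p *v shift_part q"
  "lin_part (p + q) = lin_part p ** lin_part q"
  by (simp_all add: shift_part_def lin_part_def transl_def Abs_Z2F2_inverse F2_one
      zero_Z2F2.rep_eq plus_Z2F2.rep_eq split: prod.splits)

lemma parts_lin [simp]: "x \<in> F2 \<Longrightarrow> shift_part (lin x) = 0" "x \<in> F2 \<Longrightarrow> lin_part (lin x) = x"
  by (simp_all add: shift_part_def lin_part_def lin_def Abs_Z2F2_inverse)

lemma cocycle_parts:
  "cocycle r g p q = sigma0 r (shift_part p) (lin_part p *v shift_part q) * g (shift_part q) (lin_part p)"
  by (simp add: cocycle_def Rep_parts)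

lemma transl_shift_part: "lin_part p = mat 1 \<Longrightarrow> p = transl (shift_part p)"
  by (rule parts_eqI) simp_all

lemma transl_eq_0 [simp]: "transl a = 0 \<longleftrightarrow> a = 0"
  by (metis parts_eqI parts_simps)

lemma transl_plus: "transl a + transl b = transl (a + b)"
  by (rule parts_eqI) simp_all

lemma transl_conj: "transl b + transl a - transl b = transl a"
  by (simp add: diff_eq_eq transl_plus add.commute)

lemma lin_conj: "x \<in> F2 \<Longrightarrow> lin x + transl a - lin x = transl (x *v a)"
  unfolding diff_eq_eq by (rule parts_eqI) simp_all

lemma lin_part_conj: "lin_part p \<noteq> mat 1 \<Longrightarrow> lin_part (h + p - h) \<noteq> mat 1"
proof
  assume "lin_part p \<noteq> mat 1" "lin_part (h + p - h) = mat 1"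
  define a where "a = shift_part (h + p - h)"
  have "h + p = transl a + h"
    using transl_shift_part[OF \<open>lin_part (h + p - h) = _\<close>] by (simp add: a_def diff_eq_eq)
  then have "lin_part h ** lin_part p = lin_part h" by (metis matrix_mul_lid parts_simps(2,6))
  moreover obtain y where "y ** lin_part h = mat 1"
    using group.l_inv_ex[OF group_SL2Z subgroup.mem_carrier[OF subgroup_F2 lin_part_in_F2[of h]]]
    by (auto simp: SL2Z_def)
  ultimately have "lin_part p = mat 1" by (metis matrix_mul_assoc matrix_mul_lid)
  then show False using \<open>lin_part p \<noteq> mat 1\<close> by simp
qed

section \<open>Averages off the lattice\<close>

text \<open>
  On the projective line, \<open>|s| > R |t|\<close> is a neighbourhood of infinity, and a matrix not fixing
  infinity moves it off itself once \<open>R\<close> is large.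
\<close>

lemma moved_off_infinity:
  fixes a b c d s t R :: int
  assumes "\<bar>s\<bar> > R * \<bar>t\<bar>" "c \<noteq> 0" "R \<ge> \<bar>a\<bar> + \<bar>b\<bar> + \<bar>d\<bar>" "R \<ge> 1"
  shows "\<bar>a * s + b * t\<bar> \<le> R * \<bar>c * s + d * t\<bar>"
proof -
  have ts: "\<bar>t\<bar> \<le> \<bar>s\<bar>"
    using assms(1) mult_right_mono[OF assms(4), of "\<bar>t\<bar>"] by linarith
  have "\<bar>s\<bar> \<le> \<bar>c * s\<bar>" 
    using mult_right_mono[of 1 "\<bar>c\<bar>" "\<bar>s\<bar>"] assms(2) by (simp add: abs_mult)
  moreover have "\<bar>c * s\<bar> \<le> \<bar>c * s + d * t\<bar> + \<bar>d\<bar> * \<bar>t\<bar>"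
    unfolding abs_mult[of d t, symmetric] by linarith
  ultimately have "R * (\<bar>s\<bar> - \<bar>d\<bar> * \<bar>t\<bar>) \<le> R * \<bar>c * s + d * t\<bar>"
    using assms(4) by (intro mult_left_mono) auto
  moreover have "\<bar>d\<bar> * (R * \<bar>t\<bar>) \<le> \<bar>d\<bar> * \<bar>s\<bar>" using assms(1) by (intro mult_left_mono) auto
  moreover have "(\<bar>a\<bar> + \<bar>b\<bar> + \<bar>d\<bar>) * \<bar>s\<bar> \<le> R * \<bar>s\<bar>" using assms(3) by (rule mult_right_mono) simp
  moreover have "\<bar>a * s + b * t\<bar> \<le> \<bar>a\<bar> * \<bar>s\<bar> + \<bar>b\<bar> * \<bar>t\<bar>"
    by (metis abs_mult abs_triangle_ineq)
  moreover have "\<bar>b\<bar> * \<bar>t\<bar> \<le> \<bar>b\<bar> * \<bar>s\<bar>" using ts by (rule mult_left_mono) simp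
  ultimately show ?thesis by (simp add: algebra_simps)
qed

text \<open>
  The expression is the lower left entry of \<open>lower m ** f ** lower (- m)\<close>, which vanishes if and only
  if \<open>f\<close> fixes the line through \<open>(1, - 2 m)\<close>. As a polynomial in \<open>m\<close> it is zero only for scalar \<open>f\<close>, and
  \<open>m\<close> exceeds its roots.
\<close>

lemma lower_left_nonzero:
  assumes f: "f \<in> F2" "f \<noteq> mat 1" and m: "m > \<bar>f$2$1\<bar> + \<bar>f$1$1 - f$2$2\<bar>"
  shows "f$2$1 + 2 * m * (f$1$1 - f$2$2) - 4 * m\<^sup>2 * f$1$2 \<noteq> 0"
proof (cases "f$1$2 = 0")
  case True
  show ?thesis
  proof (cases "f$1$1 = f$2$2")
    case diag: True
    then have "f$1$1 * f$1$1 = 1" using F2_det[OF f(1)] True by simp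
    then have "f$1$1 = 1 \<or> f$1$1 = -1" by (simp add: square_eq_1_iff)
    then have "f$1$1 = 1" using F2_mod4[OF f(1)] by auto
    then have "f$2$1 \<noteq> 0" using f(2) True diag by (auto simp: mat2_simps)
    then show ?thesis using True diag by simp
  next
    case False
    then have "1 \<le> \<bar>f$1$1 - f$2$2\<bar>" by simp
    then have "2 * m * 1 \<le> 2 * m * \<bar>f$1$1 - f$2$2\<bar>" using m by (intro mult_left_mono) auto
    also have "\<dots> = \<bar>2 * m * (f$1$1 - f$2$2)\<bar>" using m by (simp add: abs_mult)
    finally show ?thesis using True m by auto
  qed
next
  case False
  have "m\<^sup>2 * 1 \<le> m\<^sup>2 * \<bar>f$1$2\<bar>" using False by (intro mult_left_mono) auto
  also have "\<dots> = \<bar>m\<^sup>2 * f$1$2\<bar>" by (simp add: abs_mult)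
  finally have 1: "m\<^sup>2 \<le> \<bar>m\<^sup>2 * f$1$2\<bar>" by simp
  have "m * \<bar>f$1$1 - f$2$2\<bar> \<le> m * m" using m by (intro mult_left_mono) auto
  then have 2: "\<bar>m * (f$1$1 - f$2$2)\<bar> \<le> m\<^sup>2" using m by (simp add: abs_mult power2_eq_square)
  have "m * 1 \<le> m * m" using m by (intro mult_left_mono) auto
  then have 3: "\<bar>f$2$1\<bar> < m\<^sup>2" using m by (simp add: power2_eq_square)
  have "2 * m * (f$1$1 - f$2$2) = 2 * (m * (f$1$1 - f$2$2))" "4 * m\<^sup>2 * f$1$2 = 4 * (m\<^sup>2 * f$1$2)" by simp_all
  then show ?thesis using 1 2 3 by linarith
qed

locale lattice_cocycle =
  fixes r \<mu>\<^sub>1 \<mu>\<^sub>2 :: complex and g :: "int^2 \<Rightarrow> int^2^2 \<Rightarrow> complex"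
  assumes cmod_r: "cmod r = 1" and is_g: "is_g \<mu>\<^sub>1 \<mu>\<^sub>2 g"
begin

sublocale twisted_group "cocycle r g"
  by standard (rule cocycle_in_two_cocycles[OF cmod_r is_g])

text \<open>
  The matrix \<open>lower m\<close> takes a cusp that no element of \<open>F\<close> fixes to infinity. The set \<open>E\<close> consists of the
  group elements that, followed by \<open>lower m\<close>, take infinity off a neighbourhood \<open>|s| > R |t|\<close> of
  infinity; so elements of \<open>F\<close> map the complement of \<open>E\<close> into \<open>E\<close>. The matrices \<open>upper k\<close> translate the
  projective line by \<open>2 k\<close>, so steps longer than \<open>R\<close> produce pairwise disjoint images of \<open>E\<close>.
\<close>

lemma vanish_off_lattice: "vanish_on {p. lin_part p \<noteq> mat 1}"
  unfolding vanish_on_def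
proof (intro allI impI)
  fix F :: "Z2F2 set" and e :: real
  assume F: "finite F" "F \<subseteq> {p. lin_part p \<noteq> mat 1}" and e: "e > 0"
  define f where "f p = lin_part p" for p
  have f: "f p \<in> F2" "p \<in> F \<Longrightarrow> f p \<noteq> mat 1" for p using F(2) by (auto simp: f_def lin_part_in_F2)
  define m where "m = 1 + (\<Sum>p\<in>F. nat (\<bar>f p$2$1\<bar> + \<bar>f p$1$1 - f p$2$2\<bar>))"
  have m: "int m > \<bar>f p$2$1\<bar> + \<bar>f p$1$1 - f p$2$2\<bar>" if "p \<in> F" for p
  proof -
    have "nat (\<bar>f p$2$1\<bar> + \<bar>f p$1$1 - f p$2$2\<bar>) < m"
      using member_le_sum[OF that, of "\<lambda>p. nat (\<bar>f p$2$1\<bar> + \<bar>f p$1$1 - f p$2$2\<bar>)"] F(1)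
      unfolding m_def by linarith
    then show ?thesis by linarith
  qed
  define f' where "f' p = lower m ** (f p ** lower (- m))" for p
  define R where "R = 1 + (\<Sum>p\<in>F. \<bar>f' p$1$1\<bar> + \<bar>f' p$1$2\<bar> + \<bar>f' p$2$2\<bar>)"
  have R: "R \<ge> \<bar>f' p$1$1\<bar> + \<bar>f' p$1$2\<bar> + \<bar>f' p$2$2\<bar>" if "p \<in> F" for p
    using member_le_sum[OF that, of "\<lambda>p. \<bar>f' p$1$1\<bar> + \<bar>f' p$1$2\<bar> + \<bar>f' p$2$2\<bar>"] F(1) by (simp add: R_def)
  have R1: "R \<ge> 1" by (simp add: R_def sum_nonneg)
  have f'21: "f' p$2$1 \<noteq> 0" if "p \<in> F" for p
  proof -
    have "f' p$2$1 = f p$2$1 + 2 * m * (f p$1$1 - f p$2$2) - 4 * (int m)\<^sup>2 * f p$1$2"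
      by (simp add: f'_def lower_def matrix_matrix_mult_def sum_2 power2_eq_square algebra_simps)
    then show ?thesis using lower_left_nonzero[OF f(1) f(2)[OF that] m[OF that]] by simp
  qed
  define z where "z q = lower m ** lin_part q" for q
  define E where "E = {q. \<bar>z q$1$1\<bar> \<le> R * \<bar>z q$2$1\<bar>}"
  define k where "k j = j * nat (R + 1)" for j
  have k: "int (k j) = int j * (R + 1)" for j using R1 by (simp add: k_def)
  define u where "u j = lin (upper (k j) ** lower m)" for j
  have ul: "lin_part (u j) = upper (k j) ** lower m" for j
    unfolding u_def by (intro parts_lin F2_mult upper_in_F2 lower_in_F2)
  have moved: "p + y \<in> E" if p: "p \<in> F" and y: "y \<notin> E" for p y
  proof -
    have "lower (- m) ** lower m = mat 1" by (simp add: lower_def mat2_simps)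
    then have "z (p + y) = f' p ** z y"
      by (simp add: z_def f'_def f_def matrix_mul_assoc[symmetric])
        (simp add: matrix_mul_assoc)
    then have "z (p + y)$1$1 = f' p$1$1 * z y$1$1 + f' p$1$2 * z y$2$1"
      "z (p + y)$2$1 = f' p$2$1 * z y$1$1 + f' p$2$2 * z y$2$1"
      by (simp_all add: matrix_matrix_mult_def sum_2)
    then show ?thesis
      using moved_off_infinity[OF _ f'21[OF p] R[OF p] R1] y by (simp add: E_def)
  qed
  have disjoint: "disjoint_family_on (\<lambda>j. (+) (u j) ` E) {..<n}" for n
    unfolding disjoint_family_on_def
  proof (intro ballI impI, rule ccontr)
    fix i j assume ij: "i \<noteq> j" and "(+) (u i) ` E \<inter> (+) (u j) ` E \<noteq> {}"
    then obtain x y where xy: "x \<in> E" "y \<in> E" "u i + x = u j + y" by blast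
    then have "lin_part (u i + x) = lin_part (u j + y)" by simp
    then have "upper (k i) ** z x = upper (k j) ** z y"
      by (simp add: ul z_def matrix_mul_assoc)
    then have "(upper (k i) ** z x)$1$1 = (upper (k j) ** z y)$1$1"
      "(upper (k i) ** z x)$2$1 = (upper (k j) ** z y)$2$1" by simp_all
    then have eq: "z x$1$1 + 2 * (int i * (R + 1)) * z x$2$1 = z y$1$1 + 2 * (int j * (R + 1)) * z y$2$1"
      and same: "z x$2$1 = z y$2$1"
      by (simp_all add: upper_def matrix_matrix_mult_def sum_2 k)
    define t where "t = z x$2$1"
    have bd: "\<bar>z x$1$1\<bar> \<le> R * \<bar>t\<bar>" "\<bar>z y$1$1\<bar> \<le> R * \<bar>t\<bar>"
      using xy same by (simp_all add: E_def t_def)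
    have diff: "2 * ((int i - int j) * (R + 1)) * t = z y$1$1 - z x$1$1"
      using eq same by (simp add: t_def algebra_simps)
    have "(R + 1) * \<bar>t\<bar> \<le> \<bar>int i - int j\<bar> * ((R + 1) * \<bar>t\<bar>)"
      using mult_right_mono[of 1 "\<bar>int i - int j\<bar>" "(R + 1) * \<bar>t\<bar>"] ij R1 by simp
    moreover have "2 * (\<bar>int i - int j\<bar> * ((R + 1) * \<bar>t\<bar>)) = \<bar>2 * ((int i - int j) * (R + 1)) * t\<bar>"
      using R1 by (simp add: abs_mult mult.assoc)
    ultimately have "2 * ((R + 1) * \<bar>t\<bar>) \<le> 2 * (R * \<bar>t\<bar>)" unfolding diff using bd by linarith
    then have "t = 0" by (simp add: algebra_simps)
    then have "z x$1$1 = 0" "z x$2$1 = 0" using bd by (simp_all add: t_def)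
    moreover have "z x \<in> F2" unfolding z_def by (intro F2_mult lower_in_F2 lin_part_in_F2)
    ultimately show False using F2_det by force
  qed
  obtain n :: nat where n: "n > 0" "2 / sqrt n \<le> e"
  proof
    define n where "n = nat \<lceil>(2 / e)\<^sup>2\<rceil> + 1"
    show "n > 0" by (simp add: n_def)
    have "(2 / e)\<^sup>2 \<le> n" unfolding n_def by linarith
    then have "2 / e \<le> sqrt n" using real_le_rsqrt by blast
    then show "2 / sqrt n \<le> e" using e \<open>n > 0\<close> by (simp add: field_simps)
  qed
  have "\<forall>p\<in>F. norm (average n u (L p)) \<le> e"
    using powers_average[OF disjoint moved n(1)] n(2) by (meson order_trans)
  then show "\<exists>n u. n > 0 \<and> (\<forall>p\<in>F. norm (average n u (L p)) \<le> e)" using n(1) by blast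
qed

end

section \<open>Averages on the lattice\<close>

lemma cnj_unit: "cmod u = 1 \<Longrightarrow> cnj u = inverse u"
  by (rule inverse_unique[symmetric]) (simp add: complex_norm_square[symmetric])

lemma nontorsion_power_int:
  assumes "nontorsion \<mu>" "n \<noteq> 0" shows "\<mu> powi n \<noteq> 1"
proof (cases "n > 0")
  case True
  then have "nat n > 0" "\<mu> powi n = \<mu> ^ nat n" by (simp_all add: power_int_def)
  then show ?thesis using assms(1) by (metis nontorsion_def)
next
  case False
  then have "nat (- n) > 0" "\<mu> powi n = inverse (\<mu> ^ nat (- n))"
    using assms(2) by (simp_all add: power_int_def power_inverse)
  then show ?thesis using assms(1) by (metis nontorsion_def inverse_eq_1_iff)
qed

lemma nontorsion_power_int_power:
  assumes "nontorsion \<mu>" "n \<noteq> 0" "d > (0::nat)" shows "(\<mu> powi n) ^ d \<noteq> 1"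
proof -
  have "(\<mu> powi n) ^ d = \<mu> powi (n * int d)" by (simp add: power_int_mult)
  then show ?thesis using nontorsion_power_int[OF assms(1), of "n * int d"] assms(2,3) by simp
qed

context lattice_cocycle begin

lemma g_norm: "x \<in> F2 \<Longrightarrow> cmod (g a x) = 1"
  and g_add: "x \<in> F2 \<Longrightarrow> g (a + b) x = g a x * g b x"
  and g_mult: "x \<in> F2 \<Longrightarrow> y \<in> F2 \<Longrightarrow> g a (x ** y) = g (y *v a) x * g a y"
  and g_zero [simp]: "x \<in> F2 \<Longrightarrow> g 0 x = 1" and g_one [simp]: "g a (mat 1) = 1"
  and g_generators: "g e1 v2 = 1" "g e2 v1 = 1" "g e1 v1 = \<mu>\<^sub>1" "g e2 v2 = \<mu>\<^sub>2"
  using is_g by (auto simp: is_g_def)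

lemma g_minus: assumes "x \<in> F2" shows "g (- a) x = inverse (g a x)"
proof (rule inverse_unique[symmetric])
  show "g a x * g (- a) x = 1" using g_add[OF assms, of a "- a"] assms by simp
qed

lemma g_scale: assumes x: "x \<in> F2" shows "g (k *s a) x = g a x powi k"
proof -
  have nat: "g (int n *s a) x = g a x ^ n" for n
  proof (induction n)
    case (Suc n)
    have "int (Suc n) *s a = a + int n *s a" by (simp add: vec_eq_iff algebra_simps)
    then show ?case by (simp add: g_add[OF x] Suc)
  qed (simp add: x)
  show ?thesis
  proof (cases "k \<ge> 0")
    case True
    then show ?thesis using nat[of "nat k"] by (simp add: power_int_def)
  next
    case False
    then obtain j where k: "k = - int j" by (metis nle_le nonpos_int_cases)
    have "k *s a = - (int j *s a)" by (simp add: k vec_eq_iff)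
    then have "g (k *s a) x = inverse (g a x ^ j)" by (simp only: g_minus[OF x] nat)
    then show ?thesis by (simp add: k power_int_minus)
  qed
qed

lemma cocycle_trans: "cocycle r g (transl a) (transl b) = sigma0 r a b"
  by (simp add: cocycle_parts)

lemma conj_by_trans:
  "conj_by (transl b) (L (transl a)) = r powi (2 * (b$1 * a$2 - b$2 * a$1)) \<cdot> L (transl a)"
proof -
  define d where "d = b$1 * a$2 - b$2 * a$1"
  have "sigma0 r b a = r powi d" "sigma0 r a b = r powi (- d)"
    by (simp_all add: sigma0_def d_def algebra_simps)
  moreover have "r powi d * cnj (r powi (- d)) = r powi (2 * d)"
  proof -
    have "cmod (r powi (- d)) = 1" unfolding norm_power_int cmod_r by simp
    from cnj_unit[OF this] have "cnj (r powi (- d)) = r powi d"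
      by (simp only: power_int_minus inverse_inverse_eq)
    moreover have "r \<noteq> 0" using cmod_r by auto
    ultimately show ?thesis by (simp add: power_int_add[symmetric])
  qed
  ultimately show ?thesis
    unfolding conj_by_L transl_conj cocycle_trans d_def by simp
qed

lemma conj_by_lin:
  assumes "x \<in> F2" shows "conj_by (lin x) (L (transl a)) = g a x \<cdot> L (transl (x *v a))"
  unfolding conj_by_L lin_conj[OF assms] using assms by (simp add: cocycle_parts sigma0_def)

text \<open>
  If \<open>\<mu>\<^sub>0\<close> is nontorsion, then conjugation by a single lattice vector, in general position with
  respect to \<open>F\<close>, multiplies each generator by a phase other than \<open>1\<close>.
\<close>

lemma vanish_on_lattice_mu0:
  assumes nt: "nontorsion (r\<^sup>2)"
  shows "vanish_on ({p. lin_part p = mat 1} - {0})"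
  unfolding vanish_on_def
proof (intro allI impI)
  fix F :: "Z2F2 set" and e :: real
  assume F: "finite F" "F \<subseteq> {p. lin_part p = mat 1} - {0}" and e: "e > 0"
  \<comment> \<open>Large enough that \<open>b\<close> is parallel to no element of \<open>F\<close>.\<close>
  define m where "m = 1 + (\<Sum>p\<in>F. \<bar>shift_part p$2\<bar>)"
  define b :: "int^2" where "b = vector [1, m]"
  have "\<forall>\<^sub>F N in sequentially. norm (average N (\<lambda>k. multiple k (transl b)) (L p)) \<le> e" if p: "p \<in> F" for p
  proof -
    define a where "a = shift_part p"
    have pa: "p = transl a" using F(2) p transl_shift_part by (auto simp: a_def)
    have "a \<noteq> 0" using F(2) p pa by auto
    then have a: "a$1 \<noteq> 0 \<or> a$2 \<noteq> 0" by (auto simp: vec_eq_iff forall_2)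
    have m: "m > \<bar>a$2\<bar>"
      using member_le_sum[OF p, of "\<lambda>p. \<bar>shift_part p$2\<bar>"] F(1) by (simp add: m_def a_def)
    have ne: "a$2 - m * a$1 \<noteq> 0"
    proof (cases "a$1 = 0")
      case False
      then have "m * 1 \<le> m * \<bar>a$1\<bar>" using m by (intro mult_left_mono) auto
      also have "\<dots> = \<bar>m * a$1\<bar>" using m by (simp add: abs_mult)
      finally show ?thesis using m by linarith
    qed (use a in simp)
    define \<rho> where "\<rho> = r powi (2 * (a$2 - m * a$1))"
    have "\<rho> = (r\<^sup>2) powi (a$2 - m * a$1)" unfolding \<rho>_def power_int_mult by simp
    then have \<rho>: "\<rho> \<noteq> 1" using nontorsion_power_int[OF nt ne] by simp
    have "cmod \<rho> = 1" using cmod_r by (simp add: \<rho>_def norm_power_int)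
    moreover have "conj_by (transl b) (L (transl a)) = \<rho> \<cdot> L (transl a)"
      by (simp add: conj_by_trans \<rho>_def b_def)
    ultimately show ?thesis
      unfolding pa using \<rho> e by (intro average_eigenvector_small[OF L_bounded_ops norm_L])
  qed
  then have "\<forall>\<^sub>F N in sequentially. \<forall>p\<in>F. norm (average N (\<lambda>k. multiple k (transl b)) (L p)) \<le> e"
    using F(1) by (simp add: eventually_ball_finite)
  then have "\<forall>\<^sub>F N in sequentially. N > 0 \<and> (\<forall>p\<in>F. norm (average N (\<lambda>k. multiple k (transl b)) (L p)) \<le> e)"
    using eventually_gt_at_top[of 0] by eventually_elim auto
  from eventually_happens'[OF sequentially_bot this]
  obtain N where "N > 0 \<and> (\<forall>p\<in>F. norm (average N (\<lambda>k. multiple k (transl b)) (L p)) \<le> e)"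
    by (rule exE)
  then show "\<exists>n u. n > 0 \<and> (\<forall>p\<in>F. norm (average n u (L p)) \<le> e)" by (intro exI)
qed

text \<open>
  A unipotent \<open>w\<close> fixing \<open>p\<close> acts on the lattice generators as a skew product over the rotation by
  \<open>g p w\<close> acts on characters: powers of \<open>w\<close> multiply the generators along \<open>p\<close> by powers of a nontrivial
  phase and shift all others along \<open>p\<close>, with phases quadratic in the exponent.
\<close>

lemma vanish_on_lattice_unipotent:
  fixes m :: "int^2 \<Rightarrow> int"
  assumes w: "w \<in> F2" and fixed: "w *v p = p" and nt: "nontorsion (g p w)"
    and shear: "\<And>a. w *v a = a + m a *s p" and line: "\<And>a. m a = 0 \<Longrightarrow> \<exists>k. a = k *s p"
  shows "vanish_on ({p. lin_part p = mat 1} - {0})"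
  unfolding vanish_on_def
proof (intro allI impI)
  fix F :: "Z2F2 set" and e :: real
  assume F: "finite F" "F \<subseteq> {p. lin_part p = mat 1} - {0}" and e: "e > 0"
  obtain H :: nat where H: "H > 0" "sqrt (2 / real H) \<le> e"
  proof
    define H where "H = nat \<lceil>2 / e\<^sup>2\<rceil> + 1"
    show "H > 0" by (simp add: H_def)
    have "2 / e\<^sup>2 \<le> H" unfolding H_def by linarith
    then have "2 / real H \<le> e\<^sup>2" using e \<open>H > 0\<close> by (simp add: field_simps)
    then show "sqrt (2 / real H) \<le> e" using e by (intro real_le_lsqrt) auto
  qed
  let ?u = "\<lambda>k. multiple k (lin w)"
  have gw: "cmod (g a w) = 1" for a using g_norm[OF w] .
  have "\<forall>\<^sub>F N in sequentially. norm (average (N * H) ?u (L q)) \<le> e" if q: "q \<in> F" for q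
  proof -
    define a where "a = shift_part q"
    have qa: "q = transl a" using F(2) q transl_shift_part by (auto simp: a_def)
    have a0: "a \<noteq> 0" using F(2) q qa by auto
    show ?thesis
    proof (cases "m a = 0")
      case True
      then obtain k where k: "a = k *s p" using line by blast
      then have "k \<noteq> 0" using a0 by auto
      then have "g a w \<noteq> 1" using nontorsion_power_int[OF nt] by (simp add: k g_scale[OF w])
      moreover have "conj_by (lin w) (L q) = g a w \<cdot> L q"
        using True by (simp add: qa conj_by_lin[OF w] shear)
      ultimately have "\<forall>\<^sub>F N in sequentially. norm (average N ?u (L q)) \<le> e"
        using gw e by (intro average_eigenvector_small[OF L_bounded_ops norm_L])
      then obtain N0 where N0: "\<And>N. N \<ge> N0 \<Longrightarrow> norm (average N ?u (L q)) \<le> e"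
        by (auto simp: eventually_sequentially)
      have "N * H \<ge> N0" if "N \<ge> N0" for N using H(1) that by (cases H) auto
      then show ?thesis
        unfolding eventually_sequentially using N0 by blast
    next
      case False
      define W where "W = L (transl (m a *s p))"
      define \<rho> where "\<rho> = g a w * cnj (sigma0 r (m a *s p) a)"
      have s: "cmod (sigma0 r x y) = 1" for x y using cmod_r by (simp add: sigma0_def norm_power_int)
      have s0: "sigma0 r x y \<noteq> 0" for x y using s[of x y] by auto
      have WV: "W o\<^sub>L L q = sigma0 r (m a *s p) a \<cdot> L (transl (w *v a))"
        by (simp add: W_def qa L_compose transl_plus shear cocycle_trans add.commute)
      have conjV: "conj_by (lin w) (L q) = \<rho> \<cdot> (W o\<^sub>L L q)"
        unfolding WV using s[of "m a *s p" a] s0[of "m a *s p" a]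
        by (simp add: qa conj_by_lin[OF w] \<rho>_def mult.assoc cnj_unit)
      have "w *v (m a *s p) = m a *s p"
        using fixed by (simp add: matrix_vector_mult_def vec_eq_iff sum_distrib_left[symmetric] mult.left_commute)
      then have conjW: "conj_by (lin w) W = (g p w powi m a) \<cdot> W"
        by (simp add: W_def conj_by_lin[OF w] g_scale[OF w])
      have "\<forall>\<^sub>F N in sequentially. norm (average (N * H) ?u (L q)) \<le> sqrt (2 / real H)"
      proof (rule average_quadratic_phase_small[OF L_bounded_ops _ _ _ conjV conjW])
        show "W \<in> bounded_ops" "norm (W \<xi>) = norm \<xi>" for \<xi> by (simp_all add: W_def L_bounded_ops)
        show "cmod \<rho> = 1" by (simp add: \<rho>_def norm_mult gw s)
        show "cmod (g p w powi m a) = 1" by (simp add: norm_power_int gw)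
        show "(g p w powi m a) ^ d \<noteq> 1" if "d > 0" for d
          using nontorsion_power_int_power[OF nt False that] .
      qed (use H in auto)
      then show ?thesis by eventually_elim (use H(2) in linarith)
    qed
  qed
  then have "\<forall>\<^sub>F N in sequentially. \<forall>q\<in>F. norm (average (N * H) ?u (L q)) \<le> e"
    using F(1) by (simp add: eventually_ball_finite)
  then have "\<forall>\<^sub>F N in sequentially. N * H > 0 \<and> (\<forall>q\<in>F. norm (average (N * H) ?u (L q)) \<le> e)"
    using eventually_gt_at_top[of 0] by eventually_elim (use H(1) in auto)
  from eventually_happens'[OF sequentially_bot this]
  obtain N where "N * H > 0 \<and> (\<forall>q\<in>F. norm (average (N * H) ?u (L q)) \<le> e)" by (rule exE)
  then show "\<exists>n u. n > 0 \<and> (\<forall>q\<in>F. norm (average n u (L q)) \<le> e)" by (intro exI)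
qed

lemma vanish_on_lattice:
  assumes "nontorsion (r\<^sup>2) \<or> nontorsion \<mu>\<^sub>1 \<or> nontorsion \<mu>\<^sub>2"
  shows "vanish_on ({p. lin_part p = mat 1} - {0})"
proof -
  have 1: ?thesis if "nontorsion \<mu>\<^sub>1"
  proof (rule vanish_on_lattice_unipotent[OF v1_in_F2, of e1 "\<lambda>a. 2 * a$2"])
    show "\<exists>k. a = k *s e1" if "2 * a$2 = 0" for a
      using that by (intro exI[of _ "a$1"]) (simp add: vec_eq_iff forall_2 e1_def)
    show "nontorsion (g e1 v1)" using that by (simp add: g_generators)
  qed (simp_all add: v1_def e1_def mat2_simps)
  have 2: ?thesis if "nontorsion \<mu>\<^sub>2"
  proof (rule vanish_on_lattice_unipotent[OF v2_in_F2, of e2 "\<lambda>a. 2 * a$1"])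
    show "\<exists>k. a = k *s e2" if "2 * a$1 = 0" for a
      using that by (intro exI[of _ "a$2"]) (simp add: vec_eq_iff forall_2 e2_def)
    show "nontorsion (g e2 v2)" using that by (simp add: g_generators)
  qed (simp_all add: v2_def e2_def mat2_simps)
  show ?thesis using assms vanish_on_lattice_mu0 1 2 by blast
qed

lemma nontorsion_averages_vanish:
  assumes "nontorsion (r\<^sup>2) \<or> nontorsion \<mu>\<^sub>1 \<or> nontorsion \<mu>\<^sub>2"
  shows averages_vanish
proof (rule averages_vanish_normal[OF vanish_on_lattice[OF assms]])
  show "vanish_on (- {p. lin_part p = mat 1})"
    using vanish_off_lattice by (simp add: Collect_neg_eq)
qed (simp add: lin_part_conj)

end

section \<open>A proper quotient in the torsion case\<close>

context twisted_group begin

text \<open>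
  The operators whose norm along the vectors tends to zero are the null space of the limit trace;
  since the trace is symmetric, this left ideal is closed under adjoints, hence two-sided.
\<close>

lemma null_ideal:
  assumes unit: "\<And>n. norm (\<xi> n) = 1"
    and lim: "\<And>g. (\<lambda>n. cinner (L g (\<xi> n)) (\<xi> n)) \<longlonglongrightarrow> \<phi> g"
    and sym: "\<And>g h. \<sigma> g h * \<phi> (g + h) = \<sigma> h g * \<phi> (h + g)"
  shows "closed_ideal {T \<in> A. (\<lambda>n. norm (T (\<xi> n))) \<longlonglongrightarrow> 0} A" (is "closed_ideal ?J A")
proof -
  let ?\<tau> = "limit_state \<xi>"
  have tr: "?\<tau> (S o\<^sub>L T) = ?\<tau> (T o\<^sub>L S)" if "S \<in> A" "T \<in> A" for S T
    using tracial_limit_state(1)[OF unit lim sym] that by (simp add: tracial_state_def)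
  have sq: "(\<lambda>n. complex_of_real ((norm (T (\<xi> n)))\<^sup>2)) \<longlonglongrightarrow> ?\<tau> (adj T o\<^sub>L T)" if T: "T \<in> A" for T
  proof -
    have "adjoint_pair (adj T) T" by (rule adjoint_pair_sym[OF adjoint_pair_adj[OF T]])
    then have "cinner ((adj T o\<^sub>L T) (\<xi> n)) (\<xi> n) = complex_of_real ((norm (T (\<xi> n)))\<^sup>2)" for n
      by (simp add: adjoint_pair_def cinner_self)
    then show ?thesis using limit_state_tendsto[OF unit lim A_compose[OF A_adj[OF T] T]] by simp
  qed
  have iff: "(\<lambda>n. norm (T (\<xi> n))) \<longlonglongrightarrow> 0 \<longleftrightarrow> ?\<tau> (adj T o\<^sub>L T) = 0" if T: "T \<in> A" for T
  proof
    assume "(\<lambda>n. norm (T (\<xi> n))) \<longlonglongrightarrow> 0"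
    then have "(\<lambda>n. complex_of_real ((norm (T (\<xi> n)))\<^sup>2)) \<longlonglongrightarrow> complex_of_real (0\<^sup>2)"
      by (intro tendsto_intros)
    then show "?\<tau> (adj T o\<^sub>L T) = 0" using LIMSEQ_unique[OF sq[OF T]] by simp
  next
    assume "?\<tau> (adj T o\<^sub>L T) = 0"
    then have "(\<lambda>n. complex_of_real ((norm (T (\<xi> n)))\<^sup>2)) \<longlonglongrightarrow> 0" using sq[OF T] by (simp only:)
    then have "(\<lambda>n. norm (complex_of_real ((norm (T (\<xi> n)))\<^sup>2))) \<longlonglongrightarrow> 0" by (rule tendsto_norm_zero)
    then have "(\<lambda>n. sqrt ((norm (T (\<xi> n)))\<^sup>2)) \<longlonglongrightarrow> sqrt 0"
      by (intro tendsto_real_sqrt) (simp add: norm_power)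
    then show "(\<lambda>n. norm (T (\<xi> n))) \<longlonglongrightarrow> 0" by simp
  qed
  have adj_adj: "adj (adj T) = T" if "T \<in> A" for T
    by (rule adj_eq[OF adjoint_pair_sym[OF adjoint_pair_adj[OF that]]])
  have adjJ: "adj T \<in> ?J" if T: "T \<in> ?J" for T
  proof -
    have TA: "T \<in> A" using T by simp
    have "?\<tau> (adj T o\<^sub>L T) = 0" using T iff[OF TA] by simp
    then have "?\<tau> (adj (adj T) o\<^sub>L adj T) = 0" using tr[OF TA A_adj[OF TA]] adj_adj[OF TA] by simp
    then show ?thesis using iff[OF A_adj[OF TA]] A_adj[OF TA] by simp
  qed
  have left: "S o\<^sub>L T \<in> ?J" if S: "S \<in> A" and T: "T \<in> ?J" for S T
  proof -
    have "(\<lambda>n. norm S * norm (T (\<xi> n))) \<longlonglongrightarrow> 0"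
      by (rule tendsto_mult_right_zero) (use T in simp)
    then have "(\<lambda>n. norm ((S o\<^sub>L T) (\<xi> n))) \<longlonglongrightarrow> 0"
      by (rule Lim_null_comparison[rotated]) (simp add: norm_blinfun)
    then show ?thesis using S T by (simp add: A_compose)
  qed
  have right: "T o\<^sub>L S \<in> ?J" if S: "S \<in> A" and T: "T \<in> ?J" for S T
  proof -
    have TA: "T \<in> A" using T by simp
    have "adj (adj S o\<^sub>L adj T) \<in> ?J" by (intro adjJ left A_adj S T)
    moreover have "adj (adj S o\<^sub>L adj T) = T o\<^sub>L S"
      by (intro adj_eq adjoint_pair_compose)
        (rule adjoint_pair_sym[OF adjoint_pair_adj[OF S]] adjoint_pair_sym[OF adjoint_pair_adj[OF TA]])+
    ultimately show ?thesis by simp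
  qed
  have add: "S + T \<in> ?J" if "S \<in> ?J" "T \<in> ?J" for S T
  proof -
    have "(\<lambda>n. norm (S (\<xi> n)) + norm (T (\<xi> n))) \<longlonglongrightarrow> 0"
      by (rule tendsto_add_zero) (use that in auto)
    then have "(\<lambda>n. norm (blinfun_apply (S + T) (\<xi> n))) \<longlonglongrightarrow> 0"
      by (rule Lim_null_comparison[rotated]) (simp add: norm_triangle_ineq)
    then show ?thesis using that by (simp add: A_add)
  qed
  have scale: "c \<cdot> T \<in> ?J" if T: "T \<in> ?J" for c T
    using left[OF A_cscale[OF id_in_A] T, of c] by (simp add: compose_cscale_left)
  have closed: "closed ?J"
    unfolding closed_sequential_limits
  proof (intro allI impI, elim conjE)
    fix f T assume f: "\<forall>n. f n \<in> ?J" "f \<longlonglongrightarrow> T"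
    have T: "T \<in> A" using f A_closed by (auto simp: closed_sequential_limits)
    have "(\<lambda>n. norm (T (\<xi> n))) \<longlonglongrightarrow> 0"
    proof (rule LIMSEQ_I)
      fix e :: real assume e: "e > 0"
      obtain k where k: "norm (f k - T) < e / 2"
        using LIMSEQ_D[OF f(2), of "e/2"] e by auto
      obtain M where M: "\<And>n. n \<ge> M \<Longrightarrow> norm (f k (\<xi> n)) < e / 2"
        using f(1) LIMSEQ_D[of "\<lambda>n. norm (f k (\<xi> n))" 0 "e/2"] e by auto
      have "norm (norm (T (\<xi> n)) - 0) < e" if "n \<ge> M" for n
      proof -
        have "norm ((f k - T) (\<xi> n)) \<le> norm (f k - T)"
          using norm_blinfun[of "f k - T" "\<xi> n"] by (simp only: unit mult_1_right)
        moreover have "norm (T (\<xi> n)) \<le> norm (f k (\<xi> n)) + norm ((f k - T) (\<xi> n))"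
          using norm_triangle_ineq4[of "f k (\<xi> n)" "(f k - T) (\<xi> n)"] by simp
        ultimately show ?thesis using k M[OF that] by simp
      qed
      then show "\<exists>no. \<forall>n\<ge>no. norm (norm (T (\<xi> n)) - 0) < e" by blast
    qed
    then show "T \<in> ?J" using T by simp
  qed
  show ?thesis
    unfolding closed_ideal_def complex_subspace_def
    using add scale left right closed A_zero by (auto simp: )
qed

text \<open>
  If the limit trace takes the value \<open>1\<close> at \<open>L g\<close>, then it differs from the canonical trace and
  \<open>L g\<close> is the identity modulo its null space.
\<close>

lemma limit_state_obstruction:
  assumes unit: "\<And>n. norm (\<xi> n) = 1"
    and lim: "\<And>g. (\<lambda>n. cinner (L g (\<xi> n)) (\<xi> n)) \<longlonglongrightarrow> \<phi> g"
    and sym: "\<And>g h. \<sigma> g h * \<phi> (g + h) = \<sigma> h g * \<phi> (h + g)"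
    and g: "g \<noteq> 0" "\<phi> g = 1"
  shows "\<not> cstar_simple \<sigma>" "\<not> unique_trace_property \<sigma>"
proof -
  have "limit_state \<xi> (L g) \<noteq> canonical_trace (L g)"
    using tracial_limit_state(2)[OF unit lim sym] g by (simp add: canonical_trace_L)
  then have "limit_state \<xi> \<noteq> canonical_trace" by auto
  then show "\<not> unique_trace_property \<sigma>"
    using tracial_limit_state(1)[OF unit lim sym] tracial_canonical_trace
    unfolding unique_trace_property_def by blast
  define J where "J = {T \<in> A. (\<lambda>n. norm (T (\<xi> n))) \<longlonglongrightarrow> 0}"
  have "id_blinfun \<notin> J" by (simp add: J_def unit LIMSEQ_const_iff)
  then have 1: "J \<noteq> A" using id_in_A by blast
  have 2: "L g - id_blinfun \<in> J"
  proof -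
    have "(norm ((L g - id_blinfun) (\<xi> n)))\<^sup>2 = 2 - 2 * Re (cinner (L g (\<xi> n)) (\<xi> n))" for n
    proof -
      have "(norm (L g (\<xi> n) - \<xi> n))\<^sup>2
          = (norm (L g (\<xi> n)))\<^sup>2 + (norm (\<xi> n))\<^sup>2 - 2 * inner (L g (\<xi> n)) (\<xi> n)"
        unfolding power2_norm_eq_inner by (simp add: inner_diff_left inner_diff_right inner_commute)
      then show ?thesis by (simp add: unit inner_ell2_def)
    qed
    moreover have "(\<lambda>n. 2 - 2 * Re (cinner (L g (\<xi> n)) (\<xi> n))) \<longlonglongrightarrow> 2 - 2 * Re 1"
      using lim[of g] g(2) by (intro tendsto_intros) simp
    ultimately have "(\<lambda>n. (norm ((L g - id_blinfun) (\<xi> n)))\<^sup>2) \<longlonglongrightarrow> 0" by simp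
    then have "(\<lambda>n. sqrt ((norm ((L g - id_blinfun) (\<xi> n)))\<^sup>2)) \<longlonglongrightarrow> sqrt 0" by (rule tendsto_real_sqrt)
    then show ?thesis by (simp add: J_def A_diff L_in_A id_in_A)
  qed
  have 3: "L g - id_blinfun \<noteq> 0"
  proof
    assume "L g - id_blinfun = 0"
    then have "canonical_trace (L g) = canonical_trace (L 0)" by simp
    then show False using g(1) by (simp only: canonical_trace_L) simp
  qed
  have "closed_ideal J A" unfolding J_def by (rule null_ideal[OF unit lim sym])
  then show "\<not> cstar_simple \<sigma>"
    using 1 2 3 unfolding cstar_simple_def simple_algebra_def by blast
qed

end

text \<open>Infinite sets are sent to zero, so that the function is square-summable for every set.\<close>

lift_definition unit_indicator :: "'g set \<Rightarrow> 'g ell2" is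
  "\<lambda>B h. if finite B \<and> h \<in> B then 1 / complex_of_real (sqrt (card B)) else 0"
proof -
  fix B :: "'g set"
  show "(\<lambda>h. (cmod (if finite B \<and> h \<in> B then 1 / complex_of_real (sqrt (card B)) else 0))\<^sup>2) summable_on UNIV"
    by (rule finite_nonzero_values_imp_summable_on, rule finite_subset[of _ "if finite B then B else {}"]) auto
qed

lemma cinner_unit_indicator:
  assumes "finite B"
  shows "cinner \<xi> (unit_indicator B) = (\<Sum>h\<in>B. ell2_at \<xi> h) / sqrt (card B)"
proof -
  have "cinner \<xi> (unit_indicator B) = (\<Sum>\<^sub>\<infinity>h\<in>B. ell2_at \<xi> h * cnj (ell2_at (unit_indicator B) h))"
    unfolding cinner_def by (rule infsum_cong_neutral) (auto simp: unit_indicator.rep_eq)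
  then show ?thesis using assms by (simp add: unit_indicator.rep_eq sum_divide_distrib)
qed

lemma norm_unit_indicator:
  assumes "finite B" "B \<noteq> {}" shows "norm (unit_indicator B) = 1"
proof -
  have "card B > 0" using assms by (simp add: card_gt_0_iff)
  then have "complex_of_real ((norm (unit_indicator B))\<^sup>2) = 1"
    unfolding cinner_self[symmetric] cinner_unit_indicator[OF assms(1)]
    using assms by (simp add: unit_indicator.rep_eq of_real_mult[symmetric] del: of_real_mult)
  then have "(norm (unit_indicator B))\<^sup>2 = 1" by (simp only: of_real_eq_1_iff)
  then show ?thesis by (metis norm_ge_zero power2_eq_1_iff le_minus_one_simps(3) not_one_le_zero)
qed

lemma card_interval_shift:
  fixes c :: int
  shows "card {i \<in> {0..<int n}. i - c \<in> {0..<int n}} = nat (int n - \<bar>c\<bar>)"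
proof -
  have "{i \<in> {0..<int n}. i - c \<in> {0..<int n}} = {max 0 c..<min (int n) (int n + c)}" by auto
  moreover have "min (int n) (int n + c) - max 0 c = int n - \<bar>c\<bar>" by auto
  ultimately show ?thesis by simp
qed

lemma shift_ratio_tendsto: "(\<lambda>n. real (nat (int n - \<bar>c\<bar>)) / real n) \<longlonglongrightarrow> 1"
proof (rule Lim_transform_eventually)
  have "(\<lambda>n. 1 - real_of_int \<bar>c\<bar> / real n) \<longlonglongrightarrow> 1 - 0"
    by (intro tendsto_diff tendsto_const lim_const_over_n)
  then show "(\<lambda>n. 1 - real_of_int \<bar>c\<bar> / real n) \<longlonglongrightarrow> 1" by simp
  show "\<forall>\<^sub>F n in sequentially. 1 - real_of_int \<bar>c\<bar> / real n = real (nat (int n - \<bar>c\<bar>)) / real n"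
    using eventually_ge_at_top[of "nat \<bar>c\<bar> + 1"]
  proof eventually_elim
    case (elim n)
    then have "real (nat (int n - \<bar>c\<bar>)) = real n - real_of_int \<bar>c\<bar>" by (simp add: of_nat_nat)
    then show ?case using elim by (simp add: diff_divide_distrib)
  qed
qed

context lattice_cocycle begin

definition sublattice :: "nat \<Rightarrow> Z2F2 set" where
  "sublattice l = {transl (int l *s a) | a. True}"

definition lattice_square :: "nat \<Rightarrow> nat \<Rightarrow> Z2F2 set" where
  "lattice_square l n = (\<lambda>(i, j). transl (int l *s vector [i, j])) ` ({0..<int n} \<times> {0..<int n})"

text \<open>
  Under the following assumptions all phases of the cocycle on \<open>l \<int>\<^sup>2\<close> are trivial, so the cocycle
  depends only on classes modulo this normal subgroup.
\<close>

context
  fixes l :: nat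
  assumes l: "l > 0" "r ^ l = 1" "\<mu>\<^sub>1 ^ l = 1" "\<mu>\<^sub>2 ^ l = 1"
begin

lemma r_multiple: "r powi (int l * k) = 1"
  using l(2) by (simp add: power_int_mult)

lemma sigma0_multiple: "sigma0 r (int l *s a) b = 1" "sigma0 r a (int l *s b) = 1"
  using r_multiple[of "a$1 * b$2 - a$2 * b$1"] by (simp_all add: sigma0_def algebra_simps)

lemma g_power_l_generator:
  assumes "x \<in> {v1, v2}" shows "g a x ^ l = 1"
proof -
  have x: "x \<in> F2" using assms v1_in_F2 v2_in_F2 by auto
  have "a = a$1 *s e1 + a$2 *s e2" by (simp add: vec_eq_iff forall_2 e1_def e2_def)
  then have "g a x = g e1 x powi (a$1) * g e2 x powi (a$2)" by (metis g_add[OF x] g_scale[OF x])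
  moreover have "g e1 x ^ l = 1" "g e2 x ^ l = 1" using assms l by (auto simp: g_generators)
  moreover have "(z powi k) ^ l = (z ^ l) powi k" for z :: complex and k
    by (simp add: power_int_mult[symmetric] mult.commute flip: power_int_of_nat)
  ultimately show ?thesis by (simp add: power_mult_distrib)
qed

lemma g_power_l: "x \<in> F2 \<Longrightarrow> g a x ^ l = 1"
  unfolding F2_def
proof (induction arbitrary: a rule: generate.induct)
  case one
  show ?case by (simp add: SL2Z_def)
next
  case (incl x)
  then show ?case by (rule g_power_l_generator)
next
  case (inv x)
  have x: "x \<in> F2" using inv v1_in_F2 v2_in_F2 by auto
  let ?y = "inv\<^bsub>SL2Z\<^esub> x"
  have y: "?y \<in> F2" using subgroup.m_inv_closed[OF subgroup_F2 x] .
  have xC: "x \<in> carrier SL2Z" using subgroup.mem_carrier[OF subgroup_F2 x] .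
  have yx: "?y ** x = mat 1" "x ** ?y = mat 1"
    using group.l_inv[OF group_SL2Z xC] group.r_inv[OF group_SL2Z xC] by (simp_all add: SL2Z_def)
  have "x *v (?y *v a) = a" by (simp add: matrix_vector_mul_assoc yx)
  then have "g a ?y * g (?y *v a) x = 1" using g_mult[OF y x, of "?y *v a"] by (simp add: yx)
  then have "g a ?y ^ l * g (?y *v a) x ^ l = 1" by (metis power_mult_distrib power_one)
  then show ?case by (simp add: g_power_l_generator[OF inv])
next
  case (eng x y)
  then have "x \<in> F2" "y \<in> F2" by (simp_all add: F2_def)
  then have "g a (x ** y) = g (y *v a) x * g a y" by (rule g_mult)
  then show ?case using eng by (simp add: power_mult_distrib SL2Z_def)
qed

lemma g_multiple: "x \<in> F2 \<Longrightarrow> g (int l *s a) x = 1"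
  by (simp add: g_scale g_power_l)

lemma sublattice_iff: "p \<in> sublattice l \<longleftrightarrow> lin_part p = mat 1 \<and> (\<exists>a. shift_part p = int l *s a)"
  using transl_shift_part[of p] by (auto simp: sublattice_def)

lemma matrix_scale: "x *v (k *s a) = k *s (x *v a)" for x :: "int^2^2" and a :: "int^2"
  by (simp add: matrix_vector_mult_def vec_eq_iff sum_2 algebra_simps)

text \<open>
  Modulo the sublattice \<open>p\<close> and \<open>q\<close> are inverse to each other, and a normalized cocycle is symmetric on
  such pairs.
\<close>

lemma sublattice_symmetric:
  assumes "p + q \<in> sublattice l"
  shows "q + p \<in> sublattice l" "cocycle r g p q = cocycle r g q p"
proof -
  define a b x y where "a = shift_part p" "b = shift_part q" "x = lin_part p" "y = lin_part q"
  note defs = this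
  have F: "x \<in> F2" "y \<in> F2" by (simp_all add: defs lin_part_in_F2)
  obtain c where xy: "x ** y = mat 1" and c: "a + x *v b = int l *s c"
    using assms by (auto simp: sublattice_iff defs)
  have "x \<otimes>\<^bsub>SL2Z\<^esub> y = \<one>\<^bsub>SL2Z\<^esub>" using xy by (simp add: SL2Z_def)
  from group.inv_comm[OF group_SL2Z this] have yx: "y ** x = mat 1"
    using F subgroup.mem_carrier[OF subgroup_F2] by (simp add: SL2Z_def)
  have "y *v (a + x *v b) = int l *s (y *v c)" by (simp add: c matrix_scale)
  then have c': "b + y *v a = int l *s (y *v c)"
    by (simp add: matrix_vector_right_distrib matrix_vector_mul_assoc yx add.commute)
  then show "q + p \<in> sublattice l" unfolding sublattice_iff using yx by (auto simp: defs)
  have eqs: "x *v b = int l *s c - a" "y *v a = int l *s (y *v c) - b"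
    using c c' by (simp_all add: algebra_simps)
  have s: "sigma0 r u (int l *s v - u) = 1" for u v
  proof -
    have "u$1 * (int l *s v - u)$2 - u$2 * (int l *s v - u)$1 = int l * (u$1 * v$2 - u$2 * v$1)"
      by (simp add: algebra_simps)
    then show ?thesis by (simp only: sigma0_def r_multiple)
  qed
  have "1 = g a (x ** y)" by (simp add: xy)
  also have "\<dots> = g (y *v a) x * g a y" by (rule g_mult[OF F])
  also have "g (y *v a) x = inverse (g b x)"
    unfolding eqs using g_add[OF F(1), of "int l *s (y *v c)" "- b"]
    by (simp add: g_multiple[OF F(1)] g_minus[OF F(1)])
  finally have "g a y = g b x"
    using g_norm[OF F(1), of b] by (auto simp: field_simps split: if_splits)
  then show "cocycle r g p q = cocycle r g q p"
    unfolding cocycle_parts defs[symmetric] eqs s by simp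
qed

lemma inj_square: "inj_on (\<lambda>(i, j). transl (int l *s vector [i, j])) X"
proof (rule inj_onI, clarify)
  fix i j i' j' :: int
  assume "transl (int l *s vector [i, j]) = transl (int l *s vector [i', j'])"
  then have "int l *s (vector [i, j] :: int^2) = int l *s vector [i', j']" by (metis parts_simps(1))
  then show "i = i' \<and> j = j'" using l(1) by (simp add: vec_eq_iff forall_2)
qed

lemma card_square: "finite (lattice_square l n)" "card (lattice_square l n) = n * n"
  unfolding lattice_square_def by (simp_all add: card_image[OF inj_square])

lemma vector_state_square:
  "cinner (L p (unit_indicator (lattice_square l n))) (unit_indicator (lattice_square l n))
    = (if p \<in> sublattice l then of_nat (card {h \<in> lattice_square l n. - p + h \<in> lattice_square l n}) / of_nat (n * n) else 0)"
proof -
  let ?B = "lattice_square l n"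
  let ?\<xi> = "unit_indicator ?B"
  have B: "?B \<subseteq> sublattice l" by (auto simp: lattice_square_def sublattice_def)
  have sub: "p \<in> sublattice l" if "- p + h \<in> sublattice l" "h \<in> sublattice l" for h
  proof -
    obtain a b where ab: "- p + h = transl (int l *s a)" "h = transl (int l *s b)"
      using \<open>- p + h \<in> _\<close> \<open>h \<in> _\<close> by (auto simp: sublattice_def)
    then have "p + transl (int l *s a) = transl (int l *s b)" by (metis add_minus_cancel)
    then have "p = transl (int l *s b) + transl (- (int l *s a))"
      by (metis add.assoc add.right_neutral parts_simps(1) right_minus transl_eq_0 transl_plus)
    also have "\<dots> = transl (int l *s (b - a))" unfolding transl_plus by (simp add: vec_eq_iff algebra_simps)
    finally show ?thesis unfolding sublattice_def by blast
  qed
  have one: "cocycle r g p (- p + h) = 1" if "p \<in> sublattice l" "- p + h \<in> sublattice l" for h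
    using that by (auto simp: sublattice_def cocycle_trans sigma0_multiple)
  have at: "ell2_at (L p ?\<xi>) h = (if - p + h \<in> ?B \<and> p \<in> sublattice l then 1 / sqrt (card ?B) else 0)"
    if h: "h \<in> ?B" for h
    using sub[of h] one[of h] B h by (auto simp: L_at unit_indicator.rep_eq card_square)
  have "cinner (L p ?\<xi>) ?\<xi>
      = (\<Sum>h\<in>?B. if - p + h \<in> ?B \<and> p \<in> sublattice l then 1 / complex_of_real (sqrt (card ?B)) else 0) / sqrt (card ?B)"
    unfolding cinner_unit_indicator[OF card_square(1)]
    by (simp add: at if_distrib[of complex_of_real] cong: if_cong)
  also have "\<dots> = (if p \<in> sublattice l then of_nat (card {h \<in> ?B. - p + h \<in> ?B}) / of_nat (n * n) else 0)"
    by (simp add: sum.If_cases card_square Int_def of_real_mult[symmetric] del: of_real_mult)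
  finally show ?thesis .
qed

lemma card_square_shift:
  "card {h \<in> lattice_square l n. - transl (int l *s c) + h \<in> lattice_square l n} = nat (int n - \<bar>c$1\<bar>) * nat (int n - \<bar>c$2\<bar>)"
proof -
  let ?f = "\<lambda>(i, j). transl (int l *s vector [i, j])"
  let ?I = "\<lambda>c. {i \<in> {0..<int n}. i - c \<in> {0..<int n}}"
  have shift: "- transl (int l *s c) + ?f (i, j) = ?f (i - c$1, j - c$2)" for i j
  proof -
    have "?f (i, j) = transl (int l *s c) + ?f (i - c$1, j - c$2)"
      by (simp add: transl_plus, rule arg_cong[where f = transl])
        (simp add: vec_eq_iff forall_2 algebra_simps)
    then show ?thesis by simp
  qed
  have mem: "?f (i, j) \<in> lattice_square l n \<longleftrightarrow> i \<in> {0..<int n} \<and> j \<in> {0..<int n}" for i j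
    unfolding lattice_square_def using inj_on_image_mem_iff[OF inj_square, of "(i, j)" UNIV "{0..<int n} \<times> {0..<int n}"] by simp
  have "{h \<in> lattice_square l n. - transl (int l *s c) + h \<in> lattice_square l n} = ?f ` (?I (c$1) \<times> ?I (c$2))"
  proof (intro equalityI subsetI)
    fix h assume h: "h \<in> {h \<in> lattice_square l n. - transl (int l *s c) + h \<in> lattice_square l n}"
    then obtain i j where ij: "h = ?f (i, j)" "i \<in> {0..<int n}" "j \<in> {0..<int n}" by (auto simp: lattice_square_def)
    then have "?f (i - c$1, j - c$2) \<in> lattice_square l n" using h shift by simp
    then have "i - c$1 \<in> {0..<int n}" "j - c$2 \<in> {0..<int n}" using mem by blast+
    then show "h \<in> ?f ` (?I (c$1) \<times> ?I (c$2))" using ij by blast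
  next
    fix h assume "h \<in> ?f ` (?I (c$1) \<times> ?I (c$2))"
    then obtain i j where ij: "h = ?f (i, j)" "i \<in> ?I (c$1)" "j \<in> ?I (c$2)" by blast
    then have "?f (i, j) \<in> lattice_square l n" "?f (i - c$1, j - c$2) \<in> lattice_square l n" using mem by blast+
    then show "h \<in> {h \<in> lattice_square l n. - transl (int l *s c) + h \<in> lattice_square l n}" using ij(1) shift by simp
  qed
  then show ?thesis
    by (simp only: card_image[OF inj_square] card_cartesian_product card_interval_shift)
qed

text \<open>
  Translating a large square by a fixed sublattice vector changes only a small proportion of it, so
  the vector states of the squares converge to the characteristic function of the sublattice.
\<close>

lemma torsion_obstruction: "\<not> cstar_simple (cocycle r g)" "\<not> unique_trace_property (cocycle r g)"
proof -
  define \<phi> :: "Z2F2 \<Rightarrow> complex" where "\<phi> p = (if p \<in> sublattice l then 1 else 0)" for p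
  define \<xi> where "\<xi> n = unit_indicator (lattice_square l (Suc n))" for n
  have unit: "norm (\<xi> n) = 1" for n
  proof -
    have "lattice_square l (Suc n) \<noteq> {}" using card_square(2)[of "Suc n"] by auto
    then show ?thesis unfolding \<xi>_def by (intro norm_unit_indicator card_square)
  qed
  have lim: "(\<lambda>n. cinner (L p (\<xi> n)) (\<xi> n)) \<longlonglongrightarrow> \<phi> p" for p
  proof (cases "p \<in> sublattice l")
    case True
    then obtain c where c: "p = transl (int l *s c)" by (auto simp: sublattice_def)
    have "(\<lambda>n. (real (nat (int n - \<bar>c$1\<bar>)) / n) * (real (nat (int n - \<bar>c$2\<bar>)) / n)) \<longlonglongrightarrow> 1 * 1"
      by (intro tendsto_mult shift_ratio_tendsto)
    then have "(\<lambda>n. complex_of_real ((real (nat (int n - \<bar>c$1\<bar>)) / n) * (real (nat (int n - \<bar>c$2\<bar>)) / n))) \<longlonglongrightarrow> complex_of_real (1 * 1)"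
      by (rule tendsto_of_real)
    then have "(\<lambda>n. of_nat (card {h \<in> lattice_square l n. - p + h \<in> lattice_square l n}) / of_nat (n * n)) \<longlonglongrightarrow> (1 :: complex)"
      by (simp add: c card_square_shift)
    from LIMSEQ_Suc[OF this] show ?thesis
      using True unfolding \<xi>_def vector_state_square \<phi>_def by (simp only: if_True)
  next
    case False
    then show ?thesis by (simp add: \<xi>_def vector_state_square \<phi>_def)
  qed
  have sym: "cocycle r g p q * \<phi> (p + q) = cocycle r g q p * \<phi> (q + p)" for p q
    using sublattice_symmetric[of p q] sublattice_symmetric(1)[of q p] by (auto simp: \<phi>_def)
  have "int l *s e1 \<noteq> 0" using l(1) by (simp add: vec_eq_iff forall_2 e1_def)
  then have "transl (int l *s e1) \<noteq> 0" by simp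
  moreover have "\<phi> (transl (int l *s e1)) = 1" by (auto simp: \<phi>_def sublattice_def)
  ultimately show "\<not> cstar_simple (cocycle r g)" "\<not> unique_trace_property (cocycle r g)"
    by (rule limit_state_obstruction[OF unit lim sym])+
qed

end

end

theorem proposition5p14:
  fixes \<mu>\<^sub>0 \<mu>\<^sub>1 \<mu>\<^sub>2 r :: complex
    and g :: "int^2 \<Rightarrow> int^2^2 \<Rightarrow> complex"
  assumes "cmod \<mu>\<^sub>0 = 1" and "cmod \<mu>\<^sub>1 = 1" and "cmod \<mu>\<^sub>2 = 1"
    and "r\<^sup>2 = \<mu>\<^sub>0"
    and "is_g \<mu>\<^sub>1 \<mu>\<^sub>2 g"
  shows "(cstar_simple (cocycle r g) \<longleftrightarrow> unique_trace_property (cocycle r g)) \<and>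
         (unique_trace_property (cocycle r g) \<longleftrightarrow>
            nontorsion \<mu>\<^sub>0 \<or> nontorsion \<mu>\<^sub>1 \<or> nontorsion \<mu>\<^sub>2)"
proof -
  have "(cmod r)\<^sup>2 = 1" using assms(1,4) by (metis norm_power)
  then have "cmod r = 1" by (metis norm_ge_zero power2_eq_1_iff le_minus_one_simps(3) not_one_le_zero)
  then interpret lattice_cocycle r \<mu>\<^sub>1 \<mu>\<^sub>2 g using assms(5) by unfold_locales
  show ?thesis
  proof (cases "nontorsion \<mu>\<^sub>0 \<or> nontorsion \<mu>\<^sub>1 \<or> nontorsion \<mu>\<^sub>2")
    case True
    then have averages_vanish using nontorsion_averages_vanish assms(4) by simp
    then show ?thesis
      using simple_if_averages_vanish unique_trace_if_averages_vanish True by blast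
  next
    case False
    then obtain n0 n1 n2 :: nat
      where n: "n0 > 0" "\<mu>\<^sub>0 ^ n0 = 1" "n1 > 0" "\<mu>\<^sub>1 ^ n1 = 1" "n2 > 0" "\<mu>\<^sub>2 ^ n2 = 1"
      unfolding nontorsion_def by blast
    \<comment> \<open>The factor \<open>2\<close> is there because \<open>r\<close> is only a square root of \<open>\<mu>\<^sub>0\<close>.\<close>
    define l where "l = 2 * n0 * n1 * n2"
    have "r ^ l = ((r\<^sup>2) ^ n0) ^ (n1 * n2)" "\<mu>\<^sub>1 ^ l = (\<mu>\<^sub>1 ^ n1) ^ (2 * n0 * n2)"
      "\<mu>\<^sub>2 ^ l = (\<mu>\<^sub>2 ^ n2) ^ (2 * n0 * n1)"
      unfolding l_def power_mult[symmetric] by (simp_all add: mult_ac)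
    then have "l > 0" "r ^ l = 1" "\<mu>\<^sub>1 ^ l = 1" "\<mu>\<^sub>2 ^ l = 1"
      using n assms(4) by (simp_all add: l_def)
    then show ?thesis using torsion_obstruction False by blast
  qed
qed

end
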